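(* Under the same setting as the weak consistency theorem (true parameter $(\boldsymbol\theta_0,\boldsymbol\pi_0)\in\Xi$, i.i.d. data $X_1,X_2,\dots$ from $f(\cdot;(\boldsymbol\theta_0,\boldsymbol\pi_0))$, prior $\Pi$ as described below), for every $\epsilon>0$, with $\mathcal W_\epsilon=\{(\boldsymbol\theta,\boldsymbol\pi)\in\Xi:(\int_{\mathcal V_{n,p}}(\sqrt{f(X;(\boldsymbol\theta_0,\boldsymbol\pi_0))}-\sqrt{f(X;(\boldsymbol\theta,\boldsymbol\pi))})^2[dX])^{1/2}<\epsilon\}$, $$\Pi(\mathcal W_\epsilon^c\mid X_1,\dots,X_N)\to0\quad\text{almost surely under }F_{\boldsymbol\theta_0,\boldsymbol\pi_0}^\infty\text{ as }N\to\infty.$$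
   Context: $\mathcal V_{n,p}=\{X\in\mathbb R^{n\times p}:X^TX=I_p\}$ ($n\ge p$) with normalized Haar probability measure $[dX]$; $\widetilde{\mathcal V}_{n,p}=\{X\in\mathcal V_{n,p}:X_{1j}>0\ \forall j\}$; $\mathcal S_p=\{(d_1,\dots,d_p):0<d_p<\cdots<d_1\}$; ${}_0F_1\!\left(\tfrac n2,\tfrac{D^2}{4}\right)=\int_{\mathcal V_{n,p}}\exp\big(\sum_j d_jX_{jj}\big)[dX]$, $D=\mathrm{diag}(\boldsymbol d)$. $f_{ML}(X;(M,\boldsymbol d,V))=\mathrm{etr}(VDM^TX)/{}_0F_1(\tfrac n2,\tfrac{D^2}4)$. $\boldsymbol\Theta=\widetilde{\mathcal V}_{n,p}^C\times\mathcal S_p^C\times\mathcal V_{p,p}^C$, $\mathbb S_\pi=\{\boldsymbol\pi\in(0,1)^C:\sum_c\pi_c=1\}$, $\Xi=\boldsymbol\Theta\times\mathbb S_\pi$, $f(X;(\boldsymbol\theta,\boldsymbol\pi))=\sum_{c=1}^C\pi_cf_{ML}(X;\theta_c)$; $F^\infty_{\boldsymbol\theta_0,\boldsymbol\pi_0}$ is the infinite product of the distribution with density $f(\cdot;(\boldsymbol\theta_0,\boldsymbol\pi_0))$. Prior $\Pi$: independently across components, $M_c$ has density $\propto\mathrm{etr}(G_c^TM_c)$ on $\widetilde{\mathcal V}_{n,p}$, $V_c$ has density $\propto\mathrm{etr}(H_c^TV_c)$ on $\mathcal V_{p,p}$, $\boldsymbol d_c$ has Lebesgue density on $\mathcal S_p$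 proportional to $\exp(\nu_c\boldsymbol\eta_c^T\boldsymbol d_c)/[{}_0F_1(\tfrac n2,\tfrac{D_c^2}4)]^{\nu_c}$ with $\nu_c>0$, $\max_j\eta_{cj}<1$, and $\boldsymbol\pi\sim\mathrm{Dirichlet}(\alpha_1,\dots,\alpha_C)$, $\alpha_c>0$. Posterior: $\Pi(A\mid X_{1:N})=\int_AR_N\,d\Pi/\int_\Xi R_N\,d\Pi$ with $R_N(\boldsymbol\theta,\boldsymbol\pi)=\prod_{i=1}^Nf(X_i;(\boldsymbol\theta,\boldsymbol\pi))/f(X_i;(\boldsymbol\theta_0,\boldsymbol\pi_0))$. *)

theory Defs
  imports "HOL-Probability.Probability"
begin

text \<open>Matrices are represented by functions on index pairs (row, column),
  indices starting at 0; an n x p matrix is an element of the extensional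
  function space on {..<n} x {..<p}.  Vectors of length p are extensional
  functions on {..<p}.\<close>

type_synonym mat = "nat \<times> nat \<Rightarrow> real"
type_synonym vec = "nat \<Rightarrow> real"

definition matspace :: "nat \<Rightarrow> nat \<Rightarrow> mat measure" where
  "matspace n p = PiM ({..<n} \<times> {..<p}) (\<lambda>_. lborel)"

definition vecspace :: "nat \<Rightarrow> vec measure" where
  "vecspace p = PiM {..<p} (\<lambda>_. lborel)"

definition stiefel :: "nat \<Rightarrow> nat \<Rightarrow> mat set" where
  "stiefel n p = {X \<in> PiE ({..<n} \<times> {..<p}) (\<lambda>_. UNIV).
      \<forall>j<p. \<forall>k<p. (\<Sum>i<n. X (i,j) * X (i,k)) = (if j = k then 1 else 0)}"

definition stiefel_pos :: "nat \<Rightarrow> nat \<Rightarrow> mat set" where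
  "stiefel_pos n p = {X \<in> stiefel n p. \<forall>j<p. X (0,j) > 0}"

definition left_mult :: "nat \<Rightarrow> nat \<Rightarrow> mat \<Rightarrow> mat \<Rightarrow> mat" where
  "left_mult n p Q X = restrict (\<lambda>(i,j). \<Sum>l<n. Q (i,l) * X (l,j)) ({..<n} \<times> {..<p})"

text \<open>Normalized Haar probability measure on V_{n,p}: the (unique)
  probability measure concentrated on V_{n,p} that is invariant under the
  action of the orthogonal group O(n) = V_{n,n}.\<close>
definition haar :: "nat \<Rightarrow> nat \<Rightarrow> mat measure" where
  "haar n p = (THE \<mu>. sets \<mu> = sets (matspace n p) \<and> prob_space \<mu> \<and>
      emeasure \<mu> (stiefel n p) = 1 \<and>
      (\<forall>Q\<in>stiefel n n. distr \<mu> (matspace n p) (left_mult n p Q) = \<mu>))"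

text \<open>0F1(n/2, D^2/4) = integral over V_{n,p} of exp(sum_j d_j X_jj).\<close>
definition hyp0F1 :: "nat \<Rightarrow> nat \<Rightarrow> vec \<Rightarrow> real" where
  "hyp0F1 n p d = (\<integral>X. exp (\<Sum>j<p. d j * X (j,j)) \<partial>haar n p)"

definition Sp :: "nat \<Rightarrow> vec set" where
  "Sp p = {d \<in> PiE {..<p} (\<lambda>_. UNIV). (\<forall>j<p. 0 < d j) \<and> (\<forall>j. Suc j < p \<longrightarrow> d (Suc j) < d j)}"

definition pi_simplex :: "nat \<Rightarrow> vec set" where
  "pi_simplex C = {q \<in> PiE {..<C} (\<lambda>_. UNIV). (\<forall>c<C. 0 < q c \<and> q c < 1) \<and> (\<Sum>c<C. q c) = 1}"

type_synonym comp_param = "mat \<times> vec \<times> mat"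
type_synonym param = "(nat \<Rightarrow> comp_param) \<times> vec"

definition Theta :: "nat \<Rightarrow> nat \<Rightarrow> nat \<Rightarrow> (nat \<Rightarrow> comp_param) set" where
  "Theta n p C = PiE {..<C} (\<lambda>c. stiefel_pos n p \<times> Sp p \<times> stiefel p p)"

definition Xi :: "nat \<Rightarrow> nat \<Rightarrow> nat \<Rightarrow> param set" where
  "Xi n p C = Theta n p C \<times> pi_simplex C"

text \<open>Matrix Langevin density w.r.t. Haar measure: etr(V D M^T X) / 0F1.\<close>
definition fML :: "nat \<Rightarrow> nat \<Rightarrow> comp_param \<Rightarrow> mat \<Rightarrow> real" where
  "fML n p th X = (case th of (M, d, V) \<Rightarrow>
      exp (\<Sum>j<p. \<Sum>k<p. V (j,k) * d k * (\<Sum>i<n. M (i,k) * X (i,j))) / hyp0F1 n p d)"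

definition fmix :: "nat \<Rightarrow> nat \<Rightarrow> nat \<Rightarrow> param \<Rightarrow> mat \<Rightarrow> real" where
  "fmix n p C t X = (case t of (th, q) \<Rightarrow> \<Sum>c<C. q c * fML n p (th c) X)"

definition sample_dist :: "nat \<Rightarrow> nat \<Rightarrow> nat \<Rightarrow> param \<Rightarrow> mat measure" where
  "sample_dist n p C t = density (haar n p) (\<lambda>X. ennreal (fmix n p C t X))"

definition hell :: "nat \<Rightarrow> nat \<Rightarrow> nat \<Rightarrow> param \<Rightarrow> param \<Rightarrow> real" where
  "hell n p C t0 t = sqrt (\<integral>X. (sqrt (fmix n p C t0 X) - sqrt (fmix n p C t X))\<^sup>2 \<partial>haar n p)"

definition normdens :: "'a measure \<Rightarrow> 'a set \<Rightarrow> ('a \<Rightarrow> real) \<Rightarrow> 'a measure" where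
  "normdens \<mu> A g = density \<mu> (\<lambda>x. ennreal (indicator A x * g x / (\<integral>y. indicator A y * g y \<partial>\<mu>)))"

definition dirichlet :: "nat \<Rightarrow> vec \<Rightarrow> vec measure" where
  "dirichlet C alpha =
     (let complete_last = (\<lambda>x::vec. restrict (\<lambda>c. if c < C - 1 then x c else 1 - (\<Sum>k<C - 1. x k)) {..<C})
      in distr (density (vecspace (C - 1))
             (\<lambda>x. ennreal (indicator {x. (\<forall>c<C - 1. 0 < x c) \<and> (\<Sum>c<C - 1. x c) < 1} x *
                  (Gamma (\<Sum>c<C. alpha c) / (\<Prod>c<C. Gamma (alpha c))) *
                  (\<Prod>c<C. (complete_last x c) powr (alpha c - 1)))))
           (vecspace C) complete_last)"

text \<open>The prior Pi.  Hyperparameters: G c (n x p), H c (p x p), nu c > 0,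
  eta c (vector of length p), alpha c > 0.\<close>
definition prior_M :: "nat \<Rightarrow> nat \<Rightarrow> mat \<Rightarrow> mat measure" where
  "prior_M n p G = normdens (haar n p) (stiefel_pos n p)
      (\<lambda>M. exp (\<Sum>i<n. \<Sum>j<p. G (i,j) * M (i,j)))"

definition prior_V :: "nat \<Rightarrow> mat \<Rightarrow> mat measure" where
  "prior_V p H = normdens (haar p p) (stiefel p p)
      (\<lambda>V. exp (\<Sum>i<p. \<Sum>j<p. H (i,j) * V (i,j)))"

definition prior_d :: "nat \<Rightarrow> nat \<Rightarrow> real \<Rightarrow> vec \<Rightarrow> vec measure" where
  "prior_d n p nu eta = normdens (vecspace p) (Sp p)
      (\<lambda>d. exp (nu * (\<Sum>j<p. eta j * d j)) / (hyp0F1 n p d) powr nu)"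

definition prior :: "nat \<Rightarrow> nat \<Rightarrow> nat \<Rightarrow> (nat \<Rightarrow> mat) \<Rightarrow> (nat \<Rightarrow> mat) \<Rightarrow> (nat \<Rightarrow> real)
     \<Rightarrow> (nat \<Rightarrow> vec) \<Rightarrow> vec \<Rightarrow> param measure" where
  "prior n p C G H nu eta alpha =
     (PiM {..<C} (\<lambda>c. prior_M n p (G c) \<Otimes>\<^sub>M (prior_d n p (nu c) (eta c) \<Otimes>\<^sub>M prior_V p (H c))))
       \<Otimes>\<^sub>M dirichlet C alpha"

definition lik_ratio :: "nat \<Rightarrow> nat \<Rightarrow> nat \<Rightarrow> param \<Rightarrow> (nat \<Rightarrow> mat) \<Rightarrow> nat \<Rightarrow> param \<Rightarrow> real" where
  "lik_ratio n p C t0 xs N t = (\<Prod>i<N. fmix n p C t (xs i) / fmix n p C t0 (xs i))"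

definition posterior :: "nat \<Rightarrow> nat \<Rightarrow> nat \<Rightarrow> param measure \<Rightarrow> param \<Rightarrow> (nat \<Rightarrow> mat) \<Rightarrow> nat
     \<Rightarrow> param set \<Rightarrow> ennreal" where
  "posterior n p C Pr t0 xs N A =
     (\<integral>\<^sup>+ t. indicator A t * ennreal (lik_ratio n p C t0 xs N t) \<partial>Pr) /
     (\<integral>\<^sup>+ t. indicator (Xi n p C) t * ennreal (lik_ratio n p C t0 xs N t) \<partial>Pr)"

end

theory Submission
  imports Defs
begin

text \<open>The density of one component depends on the parameter only through the matrix \<open>M D V\<^sup>T\<close> and the
  vector \<open>d\<close>, and \<open>\<bar>X i j\<bar> \<le> 1\<close> on the Stiefel manifold, so nearby parameters have densities that are
  close up to a factor, uniformly in \<open>X\<close>.  Two consequences replace testing and laws of large numbers.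

  Cut the parameter space into countably many cells, by a grid of small mesh in these coordinates.  If a
  cell contains a point at Hellinger distance at least \<open>\<epsilon>\<close> from the truth \<open>f\<^sub>0\<close>, then all its densities lie
  below a common envelope \<open>u\<close> with \<open>\<integral> sqrt (f\<^sub>0 u) \<le> r < 1\<close>.  Hence the square root of the integral of the
  likelihood ratio over the cell has expectation at most \<open>r\<^sup>N\<close> times the square root of the prior mass of
  the cell.  These square roots are summable over all cells because the prior has an exponential moment
  in \<open>d\<close>, which is where \<open>\<eta>\<^sub>j < 1\<close> enters.  So the numerator of the posterior is almost surely \<open>O(r\<^sup>N)\<close>.

  Near the true parameter \<open>f \<ge> exp (- \<beta>) f\<^sub>0\<close> holds everywhere, so the denominator is at least
  \<open>exp (- \<beta> N)\<close> times the prior mass of a neighbourhood, which is positive; take \<open>exp (- \<beta>) = sqrt r\<close>.\<close>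

section \<open>Rotation invariance of Lebesgue measure\<close>

text \<open>\<open>haar\<close> is a definite description, so integrals against it say nothing
  before existence and uniqueness of the invariant measure are proved. Both rest on rotation
  invariance of Lebesgue measure: existence orthonormalises random vectors, uniqueness identifies
  every invariant law with the first columns of a random orthogonal matrix. Uniqueness also yields
  right invariance, which normalises the component densities; transitivity of the rotations yields
  full support. The vectors \<open>d\<close> are unbounded, so there are infinitely many cells and
  their prior masses must decay. Square roots are taken because sqrt (u / f0) has mean below 1,
  while u / f0 has mean above 1. They pass through the sum over cells since a sum of squares is at
  most the square of the sum. Half of the affinity gap \<epsilon>^2/2 is given to the excess mass of
  the envelopes, hence r = 1 - \<epsilon>^2/4, kept at least 1/2. With s = sqrt r, summability of
  s^N makes the sum of the square roots O(s^N) almost surely; its square beats a denominator of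
  order s^N by a factor s^N.\<close>

lemma sigma_finite_PiM_lborel:
  "finite I \<Longrightarrow> sigma_finite_measure (PiM I (\<lambda>_. lborel :: real measure))"
proof -
  interpret product_sigma_finite "\<lambda>_. lborel :: real measure" by standard
  show "finite I \<Longrightarrow> sigma_finite_measure (PiM I (\<lambda>_. lborel :: real measure))"
    by (rule sigma_finite)
qed

text \<open>Translations map boxes to boxes, so on these generators the claim is one-dimensional
  translation invariance, coordinate by coordinate. Rotation invariance is derived below from
  translations and Fubini, without a change of variables formula.\<close>

lemma nn_integral_PiM_lborel_translate:
  fixes a :: "'i \<Rightarrow> real"
  assumes I: "finite I" and h[measurable]: "h \<in> borel_measurable (PiM I (\<lambda>_. lborel))"
  shows "(\<integral>\<^sup>+x. h (\<lambda>i\<in>I. x i + a i) \<partial>PiM I (\<lambda>_. lborel)) = (\<integral>\<^sup>+x. h x \<partial>PiM I (\<lambda>_. lborel))"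
proof -
  interpret product_sigma_finite "\<lambda>_. lborel :: real measure" by standard
  let ?L = "PiM I (\<lambda>_. lborel :: real measure)"
  let ?T = "\<lambda>x. \<lambda>i\<in>I. x i + a i"
  have T[measurable]: "?T \<in> measurable ?L ?L" by (rule measurable_restrict) measurable
  have "distr ?L ?L ?T = ?L"
  proof (rule PiM_eqI[OF I])
    fix A :: "'i \<Rightarrow> real set" assume A: "\<And>i. i \<in> I \<Longrightarrow> A i \<in> sets lborel"
    have *: "?T -` PiE I A \<inter> space ?L = PiE I (\<lambda>i. {x. x + a i \<in> A i})"
      by (auto simp: space_PiM PiE_iff extensional_def)
    have **: "emeasure lborel {x. x + a i \<in> A i} = emeasure lborel (A i)" "{x. x + a i \<in> A i} \<in> sets borel"
      if i: "i \<in> I" for i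
    proof -
      have "emeasure lborel (A i) = emeasure (distr lborel borel ((+) (a i))) (A i)"
        by (simp add: lborel_distr_plus)
      also have "\<dots> = emeasure lborel {x. x + a i \<in> A i}"
        using A[OF i] by (subst emeasure_distr) (auto simp: vimage_def add.commute)
      finally show "emeasure lborel {x. x + a i \<in> A i} = emeasure lborel (A i)" by simp
      have "(\<lambda>x. x + a i) -` A i \<inter> space borel \<in> sets borel"
        by (rule measurable_sets[OF _ A[OF i, unfolded sets_lborel]]) measurable
      then show "{x. x + a i \<in> A i} \<in> sets borel" by (simp add: vimage_def)
    qed
    have "PiE I A \<in> sets ?L" using A by (intro sets_PiM_I_finite I) auto
    then have "emeasure (distr ?L ?L ?T) (PiE I A) = emeasure ?L (PiE I (\<lambda>i. {x. x + a i \<in> A i}))"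
      by (simp add: emeasure_distr *)
    also have "\<dots> = (\<Prod>i\<in>I. emeasure lborel (A i))"
      using ** by (subst emeasure_PiM[OF I]) (auto intro!: prod.cong)
    finally show "emeasure (distr ?L ?L ?T) (PiE I A) = (\<Prod>i\<in>I. emeasure lborel (A i))" .
  qed simp
  then have "(\<integral>\<^sup>+x. h x \<partial>?L) = (\<integral>\<^sup>+x. h x \<partial>distr ?L ?L ?T)" by simp
  also have "\<dots> = (\<integral>\<^sup>+x. h (?T x) \<partial>?L)" by (rule nn_integral_distr) measurable
  finally show ?thesis by simp
qed

section \<open>Orthonormal frames: isometry, Bessel's identity, rows and entries\<close>

definition mat_vec :: "nat \<Rightarrow> mat \<Rightarrow> vec \<Rightarrow> vec" where
  "mat_vec n Q z = (\<lambda>i\<in>{..<n}. \<Sum>l<n. Q (i,l) * z l)"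

lemma stiefel_col: "X \<in> stiefel n p \<Longrightarrow> j < p \<Longrightarrow> k < p \<Longrightarrow> (\<Sum>i<n. X (i,j) * X (i,k)) = (if j = k then 1 else 0)"
  by (simp add: stiefel_def)

lemma stiefel_ext: "X \<in> stiefel n p \<Longrightarrow> X \<in> extensional ({..<n} \<times> {..<p})"
  by (simp add: stiefel_def PiE_iff)

lemma mult_if_delta: "(a::real) * (if P then 1 else 0) = (if P then a else 0)"
  "(if P then 1 else 0) * (a::real) = (if P then a else 0)"
  by auto

text \<open>Orthonormal columns make c -> X c an isometry: expanding both factors leaves the Gram
  matrix of X, which is the identity.\<close>

lemma stiefel_frame_inner:
  assumes X: "X \<in> stiefel n p"
  shows "(\<Sum>l<n. (\<Sum>k<p. X (l,k) * c k) * (\<Sum>k<p. X (l,k) * e k)) = (\<Sum>k<p. c k * e k)"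
proof -
  have "(\<Sum>l<n. (\<Sum>k<p. X (l,k) * c k) * (\<Sum>k<p. X (l,k) * e k))
    = (\<Sum>l<n. \<Sum>k<p. \<Sum>m<p. (X (l,k) * c k) * (X (l,m) * e m))"
    by (simp add: sum_product)
  also have "\<dots> = (\<Sum>k<p. \<Sum>m<p. \<Sum>l<n. (X (l,k) * c k) * (X (l,m) * e m))"
    by (subst sum.swap, rule sum.cong[OF refl], subst sum.swap, rule refl)
  also have "\<dots> = (\<Sum>k<p. \<Sum>m<p. c k * e m * (\<Sum>l<n. X (l,k) * X (l,m)))"
    by (simp add: sum_distrib_left mult_ac)
  also have "\<dots> = (\<Sum>k<p. \<Sum>m<p. if k = m then c k * e m else 0)"
    by (intro sum.cong refl) (auto simp: stiefel_col[OF X])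
  also have "\<dots> = (\<Sum>k<p. c k * e k)"
    by simp
  finally show ?thesis .
qed

lemma stiefel_frame_norm:
  "X \<in> stiefel n p \<Longrightarrow> (\<Sum>l<n. (\<Sum>k<p. X (l,k) * c k)\<^sup>2) = (\<Sum>k<p. (c k)\<^sup>2)"
  using stiefel_frame_inner[of X n p c c] by (simp add: power2_eq_square)

text \<open>Pythagoras for the projection onto the span of the columns: with c = X^T z, both the
  inner product of z with X c and the squared norm of X c equal the squared norm of c.\<close>

lemma stiefel_residual_norm:
  assumes X: "X \<in> stiefel n p"
  shows "(\<Sum>l<n. (z l - (\<Sum>k<p. X (l,k) * (\<Sum>i<n. X (i,k) * z i)))\<^sup>2)
    = (\<Sum>l<n. (z l)\<^sup>2) - (\<Sum>k<p. (\<Sum>i<n. X (i,k) * z i)\<^sup>2)"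
proof -
  define c where "c k = (\<Sum>i<n. X (i,k) * z i)" for k
  have "(\<Sum>l<n. z l * (\<Sum>k<p. X (l,k) * c k)) = (\<Sum>k<p. (c k)\<^sup>2)"
  proof -
    have "(\<Sum>l<n. z l * (\<Sum>k<p. X (l,k) * c k)) = (\<Sum>l<n. \<Sum>k<p. c k * (X (l,k) * z l))"
      by (simp add: sum_distrib_left mult_ac)
    also have "\<dots> = (\<Sum>k<p. c k * c k)"
      by (subst sum.swap) (simp add: c_def sum_distrib_left)
    finally show ?thesis by (simp add: power2_eq_square)
  qed
  moreover have "(\<Sum>l<n. (z l - (\<Sum>k<p. X (l,k) * c k))\<^sup>2)
    = (\<Sum>l<n. (z l)\<^sup>2) - 2 * (\<Sum>l<n. z l * (\<Sum>k<p. X (l,k) * c k)) + (\<Sum>l<n. (\<Sum>k<p. X (l,k) * c k)\<^sup>2)"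
    by (simp add: power2_diff sum.distrib sum_subtractf sum_distrib_left mult.assoc)
  ultimately show ?thesis
    by (simp add: stiefel_frame_norm[OF X] flip: c_def)
qed

text \<open>The case of the unit vector e_i, whose coefficients form row i. Since the left side is a
  sum of squares, row norms are at most 1.\<close>

lemma stiefel_bessel:
  assumes X: "X \<in> stiefel n p" and i: "i < n"
  shows "(\<Sum>l<n. ((if l = i then 1 else 0) - (\<Sum>k<p. X (l,k) * X (i,k)))\<^sup>2) = 1 - (\<Sum>k<p. (X (i,k))\<^sup>2)"
proof -
  have "(\<Sum>l<n. (if l = i then 1 else 0 :: real)\<^sup>2) = (\<Sum>l<n. if l = i then 1 else 0)"
    by (intro sum.cong) auto
  also have "\<dots> = 1" using i by simp
  finally show ?thesis
    using stiefel_residual_norm[OF X, of "\<lambda>l. if l = i then 1 else 0"] i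
    by (simp add: mult_if_delta)
qed

text \<open>Counted by columns. Compared with the row norms it shows that a square frame has unit
  rows, and that p < n forces a row of norm below 1.\<close>

lemma stiefel_sum_sq:
  assumes X: "X \<in> stiefel n p"
  shows "(\<Sum>i<n. \<Sum>k<p. (X (i,k))\<^sup>2) = p"
  using stiefel_col[OF X] by (subst sum.swap) (simp add: power2_eq_square)

lemma stiefel_entry_le:
  assumes X: "X \<in> stiefel n p" and i: "i < n" and j: "j < p"
  shows "\<bar>X (i,j)\<bar> \<le> 1"
proof -
  have "(X (i,j))\<^sup>2 \<le> (\<Sum>l<n. (X (l,j))\<^sup>2)"
    using i by (intro member_le_sum) auto
  also have "\<dots> = 1" using stiefel_col[OF X j j] by (simp add: power2_eq_square)
  finally show ?thesis by (simp add: abs_square_le_1)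
qed

text \<open>\<open>stiefel\<close> speaks of columns only. The n squared row norms are at most 1 and
  sum to n, so each is 1; then the Bessel residual of e_i vanishes, entry by entry.\<close>

lemma stiefel_row:
  assumes Q: "Q \<in> stiefel n n" and i: "i < n" and l: "l < n"
  shows "(\<Sum>k<n. Q (l,k) * Q (i,k)) = (if l = i then 1 else 0)"
proof -
  have nn: "0 \<le> 1 - (\<Sum>k<n. (Q (i,k))\<^sup>2)" if "i < n" for i
    by (subst stiefel_bessel[OF Q that, symmetric]) (rule sum_nonneg, simp)
  have "(\<Sum>i<n. 1 - (\<Sum>k<n. (Q (i,k))\<^sup>2)) = 0"
    by (simp add: sum_subtractf stiefel_sum_sq[OF Q])
  then have "1 - (\<Sum>k<n. (Q (i,k))\<^sup>2) = 0"
    using nn i by (subst (asm) sum_nonneg_eq_0_iff) auto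
  then have "(\<Sum>l<n. ((if l = i then 1 else 0) - (\<Sum>k<n. Q (l,k) * Q (i,k)))\<^sup>2) = 0"
    by (simp add: stiefel_bessel[OF Q i])
  then have "((if l = i then 1 else 0) - (\<Sum>k<n. Q (l,k) * Q (i,k)))\<^sup>2 = 0"
    using l by (subst (asm) sum_nonneg_eq_0_iff) auto
  then show ?thesis by simp
qed

section \<open>Boxes, the unit ball, and Lebesgue integrals under orthogonal maps\<close>

definition sqnorm :: "nat \<Rightarrow> vec \<Rightarrow> real" where "sqnorm n x = (\<Sum>i<n. (x i)\<^sup>2)"

lemma sqnorm_cong: "(\<And>i. i < n \<Longrightarrow> x i = y i) \<Longrightarrow> sqnorm n x = sqnorm n y"
  by (simp add: sqnorm_def)

lemma sqnorm_measurable[measurable]: "sqnorm n \<in> borel_measurable (PiM {..<n} (\<lambda>_. lborel))"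
  unfolding sqnorm_def by measurable

definition vec_box :: "nat \<Rightarrow> vec \<Rightarrow> real \<Rightarrow> vec set" where
  "vec_box m x r = PiE {..<m} (\<lambda>j. {x j - r<..<x j + r})"

lemma vec_box_sets: "vec_box m x r \<in> sets (vecspace m)"
  unfolding vec_box_def vecspace_def by (rule sets_PiM_I_finite) auto

lemma vec_box_pos:
  assumes r: "r > 0" shows "emeasure (vecspace m) (vec_box m x r) > 0"
proof -
  interpret product_sigma_finite "\<lambda>_. lborel :: real measure" by standard
  have "emeasure lborel {x j - r<..<x j + r} = ennreal (2 * r)" for j
    using r by (subst emeasure_lborel_Ioo) auto
  then have "emeasure (vecspace m) (vec_box m x r) = ennreal (2 * r) ^ m"
    unfolding vecspace_def vec_box_def by (subst emeasure_PiM) (simp_all del: emeasure_lborel_Ioo)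
  moreover have "ennreal (2 * r) \<noteq> 0" using r by simp
  ultimately show ?thesis by (metis power_not_zero zero_less_iff_neq_zero)
qed

lemma vec_boxD: "y \<in> vec_box m x r \<Longrightarrow> j < m \<Longrightarrow> \<bar>y j - x j\<bar> < r"
proof -
  assume "y \<in> vec_box m x r" "j < m"
  then have "y j \<in> {x j - r<..<x j + r}"
    unfolding vec_box_def by (intro PiE_mem[of y "{..<m}" "\<lambda>j. {x j - r<..<x j + r}" j]) simp_all
  then show "\<bar>y j - x j\<bar> < r" unfolding greaterThanLessThan_iff by linarith
qed

text \<open>The ball lies between two boxes. Both bounds are needed to cancel its measure in an
  equation and to normalise the uniform distribution on it.\<close>

lemma emeasure_unit_ball:
  fixes n :: nat
  shows "emeasure (vecspace n) {x \<in> space (vecspace n). sqnorm n x < 1} > 0"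
    "emeasure (vecspace n) {x \<in> space (vecspace n). sqnorm n x < 1} < \<infinity>"
proof -
  interpret product_sigma_finite "\<lambda>_. lborel :: real measure" by standard
  let ?B = "{x \<in> space (vecspace n). sqnorm n x < 1}"
  have B: "?B \<in> sets (vecspace n)" unfolding vecspace_def by measurable
  have "?B \<subseteq> PiE {..<n} (\<lambda>_. {-1..1})"
  proof
    fix x assume x: "x \<in> ?B"
    have "\<bar>x i\<bar> \<le> 1" if "i < n" for i
    proof -
      have "(x i)\<^sup>2 \<le> sqnorm n x" unfolding sqnorm_def using that by (intro member_le_sum) auto
      then show ?thesis using x by (simp add: abs_square_le_1[symmetric])
    qed
    then show "x \<in> PiE {..<n} (\<lambda>_. {-1..1})" using x
      by (auto simp: vecspace_def space_PiM PiE_iff abs_le_iff)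
  qed
  then have "emeasure (vecspace n) ?B \<le> emeasure (vecspace n) (PiE {..<n} (\<lambda>_. {-1..1}))"
    by (intro emeasure_mono) (auto simp: vecspace_def intro!: sets_PiM_I_finite)
  also have "\<dots> = (\<Prod>i<n. 2)" unfolding vecspace_def by (subst emeasure_PiM) auto
  also have "\<dots> < \<infinity>" by (simp add: less_top[symmetric] power_eq_top_ennreal)
  finally show "emeasure (vecspace n) ?B < \<infinity>" .
  \<comment> \<open>A point of this box has squared norm at most n / (n + 1)^2 < 1, also for n =
    0.\<close>
  let ?r = "1 / (real n + 1)"
  have "vec_box n (\<lambda>_. 0) ?r \<subseteq> ?B"
  proof
    fix x assume x: "x \<in> vec_box n (\<lambda>_. 0) ?r"
    have "(x i)\<^sup>2 \<le> ?r\<^sup>2" if "i < n" for i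
      using vec_boxD[OF x that] by (subst abs_le_square_iff[symmetric]) simp
    then have "sqnorm n x \<le> real (card {..<n}) * ?r\<^sup>2" unfolding sqnorm_def by (intro sum_bounded_above) auto
    also have "real (card {..<n}) * ?r\<^sup>2 < 1"
    proof -
      have "real n < (real n + 1)\<^sup>2" by (simp add: power2_sum add_nonneg_pos)
      then show ?thesis by (simp add: power_divide)
    qed
    finally show "x \<in> ?B" using x sets.sets_into_space[OF vec_box_sets] by blast
  qed
  then have "emeasure (vecspace n) (vec_box n (\<lambda>_. 0) ?r) \<le> emeasure (vecspace n) ?B"
    by (intro emeasure_mono B)
  moreover have "emeasure (vecspace n) (vec_box n (\<lambda>_. 0) ?r) > 0" by (rule vec_box_pos) simp
  ultimately show "emeasure (vecspace n) ?B > 0" by order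
qed

lemma mat_vec_measurable[measurable]: "mat_vec n Q \<in> measurable (PiM {..<n} (\<lambda>_. lborel)) (PiM {..<n} (\<lambda>_. lborel))"
  unfolding mat_vec_def by (rule measurable_restrict) measurable

lemma sqnorm_mat_vec: "Q \<in> stiefel n n \<Longrightarrow> sqnorm n (mat_vec n Q z) = sqnorm n z"
  using stiefel_frame_norm[of Q n n z] by (simp add: sqnorm_def mat_vec_def)

text \<open>With \<open>b\<close> the indicator of the unit ball, the double integral of \<open>b x * h (Q y)\<close> is transformed by the
  translations \<open>y \<mapsto> y + Q\<^sup>T x\<close> and \<open>x \<mapsto> x - Q y\<close> only; the ball is invariant under \<open>Q\<close>.\<close>
lemma nn_integral_vecspace_mat_vec:
  assumes Q: "Q \<in> stiefel n n" and h: "h \<in> borel_measurable (vecspace n)"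
  shows "(\<integral>\<^sup>+z. h (mat_vec n Q z) \<partial>vecspace n) = (\<integral>\<^sup>+z. h z \<partial>vecspace n)"
proof -
  let ?L = "PiM {..<n} (\<lambda>_. lborel :: real measure)"
  have L: "vecspace n = ?L" by (simp add: vecspace_def)
  have h[measurable]: "h \<in> borel_measurable ?L" using h by (simp add: L)
  interpret S: sigma_finite_measure ?L by (rule sigma_finite_PiM_lborel) simp
  interpret P: pair_sigma_finite ?L ?L ..
  define b :: "vec \<Rightarrow> ennreal" where "b x = (if sqnorm n x < 1 then 1 else 0)" for x
  have b[measurable]: "b \<in> borel_measurable ?L" unfolding b_def by measurable
  \<comment> \<open>\<open>T x\<close> is Q^T x. Shifting y by it turns Q y into x + Q y, because
    the rows of Q are orthonormal too (\<open>mT\<close>).\<close>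
  define T where "T x = (\<lambda>i\<in>{..<n}. \<Sum>l<n. Q (l,i) * x l)" for x :: vec
  define tr where "tr x a = (\<lambda>i\<in>{..<n}. x i + a i)" for x a :: vec
  \<comment> \<open>\<open>u x y\<close> is x - Q y.\<close>
  define u where "u x y = tr x (\<lambda>i. - mat_vec n Q y i)" for x y
  have tr: "(\<integral>\<^sup>+x. g (tr x a) \<partial>?L) = (\<integral>\<^sup>+x. g x \<partial>?L)" if "g \<in> borel_measurable ?L" for g :: "vec \<Rightarrow> ennreal" and a
    unfolding tr_def using that by (rule nn_integral_PiM_lborel_translate[OF finite_lessThan])
  have comp[measurable]: "(\<lambda>y. fst y i) \<in> borel_measurable (?L \<Otimes>\<^sub>M ?L)" "(\<lambda>y. snd y i) \<in> borel_measurable (?L \<Otimes>\<^sub>M ?L)" if "i \<in> {..<n}" for i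
    by (measurable, rule that)+
  have m1: "(\<lambda>(x,y). tr x (mat_vec n Q y)) \<in> measurable (?L \<Otimes>\<^sub>M ?L) ?L"
    unfolding tr_def mat_vec_def case_prod_beta by (rule measurable_restrict) (simp, measurable)
  have m2: "(\<lambda>(x,y). u x y) \<in> measurable (?L \<Otimes>\<^sub>M ?L) ?L"
    unfolding u_def tr_def mat_vec_def case_prod_beta by (rule measurable_restrict) (simp, measurable)
  note hm1 = measurable_compose[OF m1 h] and bm2 = measurable_compose[OF m2 b]
  have f1: "(\<lambda>(x,y). b x * h (tr x (mat_vec n Q y))) \<in> borel_measurable (?L \<Otimes>\<^sub>M ?L)"
    using borel_measurable_times_ennreal[OF measurable_compose[OF measurable_fst b] hm1]
    by (simp add: case_prod_beta)
  have f2: "(\<lambda>(x,y). b (u x y) * h x) \<in> borel_measurable (?L \<Otimes>\<^sub>M ?L)"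
    using borel_measurable_times_ennreal[OF bm2 measurable_compose[OF measurable_fst h]]
    by (simp add: case_prod_beta)
  have mT: "mat_vec n Q (tr y (T x)) = tr x (mat_vec n Q y)" for x y
  proof -
    have "(\<Sum>l<n. Q (i,l) * (\<Sum>k<n. Q (k,l) * x k)) = x i" if i: "i < n" for i
    proof -
      have "(\<Sum>l<n. Q (i,l) * (\<Sum>k<n. Q (k,l) * x k)) = (\<Sum>k<n. x k * (\<Sum>l<n. Q (k,l) * Q (i,l)))"
        by (simp add: sum_distrib_left, subst sum.swap, simp add: mult_ac)
      also have "\<dots> = (\<Sum>k<n. if k = i then x k else 0)"
        by (intro sum.cong refl) (simp add: stiefel_row[OF Q i])
      finally show ?thesis using i by simp
    qed
    then show ?thesis
      by (auto simp: mat_vec_def tr_def T_def fun_eq_iff ring_distribs sum.distrib)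
  qed
  \<comment> \<open>The shift of y by Q^T x turns x - Q y into - Q y, which has the norm of y; so
    the integral does not depend on x.\<close>
  have b': "(\<integral>\<^sup>+y. b (u x y) \<partial>?L) = (\<integral>\<^sup>+y. b y \<partial>?L)" for x
  proof -
    have "(\<lambda>y. u x y) \<in> measurable ?L ?L"
      unfolding u_def tr_def mat_vec_def by (rule measurable_restrict) (simp, measurable)
    from measurable_compose[OF this b]
    have "(\<integral>\<^sup>+y. b (u x y) \<partial>?L) = (\<integral>\<^sup>+y. b (u x (tr y (T x))) \<partial>?L)"
      by (rule tr[symmetric])
    also have "\<dots> = (\<integral>\<^sup>+y. b (\<lambda>i. - mat_vec n Q y i) \<partial>?L)"
      unfolding b_def by (intro nn_integral_cong if_cong arg_cong[where f="\<lambda>x. x < 1"] sqnorm_cong refl)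
        (use mT in \<open>simp add: u_def tr_def fun_eq_iff\<close>)
    also have "\<dots> = (\<integral>\<^sup>+y. b y \<partial>?L)"
      using sqnorm_mat_vec[OF Q] by (simp add: b_def sqnorm_def)
    finally show ?thesis .
  qed
  define K where "K = (\<integral>\<^sup>+x. b x \<partial>?L)"
  have "b x = indicator {x \<in> space ?L. sqnorm n x < 1} x" if "x \<in> space ?L" for x
    using that by (simp add: b_def indicator_def)
  then have "K = (\<integral>\<^sup>+x. indicator {x \<in> space ?L. sqnorm n x < 1} x \<partial>?L)"
    unfolding K_def by (rule nn_integral_cong)
  also have "\<dots> = emeasure ?L {x \<in> space ?L. sqnorm n x < 1}"
    by (rule nn_integral_indicator) measurable
  finally have K: "K \<noteq> 0" "K \<noteq> \<infinity>" using emeasure_unit_ball[of n] by (auto simp: L)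
  have "K * (\<integral>\<^sup>+z. h (mat_vec n Q z) \<partial>?L) = (\<integral>\<^sup>+x. b x * (\<integral>\<^sup>+y. h (mat_vec n Q y) \<partial>?L) \<partial>?L)"
    unfolding K_def by (rule nn_integral_multc[symmetric]) measurable
  also have "\<dots> = (\<integral>\<^sup>+x. b x * (\<integral>\<^sup>+y. h (mat_vec n Q (tr y (T x))) \<partial>?L) \<partial>?L)"
    by (intro nn_integral_cong arg_cong2[where f="(*)"] refl tr[symmetric]) measurable
  also have "\<dots> = (\<integral>\<^sup>+x. (\<integral>\<^sup>+y. b x * h (tr x (mat_vec n Q y)) \<partial>?L) \<partial>?L)"
    unfolding mT
    by (intro nn_integral_cong nn_integral_cmult[symmetric] measurable_Pair2[OF measurable_compose[OF m1 h], unfolded case_prod_conv])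
  also have "\<dots> = (\<integral>\<^sup>+y. (\<integral>\<^sup>+x. b x * h (tr x (mat_vec n Q y)) \<partial>?L) \<partial>?L)"
    by (rule P.Fubini'[symmetric, OF f1])
  also have "\<dots> = (\<integral>\<^sup>+y. (\<integral>\<^sup>+x. b (u x y) * h x \<partial>?L) \<partial>?L)"
  proof (rule nn_integral_cong)
    fix y
    let ?g = "\<lambda>x. b (u x y) * h x"
    have "?g \<in> borel_measurable ?L"
    proof -
      have "(\<lambda>x. u x y) \<in> measurable ?L ?L"
        unfolding u_def tr_def mat_vec_def by (rule measurable_restrict) (simp, measurable)
      from measurable_compose[OF this b] show ?thesis by measurable
    qed
    from tr[OF this, of "mat_vec n Q y"]
    have "(\<integral>\<^sup>+x. ?g x \<partial>?L) = (\<integral>\<^sup>+x. ?g (tr x (mat_vec n Q y)) \<partial>?L)" by simp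
    also have "\<dots> = (\<integral>\<^sup>+x. b x * h (tr x (mat_vec n Q y)) \<partial>?L)"
      unfolding b_def by (intro nn_integral_cong arg_cong2[where f="(*)"] if_cong arg_cong[where f="\<lambda>x. x < 1"] sqnorm_cong refl)
        (simp add: u_def tr_def)
    finally show "(\<integral>\<^sup>+x. b x * h (tr x (mat_vec n Q y)) \<partial>?L) = (\<integral>\<^sup>+x. ?g x \<partial>?L)" by simp
  qed
  also have "\<dots> = (\<integral>\<^sup>+x. (\<integral>\<^sup>+y. b (u x y) * h x \<partial>?L) \<partial>?L)"
    by (rule P.Fubini'[OF f2])
  also have "\<dots> = (\<integral>\<^sup>+x. (\<integral>\<^sup>+y. b (u x y) \<partial>?L) * h x \<partial>?L)"
    by (intro nn_integral_cong nn_integral_multc measurable_Pair2[OF measurable_compose[OF m2 b], unfolded case_prod_conv])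
  also have "\<dots> = K * (\<integral>\<^sup>+x. h x \<partial>?L)"
    unfolding b' K_def by (rule nn_integral_cmult) measurable
  finally have "K * (\<integral>\<^sup>+z. h (mat_vec n Q z) \<partial>?L) = K * (\<integral>\<^sup>+x. h x \<partial>?L)" .
  then show ?thesis using K by (simp add: L ennreal_mult_cancel_left)
qed

section \<open>Existence and uniqueness of Haar measure on the Stiefel manifold\<close>

text \<open>The restriction makes all results extensional, so that matrices with equal entries are
  equal as functions (\<open>mat_eqI\<close>).\<close>

definition matmul :: "nat \<Rightarrow> nat \<Rightarrow> nat \<Rightarrow> mat \<Rightarrow> mat \<Rightarrow> mat" where
  "matmul n m p A B = restrict (\<lambda>(i,j). \<Sum>l<m. A (i,l) * B (l,j)) ({..<n} \<times> {..<p})"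

definition transp :: "nat \<Rightarrow> mat \<Rightarrow> mat" where
  "transp n A = restrict (\<lambda>(i,j). A (j,i)) ({..<n} \<times> {..<n})"

definition cols :: "nat \<Rightarrow> nat \<Rightarrow> mat \<Rightarrow> mat" where
  "cols n p A = restrict A ({..<n} \<times> {..<p})"

lemma left_mult_eq: "left_mult n p = matmul n n p"
  by (simp add: fun_eq_iff left_mult_def matmul_def)

lemma matmul_apply: "i < n \<Longrightarrow> j < p \<Longrightarrow> matmul n m p A B (i,j) = (\<Sum>l<m. A (i,l) * B (l,j))"
  by (simp add: matmul_def)

lemma transp_apply: "i < n \<Longrightarrow> j < n \<Longrightarrow> transp n A (i,j) = A (j,i)"
  by (simp add: transp_def)

lemma cols_apply: "i < n \<Longrightarrow> j < p \<Longrightarrow> cols n p A (i,j) = A (i,j)"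
  by (simp add: cols_def)

lemma matmul_ext: "matmul n m p A B \<in> extensional ({..<n} \<times> {..<p})"
  by (simp add: matmul_def)

lemma mat_eqI:
  assumes "A \<in> extensional ({..<n} \<times> {..<p})" "B \<in> extensional ({..<n} \<times> {..<p})"
    "\<And>i j. i < n \<Longrightarrow> j < p \<Longrightarrow> A (i,j) = B (i,j)"
  shows "A = B"
  using assms by (intro extensionalityI[of A _ B]) auto

lemma matmul_assoc: "matmul n p q (matmul n m p A B) C = matmul n m q A (matmul m p q B C)"
proof (rule mat_eqI[OF matmul_ext matmul_ext])
  fix i j assume ij: "i < n" "j < q"
  have "(\<Sum>l<p. (\<Sum>k<m. A (i,k) * B (k,l)) * C (l,j)) = (\<Sum>k<m. A (i,k) * (\<Sum>l<p. B (k,l) * C (l,j)))"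
    by (simp add: sum_distrib_left sum_distrib_right mult.assoc, subst sum.swap, rule refl)
  then show "matmul n p q (matmul n m p A B) C (i,j) = matmul n m q A (matmul m p q B C) (i,j)"
    using ij by (simp add: matmul_apply)
qed

lemma stiefelI:
  "X \<in> extensional ({..<n} \<times> {..<p}) \<Longrightarrow>
   (\<And>j k. j < p \<Longrightarrow> k < p \<Longrightarrow> (\<Sum>i<n. X (i,j) * X (i,k)) = (if j = k then 1 else 0)) \<Longrightarrow> X \<in> stiefel n p"
  by (auto simp: stiefel_def PiE_iff)

lemma matmul_stiefel:
  assumes A: "A \<in> stiefel n m" and B: "B \<in> stiefel m p"
  shows "matmul n m p A B \<in> stiefel n p"
  using stiefel_frame_inner[OF A] stiefel_col[OF B]
  by (intro stiefelI matmul_ext) (simp add: matmul_apply)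

lemma transp_stiefel: "Q \<in> stiefel n n \<Longrightarrow> transp n Q \<in> stiefel n n"
  by (rule stiefelI) (auto simp: transp_def stiefel_row)

lemma transp_transp: "A \<in> extensional ({..<n} \<times> {..<n}) \<Longrightarrow> transp n (transp n A) = A"
  by (rule mat_eqI[of _ n n]) (auto simp: transp_def)

lemma transp_matmul: "transp n (matmul n n n A B) = matmul n n n (transp n B) (transp n A)"
  by (rule mat_eqI[of _ n n]) (auto simp: transp_def matmul_def mult.commute)

lemma matmul_transp_cancel:
  assumes Q: "Q \<in> stiefel n n" and X: "X \<in> extensional ({..<n} \<times> {..<p})"
  shows "matmul n n p (transp n Q) (matmul n n p Q X) = X"
proof (rule mat_eqI[OF matmul_ext X])
  fix i j assume ij: "i < n" "j < p"
  have "(\<Sum>l<n. Q (l,i) * (\<Sum>k<n. Q (l,k) * X (k,j))) = (\<Sum>k<n. (\<Sum>l<n. Q (l,i) * Q (l,k)) * X (k,j))"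
    by (simp add: sum_distrib_left sum_distrib_right mult.assoc, subst sum.swap, rule refl)
  also have "\<dots> = (\<Sum>k<n. if i = k then X (k,j) else 0)"
    using ij by (intro sum.cong refl) (auto simp: stiefel_col[OF Q])
  finally show "matmul n n p (transp n Q) (matmul n n p Q X) (i,j) = X (i,j)"
    using ij by (simp add: matmul_apply transp_apply)
qed

lemma matmul_cols: "p \<le> n \<Longrightarrow> matmul n n p A (cols n p B) = cols n p (matmul n n n A B)"
  by (rule mat_eqI[of _ n p]) (auto simp: matmul_def cols_def)

lemma space_matspace: "space (matspace n p) = extensional ({..<n} \<times> {..<p})"
  by (simp add: matspace_def space_PiM PiE_def)

lemma stiefel_space: "X \<in> stiefel n p \<Longrightarrow> X \<in> space (matspace n p)"
  using stiefel_ext by (simp add: space_matspace)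

lemma mat_component:
  "i < n \<Longrightarrow> j < p \<Longrightarrow> (\<lambda>X. X (i,j)) \<in> borel_measurable (matspace n p)"
  unfolding matspace_def using measurable_component_singleton[of "(i,j)" "{..<n} \<times> {..<p}" "\<lambda>_. lborel :: real measure"] by simp

lemma measurable_matI:
  "(\<And>i j. i < n \<Longrightarrow> j < p \<Longrightarrow> (\<lambda>x. g x i j) \<in> borel_measurable M) \<Longrightarrow>
   (\<lambda>x. restrict (\<lambda>(i,j). g x i j) ({..<n} \<times> {..<p})) \<in> measurable M (matspace n p)"
  unfolding matspace_def by (rule measurable_restrict) auto

lemma matmul_measurable[measurable (raw)]:
  assumes A: "A \<in> measurable M (matspace n m)" and B: "B \<in> measurable M (matspace m p)"
  shows "(\<lambda>x. matmul n m p (A x) (B x)) \<in> measurable M (matspace n p)"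
  unfolding matmul_def
proof (rule measurable_matI)
  fix i j assume ij: "i < n" "j < p"
  show "(\<lambda>x. \<Sum>l<m. A x (i,l) * B x (l,j)) \<in> borel_measurable M"
    using ij by (intro borel_measurable_sum borel_measurable_times measurable_compose[OF A] measurable_compose[OF B] mat_component) auto
qed

lemma transp_measurable[measurable]: "transp n \<in> measurable (matspace n n) (matspace n n)"
  unfolding transp_def by (rule measurable_matI) (rule mat_component)

lemma cols_measurable[measurable]: "p \<le> m \<Longrightarrow> cols n p \<in> measurable (matspace n m) (matspace n p)"
  unfolding cols_def using measurable_matI[of n p "\<lambda>X i j. X (i,j)" "matspace n m"]
  by (simp add: case_prod_eta mat_component)

lemma stiefel_sets[measurable]: "stiefel n p \<in> sets (matspace n p)"
proof -
  have "stiefel n p = {X \<in> space (matspace n p). \<forall>j\<in>{..<p}. \<forall>k\<in>{..<p}. (\<Sum>i<n. X (i,j) * X (i,k)) = (if j = k then 1 else 0)}"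
    by (auto simp: stiefel_def space_matspace PiE_def)
  also have "\<dots> \<in> sets (matspace n p)"
    by (intro sets.sets_Collect_finite_All borel_measurable_eq borel_measurable_sum
          borel_measurable_times mat_component borel_measurable_const) auto
  finally show ?thesis .
qed

section \<open>Gram-Schmidt steps, completion of frames, almost sure independence\<close>

definition residual :: "nat \<Rightarrow> nat \<Rightarrow> mat \<Rightarrow> vec \<Rightarrow> vec" where
  "residual n p X z = (\<lambda>i. z i - (\<Sum>k<p. X (i,k) * (\<Sum>l<n. X (l,k) * z l)))"

text \<open>One Gram-Schmidt step. If the residual vanishes, division by zero yields a zero column
  and the result is no frame; this case is excluded by a hypothesis or has probability zero.\<close>

definition append_col :: "nat \<Rightarrow> nat \<Rightarrow> mat \<Rightarrow> vec \<Rightarrow> mat" where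
  "append_col n p X z = restrict (\<lambda>(i,j). if j < p then X (i,j)
      else residual n p X z i / sqrt (sqnorm n (residual n p X z))) ({..<n} \<times> {..<Suc p})"

lemma residual_orthogonal:
  assumes X: "X \<in> stiefel n p" and j: "j < p"
  shows "(\<Sum>i<n. X (i,j) * residual n p X z i) = 0"
proof -
  define c where "c k = (\<Sum>l<n. X (l,k) * z l)" for k
  have "(\<Sum>i<n. X (i,j) * (\<Sum>k<p. X (i,k) * c k)) = (\<Sum>k<p. (\<Sum>i<n. X (i,j) * X (i,k)) * c k)"
    by (simp add: sum_distrib_left sum_distrib_right mult.assoc, subst sum.swap, rule refl)
  also have "\<dots> = (\<Sum>k<p. if j = k then c k else 0)"
    by (intro sum.cong refl) (simp add: stiefel_col[OF X j])
  also have "\<dots> = c j" using j by simp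
  finally show ?thesis
    by (simp add: residual_def right_diff_distrib sum_subtractf flip: c_def)
qed

lemma append_col_stiefel:
  assumes X: "X \<in> stiefel n p" and z: "sqnorm n (residual n p X z) \<noteq> 0"
  shows "append_col n p X z \<in> stiefel n (Suc p)"
proof (rule stiefelI)
  let ?r = "residual n p X z"
  let ?s = "sqrt (sqnorm n ?r)"
  have nn: "0 \<le> sqnorm n ?r" by (simp add: sqnorm_def sum_nonneg)
  have o: "(\<Sum>i<n. X (i,j) * ?r i / ?s) = 0" "(\<Sum>i<n. ?r i * X (i,j) / ?s) = 0" if "j < p" for j
    using residual_orthogonal[OF X that, of z] by (simp_all add: mult.commute flip: sum_divide_distrib)
  have s: "(\<Sum>i<n. ?r i * ?r i) / (?s * ?s) = 1"
    using z nn by (simp add: sqnorm_def power2_eq_square)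
  fix j k assume jk: "j < Suc p" "k < Suc p"
  show "(\<Sum>i<n. append_col n p X z (i,j) * append_col n p X z (i,k)) = (if j = k then 1 else 0)"
    using jk o s stiefel_col[OF X] nn by (auto simp: append_col_def less_Suc_eq sum_divide_distrib)
qed (simp add: append_col_def)

lemma cols_append_col: "X \<in> stiefel n p \<Longrightarrow> cols n p (append_col n p X z) = X"
  by (rule mat_eqI[OF _ stiefel_ext]) (auto simp: cols_def append_col_def)

text \<open>Otherwise the squared row norms, whose sum is p, would add up to at least n.\<close>

lemma stiefel_row_lt_1:
  assumes X: "X \<in> stiefel n p" and pn: "p < n"
  obtains i where "i < n" "(\<Sum>k<p. (X (i,k))\<^sup>2) < 1"
proof (rule ccontr)
  assume "\<not> thesis"
  then have "(\<Sum>i<n. 1) \<le> (\<Sum>i<n. \<Sum>k<p. (X (i,k))\<^sup>2)"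
    using that by (intro sum_mono) force
  then show False using pn by (simp add: stiefel_sum_sq[OF X])
qed

text \<open>Induction on the number of missing columns: a unit vector belonging to a row of norm
  below 1 has a nonzero residual and can be appended. In effect the rotations act transitively on
  frames.\<close>

lemma stiefel_completion:
  assumes "X \<in> stiefel n p" "p \<le> n"
  shows "\<exists>Q\<in>stiefel n n. X = cols n p Q"
  using assms
proof (induction "n - p" arbitrary: p X)
  case 0
  then show ?case using stiefel_ext[of X n n] by (intro bexI[of _ X]) (auto simp: cols_def extensional_restrict)
next
  case (Suc d)
  then have pn: "p < n" by simp
  obtain i where i: "i < n" "(\<Sum>k<p. (X (i,k))\<^sup>2) < 1" using stiefel_row_lt_1[OF Suc.prems(1) pn] .
  define z :: vec where "z l = (if l = i then 1 else 0)" for l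
  have "sqnorm n (residual n p X z) = 1 - (\<Sum>k<p. (X (i,k))\<^sup>2)"
    using stiefel_bessel[OF Suc.prems(1) i(1)] i(1) by (simp add: sqnorm_def residual_def z_def mult_if_delta)
  then have S: "append_col n p X z \<in> stiefel n (Suc p)"
    using i by (intro append_col_stiefel Suc.prems) auto
  have "d = n - Suc p" "Suc p \<le> n" using Suc.hyps(2) by auto
  from Suc.hyps(1)[OF this(1) S this(2)] obtain Q where Q: "Q \<in> stiefel n n" "append_col n p X z = cols n (Suc p) Q" by auto
  have "X = cols n p (cols n (Suc p) Q)" using cols_append_col[OF Suc.prems(1), of z] Q by simp
  also have "\<dots> = cols n p Q" by (rule mat_eqI[of _ n p]) (auto simp: cols_def)
  finally show ?case using Q by blast
qed

text \<open>Q preserves inner products, so the projection coefficients and the norm of the residual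
  stay the same and the residual itself is rotated by Q.\<close>

lemma append_col_equivariant:
  assumes X: "X \<in> stiefel n p" and Q: "Q \<in> stiefel n n"
  shows "append_col n p (matmul n n p Q X) (mat_vec n Q z) = matmul n n (Suc p) Q (append_col n p X z)"
proof -
  have r: "residual n p (matmul n n p Q X) (mat_vec n Q z) i = (\<Sum>l<n. Q (i,l) * residual n p X z l)" if i: "i < n" for i
  proof -
    have "(\<Sum>l<n. matmul n n p Q X (l,k) * mat_vec n Q z l) = (\<Sum>l<n. X (l,k) * z l)" if "k < p" for k
      using stiefel_frame_inner[OF Q, of "\<lambda>l. X (l,k)" z] that by (simp add: matmul_apply mat_vec_def)
    then have "residual n p (matmul n n p Q X) (mat_vec n Q z) i
      = (\<Sum>l<n. Q (i,l) * z l) - (\<Sum>k<p. (\<Sum>l<n. Q (i,l) * X (l,k)) * (\<Sum>l<n. X (l,k) * z l))"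
      using i by (simp add: residual_def mat_vec_def matmul_apply)
    also have "(\<Sum>k<p. (\<Sum>l<n. Q (i,l) * X (l,k)) * (\<Sum>l<n. X (l,k) * z l))
      = (\<Sum>l<n. Q (i,l) * (\<Sum>k<p. X (l,k) * (\<Sum>l<n. X (l,k) * z l)))"
      by (simp only: sum_distrib_right, subst sum.swap, simp add: sum_distrib_left mult.assoc)
    finally show ?thesis by (simp add: residual_def right_diff_distrib sum_subtractf)
  qed
  have s: "sqnorm n (residual n p (matmul n n p Q X) (mat_vec n Q z)) = sqnorm n (residual n p X z)"
    using stiefel_frame_norm[OF Q, of "residual n p X z"] r by (simp add: sqnorm_def)
  show ?thesis
  proof (rule mat_eqI[OF _ matmul_ext])
    fix i j assume ij: "i < n" "j < Suc p"
    show "append_col n p (matmul n n p Q X) (mat_vec n Q z) (i,j) = matmul n n (Suc p) Q (append_col n p X z) (i,j)"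
      using ij by (simp add: append_col_def matmul_apply s r sum_divide_distrib)
  qed (simp add: append_col_def)
qed

text \<open>Fubini in the coordinate i: for fixed other coordinates a single value of z i
  annihilates the form.\<close>

lemma AE_linear_form_nonzero:
  fixes a :: "'i \<Rightarrow> real"
  assumes I: "finite I" "i \<in> I" and a: "a i \<noteq> 0"
  shows "AE z in PiM I (\<lambda>_. lborel). (\<Sum>l\<in>I. a l * z l) \<noteq> 0"
proof -
  interpret product_sigma_finite "\<lambda>_. lborel :: real measure" by standard
  define J where "J = I - {i}"
  have J: "I = insert i J" "finite J" "i \<notin> J" using I by (auto simp: J_def)
  let ?N = "{z \<in> space (PiM I (\<lambda>_. lborel)). (\<Sum>l\<in>I. a l * z l) = 0}"
  have m: "(\<lambda>z. \<Sum>l\<in>I. a l * z l) \<in> borel_measurable (PiM I (\<lambda>_. lborel))" by measurable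
  have N: "?N \<in> sets (PiM I (\<lambda>_. lborel))" using m by measurable
  have "emeasure (PiM I (\<lambda>_. lborel)) ?N = (\<integral>\<^sup>+z. indicator ?N z \<partial>PiM (insert i J) (\<lambda>_. lborel))"
    using N by (simp add: J(1))
  also have "\<dots> = (\<integral>\<^sup>+x. (\<integral>\<^sup>+y. indicator ?N (x(i := y)) \<partial>lborel) \<partial>PiM J (\<lambda>_. lborel))"
    using N J by (intro product_nn_integral_insert) auto
  also have "\<dots> = (\<integral>\<^sup>+x. 0 \<partial>PiM J (\<lambda>_. lborel :: real measure))"
  proof (rule nn_integral_cong)
    fix x assume "x \<in> space (PiM J (\<lambda>_. lborel :: real measure))"
    let ?c = "- (\<Sum>l\<in>J. a l * x l) / a i"
    have "(\<Sum>l\<in>I. a l * (x(i := y)) l) = a i * y + (\<Sum>l\<in>J. a l * x l)" for y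
      using J by (auto intro!: sum.cong)
    then have "(\<integral>\<^sup>+y. indicator ?N (x(i := y)) \<partial>lborel) \<le> (\<integral>\<^sup>+y. indicator {?c} y \<partial>lborel)"
      using a by (intro nn_integral_mono) (auto simp: indicator_def field_simps)
    also have "\<dots> = 0" by (subst nn_integral_indicator) auto
    finally show "(\<integral>\<^sup>+y. indicator ?N (x(i := y)) \<partial>lborel) = 0" by simp
  qed
  finally have "emeasure (PiM I (\<lambda>_. lborel)) ?N = 0" by simp
  then show ?thesis using N by (intro AE_I[of _ _ ?N]) auto
qed

text \<open>Coordinate i of the residual is a linear form in z whose i-th coefficient is 1 minus the
  squared norm of row i; it is nonzero for a suitable row.\<close>

lemma AE_residual_nonzero:
  assumes X: "X \<in> stiefel n p" and pn: "p < n"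
  shows "AE z in vecspace n. sqnorm n (residual n p X z) \<noteq> 0"
proof -
  obtain i where i: "i < n" "(\<Sum>k<p. (X (i,k))\<^sup>2) < 1" using stiefel_row_lt_1[OF X pn] .
  define a where "a l = (if l = i then 1 else 0) - (\<Sum>k<p. X (i,k) * X (l,k))" for l
  have "a i \<noteq> 0" using i by (simp add: a_def power2_eq_square)
  then have "AE z in vecspace n. (\<Sum>l<n. a l * z l) \<noteq> 0"
    unfolding vecspace_def using i by (intro AE_linear_form_nonzero) auto
  then show ?thesis
  proof eventually_elim
    case (elim z)
    have "(\<Sum>l<n. a l * z l) = residual n p X z i"
      using i(1) by (simp add: a_def residual_def left_diff_distrib sum_subtractf mult_if_delta sum_distrib_left sum_distrib_right mult.assoc)
        (subst sum.swap, rule refl)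
    then have "0 < (residual n p X z i)\<^sup>2" using elim by simp
    also have "\<dots> \<le> sqnorm n (residual n p X z)"
      unfolding sqnorm_def using i(1) by (intro member_le_sum) auto
    finally show ?case by simp
  qed
qed

section \<open>Invariant measures: symmetries, existence and uniqueness\<close>

text \<open>The predicate under the \<open>THE\<close> of \<open>haar\<close>, so that candidates
  can be compared before \<open>haar\<close> itself is known to satisfy it.\<close>

definition is_haar :: "nat \<Rightarrow> nat \<Rightarrow> mat measure \<Rightarrow> bool" where
  "is_haar n p \<mu> \<longleftrightarrow> sets \<mu> = sets (matspace n p) \<and> prob_space \<mu> \<and>
      emeasure \<mu> (stiefel n p) = 1 \<and>
      (\<forall>Q\<in>stiefel n n. distr \<mu> (matspace n p) (left_mult n p Q) = \<mu>)"

text \<open>Invariance is recast for integrals of nonnegative functions, the form in which Fubini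
  arguments use it; \<open>is_haarI\<close> goes back.\<close>

lemma is_haarD:
  assumes "is_haar n p \<mu>"
  shows is_haar_sets: "sets \<mu> = sets (matspace n p)" and is_haar_prob: "prob_space \<mu>"
    and is_haar_AE: "AE X in \<mu>. X \<in> stiefel n p"
    and is_haar_invariant: "Q \<in> stiefel n n \<Longrightarrow> h \<in> borel_measurable (matspace n p) \<Longrightarrow>
      (\<integral>\<^sup>+X. h (matmul n n p Q X) \<partial>\<mu>) = (\<integral>\<^sup>+X. h X \<partial>\<mu>)"
proof -
  note * = assms[unfolded is_haar_def]
  show s: "sets \<mu> = sets (matspace n p)" using * by simp
  show "prob_space \<mu>" using * by simp
  then interpret prob_space \<mu> .
  show "AE X in \<mu>. X \<in> stiefel n p"
    by (rule AE_prob_1) (use * in \<open>simp add: measure_def\<close>)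
  assume Q: "Q \<in> stiefel n n" and h[measurable]: "h \<in> borel_measurable (matspace n p)"
  note [simp] = stiefel_space[OF Q]
  have m[measurable_cong]: "sets \<mu> = sets (matspace n p)" by (rule s)
  have "(\<integral>\<^sup>+X. h X \<partial>\<mu>) = (\<integral>\<^sup>+X. h X \<partial>distr \<mu> (matspace n p) (left_mult n p Q))" using * Q by simp
  also have "\<dots> = (\<integral>\<^sup>+X. h (matmul n n p Q X) \<partial>\<mu>)"
    unfolding left_mult_eq by (rule nn_integral_distr) measurable
  finally show "(\<integral>\<^sup>+X. h (matmul n n p Q X) \<partial>\<mu>) = (\<integral>\<^sup>+X. h X \<partial>\<mu>)" by simp
qed

lemma is_haarI:
  assumes s: "sets \<mu> = sets (matspace n p)" and P: "prob_space \<mu>"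
    and S: "AE X in \<mu>. X \<in> stiefel n p"
    and inv: "\<And>Q h. Q \<in> stiefel n n \<Longrightarrow> h \<in> borel_measurable (matspace n p) \<Longrightarrow>
      (\<integral>\<^sup>+X. h (matmul n n p Q X) \<partial>\<mu>) = (\<integral>\<^sup>+X. h X \<partial>\<mu>)"
  shows "is_haar n p \<mu>"
  unfolding is_haar_def
proof (intro conjI ballI s P)
  interpret prob_space \<mu> by fact
  have m[measurable_cong]: "sets \<mu> = sets (matspace n p)" by (rule s)
  show "emeasure \<mu> (stiefel n p) = 1"
    using S by (subst emeasure_eq_1_AE) (auto simp: s)
  fix Q assume Q: "Q \<in> stiefel n n"
  note [simp] = stiefel_space[OF Q]
  have L[measurable]: "matmul n n p Q \<in> measurable \<mu> (matspace n p)" by measurable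
  show "distr \<mu> (matspace n p) (left_mult n p Q) = \<mu>"
    unfolding left_mult_eq
  proof (rule measure_eqI)
    fix A assume "A \<in> sets (distr \<mu> (matspace n p) (matmul n n p Q))"
    then have A[measurable]: "A \<in> sets (matspace n p)" by simp
    have "emeasure (distr \<mu> (matspace n p) (matmul n n p Q)) A = (\<integral>\<^sup>+X. indicator A (matmul n n p Q X) \<partial>\<mu>)"
      by (subst nn_integral_indicator[symmetric], simp, rule nn_integral_distr) measurable
    also have "\<dots> = (\<integral>\<^sup>+X. indicator A X \<partial>\<mu>)" by (rule inv[OF Q]) measurable
    also have "\<dots> = emeasure \<mu> A" by (simp add: s)
    finally show "emeasure (distr \<mu> (matspace n p) (matmul n n p Q)) A = emeasure \<mu> A" .
  qed (simp add: s)
qed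

text \<open>Evaluate the double integral of \<open>h (Q\<^sup>T R)\<close> in both orders.\<close>
lemma haar_transp_invariant:
  assumes H: "is_haar n n \<mu>" and h[measurable]: "h \<in> borel_measurable (matspace n n)"
  shows "(\<integral>\<^sup>+Q. h (transp n Q) \<partial>\<mu>) = (\<integral>\<^sup>+Q. h Q \<partial>\<mu>)"
proof -
  note [measurable_cong] = is_haar_sets[OF H]
  interpret prob_space \<mu> by (rule is_haar_prob[OF H])
  interpret P: pair_sigma_finite \<mu> \<mu> ..
  let ?f = "\<lambda>Q R. h (matmul n n n (transp n Q) R)"
  have "(\<integral>\<^sup>+Q. h Q \<partial>\<mu>) = (\<integral>\<^sup>+Q. (\<integral>\<^sup>+R. h R \<partial>\<mu>) \<partial>\<mu>)"
    by (simp add: emeasure_space_1)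
  also have "\<dots> = (\<integral>\<^sup>+Q. (\<integral>\<^sup>+R. ?f Q R \<partial>\<mu>) \<partial>\<mu>)"
    using is_haar_AE[OF H]
    by (intro nn_integral_cong_AE) (auto simp: is_haar_invariant[OF H transp_stiefel h])
  also have "\<dots> = (\<integral>\<^sup>+R. (\<integral>\<^sup>+Q. ?f Q R \<partial>\<mu>) \<partial>\<mu>)"
    by (rule P.Fubini'[symmetric]) measurable
  also have "\<dots> = (\<integral>\<^sup>+R. (\<integral>\<^sup>+Q. h (transp n Q) \<partial>\<mu>) \<partial>\<mu>)"
    using is_haar_AE[OF H]
  proof (intro nn_integral_cong_AE, eventually_elim)
    case (elim R)
    \<comment> \<open>Q^T R is the transpose of R^T Q, so for fixed R left invariance applies to the
      function h composed with transposition.\<close>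
    have "?f Q R = h (transp n (matmul n n n (transp n R) Q))" for Q
      using stiefel_ext[OF elim(2)] by (simp add: transp_matmul transp_transp)
    then show ?case
      using is_haar_invariant[OF H transp_stiefel[OF elim(2)], of "\<lambda>Q. h (transp n Q)"] by simp
  qed
  finally show ?thesis by (simp add: emeasure_space_1)
qed

text \<open>Transposition, which preserves the measure, exchanges right multiplication by R with
  left multiplication by R^T.\<close>

lemma haar_right_invariant_square:
  assumes H: "is_haar n n \<mu>" and h[measurable]: "h \<in> borel_measurable (matspace n n)"
    and R: "R \<in> stiefel n n"
  shows "(\<integral>\<^sup>+Q. h (matmul n n n Q R) \<partial>\<mu>) = (\<integral>\<^sup>+Q. h Q \<partial>\<mu>)"
proof -
  note [measurable_cong] = is_haar_sets[OF H]
  note [simp] = stiefel_space[OF R]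
  have "(\<integral>\<^sup>+Q. h (matmul n n n Q R) \<partial>\<mu>) = (\<integral>\<^sup>+Q. h (matmul n n n (transp n Q) R) \<partial>\<mu>)"
    by (rule haar_transp_invariant[OF H, symmetric]) measurable
  also have "\<dots> = (\<integral>\<^sup>+Q. h (transp n (matmul n n n (transp n R) Q)) \<partial>\<mu>)"
    using stiefel_ext[OF R] by (simp add: transp_matmul transp_transp)
  also have "\<dots> = (\<integral>\<^sup>+Q. h (transp n Q) \<partial>\<mu>)"
    by (rule is_haar_invariant[OF H transp_stiefel[OF R], of "\<lambda>Q. h (transp n Q)"]) measurable
  also have "\<dots> = (\<integral>\<^sup>+Q. h Q \<partial>\<mu>)" by (rule haar_transp_invariant[OF H h])
  finally show ?thesis .
qed

text \<open>Averaging \<open>Q X\<close> over both measures: the inner integral over \<open>Q\<close> does not depend on \<open>X\<close>, by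
  transitivity and right invariance.\<close>
lemma haar_as_cols:
  assumes H: "is_haar n n \<kappa>" and M: "is_haar n p \<mu>" and h[measurable]: "h \<in> borel_measurable (matspace n p)"
    and [simp]: "p \<le> n"
  shows "(\<integral>\<^sup>+X. h X \<partial>\<mu>) = (\<integral>\<^sup>+Q. h (cols n p Q) \<partial>\<kappa>)"
proof -
  note [measurable_cong] = is_haar_sets[OF H] is_haar_sets[OF M]
  interpret L: prob_space \<kappa> by (rule is_haar_prob[OF H])
  interpret M: prob_space \<mu> by (rule is_haar_prob[OF M])
  interpret P: pair_sigma_finite \<mu> \<kappa> ..
  have "(\<integral>\<^sup>+X. h X \<partial>\<mu>) = (\<integral>\<^sup>+Q. (\<integral>\<^sup>+X. h X \<partial>\<mu>) \<partial>\<kappa>)"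
    by (simp add: L.emeasure_space_1)
  also have "\<dots> = (\<integral>\<^sup>+Q. (\<integral>\<^sup>+X. h (matmul n n p Q X) \<partial>\<mu>) \<partial>\<kappa>)"
    using is_haar_AE[OF H]
    by (intro nn_integral_cong_AE) (auto simp: is_haar_invariant[OF M _ h])
  also have "\<dots> = (\<integral>\<^sup>+X. (\<integral>\<^sup>+Q. h (matmul n n p Q X) \<partial>\<kappa>) \<partial>\<mu>)"
    by (rule P.Fubini') measurable
  also have "\<dots> = (\<integral>\<^sup>+X. (\<integral>\<^sup>+Q. h (cols n p Q) \<partial>\<kappa>) \<partial>\<mu>)"
    using is_haar_AE[OF M]
  proof (intro nn_integral_cong_AE, eventually_elim)
    case (elim X)
    \<comment> \<open>With X the first columns of R, Q X consists of the first columns of Q R, and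
      right invariance removes R.\<close>
    obtain R where R: "R \<in> stiefel n n" "X = cols n p R" using stiefel_completion[OF elim(2)] by auto
    have "(\<integral>\<^sup>+Q. h (matmul n n p Q X) \<partial>\<kappa>) = (\<integral>\<^sup>+Q. h (cols n p (matmul n n n Q R)) \<partial>\<kappa>)"
      by (simp add: R matmul_cols)
    also have "\<dots> = (\<integral>\<^sup>+Q. h (cols n p Q) \<partial>\<kappa>)"
      by (rule haar_right_invariant_square[OF H _ R(1), of "\<lambda>Q. h (cols n p Q)"]) measurable
    finally show ?case .
  qed
  finally show ?thesis by (simp add: M.emeasure_space_1)
qed

lemma append_col_measurable[measurable]:
  "(\<lambda>(X,z). append_col n p X z) \<in> measurable (matspace n p \<Otimes>\<^sub>M vecspace n) (matspace n (Suc p))"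
proof -
  have c1[measurable]: "(\<lambda>w. fst w (i,j)) \<in> borel_measurable (matspace n p \<Otimes>\<^sub>M vecspace n)" if "i < n" "j < p" for i j
    by (rule measurable_compose[OF measurable_fst mat_component[OF that]])
  have c2[measurable]: "(\<lambda>w. snd w i) \<in> borel_measurable (matspace n p \<Otimes>\<^sub>M vecspace n)" if "i < n" for i
    unfolding vecspace_def
    using measurable_compose[OF measurable_snd measurable_component_singleton[of i "{..<n}" "\<lambda>_. lborel"]] that by simp
  have c3: "(\<lambda>w. residual n p (fst w) (snd w) i) \<in> borel_measurable (matspace n p \<Otimes>\<^sub>M vecspace n)" if "i < n" for i
    unfolding residual_def using that
    by (intro borel_measurable_sum borel_measurable_diff borel_measurable_times c1 c2) auto
  have c4: "(\<lambda>w. sqnorm n (residual n p (fst w) (snd w))) \<in> borel_measurable (matspace n p \<Otimes>\<^sub>M vecspace n)"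
    unfolding sqnorm_def by (intro borel_measurable_sum borel_measurable_power c3) auto
  show ?thesis unfolding append_col_def case_prod_beta[of "\<lambda>X z. restrict (H X z) A" for H A]
  proof (rule measurable_matI)
    fix i j assume ij: "i < n" "j < Suc p"
    show "(\<lambda>w. if j < p then fst w (i, j) else residual n p (fst w) (snd w) i / sqrt (sqnorm n (residual n p (fst w) (snd w))))
      \<in> borel_measurable (matspace n p \<Otimes>\<^sub>M vecspace n)"
      using ij c1 c3[OF ij(1)] c4 by (cases "j < p") auto
  qed
qed

lemma append_col_measurable_raw[measurable (raw)]:
  assumes "A \<in> measurable M (matspace n p)" "z \<in> measurable M (vecspace n)"
  shows "(\<lambda>x. append_col n p (A x) (z x)) \<in> measurable M (matspace n (Suc p))"
  using measurable_compose[OF measurable_Pair[OF assms] append_col_measurable] by simp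

text \<open>The empty product measure is the unit mass at the only matrix without columns.\<close>

lemma is_haar_exists_0: "is_haar n 0 (matspace n 0)"
proof -
  have [simp]: "matspace n 0 = PiM {} (\<lambda>_. lborel)" by (simp add: matspace_def)
  have S: "stiefel n 0 = {\<lambda>_. undefined}" by (auto simp: stiefel_def)
  show ?thesis
  proof (rule is_haarI)
    show "prob_space (matspace n 0)" by (rule prob_spaceI) (simp add: space_PiM)
    show "AE X in matspace n 0. X \<in> stiefel n 0" by (rule AE_I2) (simp add: S space_PiM)
    fix Q and h :: "mat \<Rightarrow> ennreal"
    have "matmul n n 0 Q X = X" if "X \<in> space (matspace n 0)" for X
      using that by (simp add: space_PiM matmul_def restrict_def)
    then show "(\<integral>\<^sup>+X. h (matmul n n 0 Q X) \<partial>matspace n 0) = (\<integral>\<^sup>+X. h X \<partial>matspace n 0)"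
      by (intro nn_integral_cong) simp
  qed simp
qed

text \<open>Append a uniformly random vector of the unit ball, orthonormalised against the previous columns; this
  commutes with rotations.\<close>
lemma is_haar_exists: "p \<le> n \<Longrightarrow> \<exists>\<mu>. is_haar n p \<mu>"
proof (induction p)
  case 0
  show ?case using is_haar_exists_0 by blast
next
  case (Suc p)
  then obtain \<mu> where H: "is_haar n p \<mu>" and pn: "p < n" by auto
  let ?B = "{x \<in> space (vecspace n). sqnorm n x < 1}"
  define \<gamma> where "\<gamma> = uniform_measure (vecspace n) ?B"
  note [measurable_cong] = is_haar_sets[OF H]
  have [measurable_cong]: "sets \<gamma> = sets (vecspace n)" by (simp add: \<gamma>_def)
  have [measurable]: "sqnorm n \<in> borel_measurable (vecspace n)" by (simp add: vecspace_def)
  have B: "?B \<in> sets (vecspace n)" by measurable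
  have K: "emeasure (vecspace n) ?B \<noteq> 0" "emeasure (vecspace n) ?B \<noteq> \<infinity>" using emeasure_unit_ball[of n] by auto
  interpret G: prob_space \<gamma> unfolding \<gamma>_def by (rule prob_space_uniform_measure[OF K])
  interpret M: prob_space \<mu> by (rule is_haar_prob[OF H])
  interpret P: pair_prob_space \<mu> \<gamma> ..
  have mv[measurable]: "mat_vec n Q \<in> measurable (vecspace n) (vecspace n)" for Q
    by (simp add: vecspace_def)
  \<comment> \<open>Both Lebesgue measure and the unit ball are invariant under Q.\<close>
  have ginv: "(\<integral>\<^sup>+z. h (mat_vec n Q z) \<partial>\<gamma>) = (\<integral>\<^sup>+z. h z \<partial>\<gamma>)"
    if Q: "Q \<in> stiefel n n" and h[measurable]: "h \<in> borel_measurable (vecspace n)" for Q h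
  proof -
    have "(\<integral>\<^sup>+z. h (mat_vec n Q z) * indicator ?B z \<partial>vecspace n)
      = (\<integral>\<^sup>+z. (\<lambda>z. h z * indicator ?B z) (mat_vec n Q z) \<partial>vecspace n)"
      using measurable_space[OF mv, of _ Q]
      by (intro nn_integral_cong) (auto simp: indicator_def sqnorm_mat_vec[OF Q])
    also have "\<dots> = (\<integral>\<^sup>+z. h z * indicator ?B z \<partial>vecspace n)"
      by (rule nn_integral_vecspace_mat_vec[OF Q]) measurable
    finally show ?thesis using B unfolding \<gamma>_def by (simp add: nn_integral_uniform_measure)
  qed
  define \<nu> where "\<nu> = distr (\<mu> \<Otimes>\<^sub>M \<gamma>) (matspace n (Suc p)) (\<lambda>(X,z). append_col n p X z)"
  have nu: "(\<integral>\<^sup>+Y. h Y \<partial>\<nu>) = (\<integral>\<^sup>+X. (\<integral>\<^sup>+z. h (append_col n p X z) \<partial>\<gamma>) \<partial>\<mu>)"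
    if [measurable]: "h \<in> borel_measurable (matspace n (Suc p))" for h
  proof -
    have "(\<integral>\<^sup>+Y. h Y \<partial>\<nu>) = (\<integral>\<^sup>+w. h (append_col n p (fst w) (snd w)) \<partial>(\<mu> \<Otimes>\<^sub>M \<gamma>))"
      unfolding \<nu>_def case_prod_beta by (rule nn_integral_distr) measurable
    also have "\<dots> = (\<integral>\<^sup>+X. (\<integral>\<^sup>+z. h (append_col n p X z) \<partial>\<gamma>) \<partial>\<mu>)"
      by (subst G.nn_integral_fst[symmetric]) simp_all
    finally show ?thesis .
  qed
  have "is_haar n (Suc p) \<nu>"
  proof (rule is_haarI)
    show "sets \<nu> = sets (matspace n (Suc p))" by (simp add: \<nu>_def)
    show "prob_space \<nu>" unfolding \<nu>_def by (rule P.prob_space_distr) measurable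
    have "AE w in \<mu> \<Otimes>\<^sub>M \<gamma>. append_col n p (fst w) (snd w) \<in> stiefel n (Suc p)"
    proof (rule P.AE_pair_measure)
      show "{x \<in> space (\<mu> \<Otimes>\<^sub>M \<gamma>). append_col n p (fst x) (snd x) \<in> stiefel n (Suc p)} \<in> sets (\<mu> \<Otimes>\<^sub>M \<gamma>)"
        by measurable
      show "AE X in \<mu>. AE z in \<gamma>. append_col n p (fst (X, z)) (snd (X, z)) \<in> stiefel n (Suc p)"
        using is_haar_AE[OF H]
      proof eventually_elim
        case (elim X)
        have "AE z in \<gamma>. sqnorm n (residual n p X z) \<noteq> 0"
          unfolding \<gamma>_def using AE_residual_nonzero[OF elim pn] by (intro AE_uniform_measureI B) auto
        then show ?case by eventually_elim (simp add: append_col_stiefel[OF elim])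
      qed
    qed
    then show "AE Y in \<nu>. Y \<in> stiefel n (Suc p)"
      unfolding \<nu>_def by (subst AE_distr_iff) (auto simp: case_prod_beta)
    fix Q and h :: "mat \<Rightarrow> ennreal"
    assume Q: "Q \<in> stiefel n n" and h[measurable]: "h \<in> borel_measurable (matspace n (Suc p))"
    note [simp] = stiefel_space[OF Q]
    define G where "G X = (\<integral>\<^sup>+z. h (append_col n p X z) \<partial>\<gamma>)" for X
    have G[measurable]: "G \<in> borel_measurable (matspace n p)" unfolding G_def
      by (rule G.borel_measurable_nn_integral) (use measurable_compose[OF append_col_measurable[of n p] h] in \<open>simp add: case_prod_beta cong: measurable_cong_sets\<close>)
    have "(\<integral>\<^sup>+Y. h (matmul n n (Suc p) Q Y) \<partial>\<nu>) = (\<integral>\<^sup>+X. (\<integral>\<^sup>+z. h (matmul n n (Suc p) Q (append_col n p X z)) \<partial>\<gamma>) \<partial>\<mu>)"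
      by (rule nu) measurable
    \<comment> \<open>Equivariance moves Q into both arguments of \<open>append_col\<close>;
      invariance of \<open>\<gamma>\<close> then removes it from z, and the next step removes it
      from X.\<close>
    also have "\<dots> = (\<integral>\<^sup>+X. G (matmul n n p Q X) \<partial>\<mu>)"
      using is_haar_AE[OF H]
    proof (intro nn_integral_cong_AE, eventually_elim)
      case (elim X)
      have X: "matmul n n p Q X \<in> space (matspace n p)" by (simp add: space_matspace matmul_ext)
      have m: "(\<lambda>z. append_col n p (matmul n n p Q X) z) \<in> measurable (vecspace n) (matspace n (Suc p))"
        using measurable_compose[OF measurable_Pair1'[OF X] append_col_measurable] by simp
      have "(\<integral>\<^sup>+z. h (matmul n n (Suc p) Q (append_col n p X z)) \<partial>\<gamma>)
        = (\<integral>\<^sup>+z. h (append_col n p (matmul n n p Q X) (mat_vec n Q z)) \<partial>\<gamma>)"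
        using append_col_equivariant[OF elim(2) Q] by simp
      also have "\<dots> = G (matmul n n p Q X)"
        unfolding G_def by (rule ginv[OF Q measurable_compose[OF m h]])
      finally show ?case .
    qed
    also have "\<dots> = (\<integral>\<^sup>+X. G X \<partial>\<mu>)" by (rule is_haar_invariant[OF H Q G])
    also have "\<dots> = (\<integral>\<^sup>+Y. h Y \<partial>\<nu>)" unfolding G_def by (rule nu[OF h, symmetric])
    finally show "(\<integral>\<^sup>+Y. h (matmul n n (Suc p) Q Y) \<partial>\<nu>) = (\<integral>\<^sup>+Y. h Y \<partial>\<nu>)" .
  qed
  then show ?case by blast
qed

text \<open>Both measures are the law of the first p columns of one and the same Haar distributed
  orthogonal matrix.\<close>

lemma is_haar_unique:
  assumes "is_haar n p \<mu>" "is_haar n p \<mu>'" "p \<le> n"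
  shows "\<mu> = \<mu>'"
proof (rule measure_eqI)
  obtain \<kappa> where H: "is_haar n n \<kappa>" using is_haar_exists by blast
  fix A assume "A \<in> sets \<mu>"
  then have A[measurable]: "A \<in> sets (matspace n p)" using is_haar_sets[OF assms(1)] by simp
  have "(\<integral>\<^sup>+X. indicator A X \<partial>\<mu>) = (\<integral>\<^sup>+X. indicator A X \<partial>\<mu>')"
    using haar_as_cols[OF H assms(1) _ assms(3), of "indicator A"] haar_as_cols[OF H assms(2) _ assms(3), of "indicator A"] by simp
  then show "emeasure \<mu> A = emeasure \<mu>' A"
    by (simp add: is_haar_sets[OF assms(1)] is_haar_sets[OF assms(2)])
qed (simp add: is_haar_sets[OF assms(1)] is_haar_sets[OF assms(2)])

lemma is_haar_haar: "p \<le> n \<Longrightarrow> is_haar n p (haar n p)"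
proof -
  assume p: "p \<le> n"
  then obtain \<mu> where \<mu>: "is_haar n p \<mu>" using is_haar_exists by blast
  have "haar n p = (THE \<mu>. is_haar n p \<mu>)" by (simp add: haar_def is_haar_def)
  also have "\<dots> = \<mu>" using \<mu> is_haar_unique[OF _ \<mu> p] by blast
  finally show ?thesis using \<mu> by simp
qed

text \<open>Left and right multiplication commute, so the image of the measure under X -> X V is
  again left invariant; uniqueness identifies it with the original.\<close>

lemma haar_right_invariant:
  assumes pn: "p \<le> n" and V: "V \<in> stiefel p p" and h: "h \<in> borel_measurable (matspace n p)"
  shows "(\<integral>\<^sup>+X. h (matmul n p p X V) \<partial>haar n p) = (\<integral>\<^sup>+X. h X \<partial>haar n p)"
proof -
  note H = is_haar_haar[OF pn]
  note [measurable_cong] = is_haar_sets[OF H]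
  note [measurable] = h
  note [simp] = stiefel_space[OF V]
  interpret prob_space "haar n p" by (rule is_haar_prob[OF H])
  let ?D = "distr (haar n p) (matspace n p) (\<lambda>X. matmul n p p X V)"
  have m: "(\<lambda>X. matmul n p p X V) \<in> measurable (haar n p) (matspace n p)" by measurable
  have "is_haar n p ?D"
  proof (rule is_haarI)
    show "prob_space ?D" by (rule prob_space_distr) measurable
    show "AE X in ?D. X \<in> stiefel n p"
      using is_haar_AE[OF H] by (subst AE_distr_iff) (auto simp: matmul_stiefel[OF _ V])
    fix Q and h :: "mat \<Rightarrow> ennreal" assume Q: "Q \<in> stiefel n n" and h[measurable]: "h \<in> borel_measurable (matspace n p)"
    note [simp] = stiefel_space[OF Q]
    have "(\<integral>\<^sup>+ X. h (matmul n n p Q X) \<partial>?D) = (\<integral>\<^sup>+ X. h (matmul n n p Q (matmul n p p X V)) \<partial>haar n p)"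
      by (rule nn_integral_distr) measurable
    also have "\<dots> = (\<integral>\<^sup>+ X. h (matmul n p p (matmul n n p Q X) V) \<partial>haar n p)"
      by (simp add: matmul_assoc)
    also have "\<dots> = (\<integral>\<^sup>+ X. h (matmul n p p X V) \<partial>haar n p)"
      by (rule is_haar_invariant[OF H Q, of "\<lambda>X. h (matmul n p p X V)"]) measurable
    also have "\<dots> = integral\<^sup>N ?D h"
      by (rule nn_integral_distr[symmetric]) measurable
    finally show "(\<integral>\<^sup>+ X. h (matmul n n p Q X) \<partial>?D) = integral\<^sup>N ?D h" .
  qed simp
  from is_haar_unique[OF this H pn]
  have "(\<integral>\<^sup>+X. h X \<partial>haar n p) = integral\<^sup>N ?D h" by simp
  also have "\<dots> = (\<integral>\<^sup>+X. h (matmul n p p X V) \<partial>haar n p)"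
    by (rule nn_integral_distr) measurable
  finally show ?thesis by simp
qed

section \<open>Matrix Langevin densities\<close>

lemma sets_haar: "p \<le> n \<Longrightarrow> sets (haar n p) = sets (matspace n p)"
  by (rule is_haar_sets[OF is_haar_haar])

lemma prob_space_haar: "p \<le> n \<Longrightarrow> prob_space (haar n p)"
  by (rule is_haar_prob[OF is_haar_haar])

lemma AE_haar_stiefel: "p \<le> n \<Longrightarrow> AE X in haar n p. X \<in> stiefel n p"
  by (rule is_haar_AE[OF is_haar_haar])

lemma measurable_haar: "p \<le> n \<Longrightarrow> measurable (haar n p) N = measurable (matspace n p) N"
  by (rule measurable_cong_sets) (simp_all add: sets_haar)

lemma haar_integrable_bounded:
  fixes f :: "mat \<Rightarrow> real"
  assumes "p \<le> n" "f \<in> borel_measurable (matspace n p)" "\<And>X. X \<in> stiefel n p \<Longrightarrow> \<bar>f X\<bar> \<le> B"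
  shows "integrable (haar n p) f"
proof -
  interpret prob_space "haar n p" by (rule prob_space_haar) fact
  show ?thesis
    using AE_haar_stiefel[OF assms(1)] assms
    by (intro integrable_const_bound[of _ B]) (auto simp: measurable_haar)
qed

section \<open>Balls, grids and full support of Haar measure\<close>

definition mat_ball :: "nat \<Rightarrow> nat \<Rightarrow> mat \<Rightarrow> real \<Rightarrow> mat set" where
  "mat_ball n p X \<delta> = {Y \<in> stiefel n p. \<forall>i<n. \<forall>j<p. \<bar>Y (i,j) - X (i,j)\<bar> < \<delta>}"

lemma mat_ball_sets[measurable]: "mat_ball n p X \<delta> \<in> sets (matspace n p)"
proof -
  have "mat_ball n p X \<delta> = stiefel n p \<inter> {Y \<in> space (matspace n p). \<forall>i\<in>{..<n}. \<forall>j\<in>{..<p}. \<bar>Y (i,j) - X (i,j)\<bar> < \<delta>}"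
    using stiefel_ext by (auto simp: mat_ball_def space_matspace)
  also have "\<dots> \<in> sets (matspace n p)"
    by (intro sets.Int stiefel_sets sets.sets_Collect_finite_All borel_measurable_less borel_measurable_abs
          borel_measurable_diff mat_component borel_measurable_const) auto
  finally show ?thesis .
qed

text \<open>The grid cell of mesh \<open>\<delta>\<close> containing x, read off the coordinate
  functions \<open>\<Phi>\<close>. For finite \<open>I\<close> its values lie in a countable set. It
  serves both for the covering of the manifold and for the partition of the parameters.\<close>

definition cell :: "'i set \<Rightarrow> ('i \<Rightarrow> 'a \<Rightarrow> real) \<Rightarrow> real \<Rightarrow> 'a \<Rightarrow> 'i \<Rightarrow> int" where
  "cell I \<Phi> \<delta> x = (\<lambda>i\<in>I. \<lfloor>\<Phi> i x / \<delta>\<rfloor>)"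

lemma cell_close:
  assumes "cell I \<Phi> \<delta> x = cell I \<Phi> \<delta> y" "i \<in> I" "\<delta> > 0"
  shows "\<bar>\<Phi> i x - \<Phi> i y\<bar> \<le> \<delta>"
proof -
  have "\<lfloor>\<Phi> i x / \<delta>\<rfloor> = \<lfloor>\<Phi> i y / \<delta>\<rfloor>"
    using fun_cong[OF assms(1), of i] assms(2) by (simp add: cell_def)
  then have "\<bar>\<Phi> i x / \<delta> - \<Phi> i y / \<delta>\<bar> < 1" by linarith
  then have "\<bar>\<Phi> i x / \<delta> - \<Phi> i y / \<delta>\<bar> * \<delta> \<le> 1 * \<delta>" using assms(3) by (intro mult_right_mono) auto
  moreover have "\<bar>\<Phi> i x / \<delta> - \<Phi> i y / \<delta>\<bar> * \<delta> = \<bar>\<Phi> i x - \<Phi> i y\<bar>"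
  proof -
    have "\<Phi> i x - \<Phi> i y = (\<Phi> i x / \<delta> - \<Phi> i y / \<delta>) * \<delta>" using assms(3) by (simp add: field_simps)
    then show ?thesis using assms(3) by (simp only: abs_mult abs_of_pos)
  qed
  ultimately show ?thesis by simp
qed

text \<open>If one ball were null, rotations would make smaller balls around all frames null;
  countably many of them, one for each occupied grid cell, cover the manifold, which has measure
  1.\<close>

lemma haar_ball_pos:
  assumes pn: "p \<le> n" and X0: "X0 \<in> stiefel n p" and d: "\<delta> > 0"
  shows "emeasure (haar n p) (mat_ball n p X0 \<delta>) > 0"
proof (rule ccontr)
  assume "\<not> ?thesis"
  then have 0: "emeasure (haar n p) (mat_ball n p X0 \<delta>) = 0" by simp
  note H = is_haar_haar[OF pn]
  interpret prob_space "haar n p" by (rule prob_space_haar[OF pn])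
  \<comment> \<open>A rotation enlarges entrywise distances at most n times; n + 1 makes the
    inequality strict.\<close>
  define \<delta>' where "\<delta>' = \<delta> / (real n + 1)"
  have d': "\<delta>' > 0" using d by (simp add: \<delta>'_def)
  have null: "mat_ball n p X1 \<delta>' \<in> null_sets (haar n p)" if X1: "X1 \<in> stiefel n p" for X1
  proof -
    obtain Q0 where Q0: "Q0 \<in> stiefel n n" "X0 = cols n p Q0" using stiefel_completion[OF X0 pn] by auto
    obtain Q1 where Q1: "Q1 \<in> stiefel n n" "X1 = cols n p Q1" using stiefel_completion[OF X1 pn] by auto
    \<comment> \<open>Q0 Q1^T maps Q1 to Q0, hence \<open>X1\<close> to \<open>X0\<close>.\<close>
    define Q where "Q = matmul n n n Q0 (transp n Q1)"
    have Q: "Q \<in> stiefel n n" unfolding Q_def by (intro matmul_stiefel transp_stiefel Q0 Q1)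
    have E: "matmul n n n (transp n Q1) Q1 = matmul n n n (transp n Q0) Q0"
      by (rule mat_eqI[OF matmul_ext matmul_ext])
        (simp add: matmul_apply transp_apply stiefel_col[OF Q0(1)] stiefel_col[OF Q1(1)])
    have "matmul n n n Q Q1 = matmul n n n Q0 (matmul n n n (transp n Q0) Q0)"
      unfolding Q_def by (simp add: matmul_assoc E)
    also have "\<dots> = matmul n n n (transp n (transp n Q0)) (matmul n n n (transp n Q0) Q0)"
      by (simp add: transp_transp stiefel_ext[OF Q0(1)])
    also have "\<dots> = Q0"
      by (rule matmul_transp_cancel[OF transp_stiefel[OF Q0(1)] stiefel_ext[OF Q0(1)]])
    finally have QX: "matmul n n p Q X1 = X0" by (simp add: Q1(2) Q0(2) matmul_cols[OF pn])
    have sub: "matmul n n p Q Y \<in> mat_ball n p X0 \<delta>" if Y: "Y \<in> mat_ball n p X1 \<delta>'" for Y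
    proof -
      have "\<bar>matmul n n p Q Y (i,j) - X0 (i,j)\<bar> < \<delta>" if ij: "i < n" "j < p" for i j
      proof -
        have "\<bar>matmul n n p Q Y (i,j) - X0 (i,j)\<bar> = \<bar>\<Sum>l<n. Q (i,l) * (Y (l,j) - X1 (l,j))\<bar>"
          using ij by (simp add: QX[symmetric] matmul_apply sum_subtractf right_diff_distrib)
        also have "\<dots> \<le> (\<Sum>l<n. \<bar>Q (i,l)\<bar> * \<bar>Y (l,j) - X1 (l,j)\<bar>)"
          by (rule order_trans[OF sum_abs]) (simp add: abs_mult)
        also have "\<dots> \<le> (\<Sum>l<n. 1 * \<delta>')"
          using Y ij stiefel_entry_le[OF Q] by (intro sum_mono mult_mono) (auto simp: mat_ball_def less_imp_le)
        also have "\<dots> < \<delta>" using d by (simp add: \<delta>'_def field_simps)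
        finally show ?thesis .
      qed
      then show ?thesis using Y matmul_stiefel[OF Q] by (simp add: mat_ball_def)
    qed
    have "emeasure (haar n p) (mat_ball n p X1 \<delta>') = (\<integral>\<^sup>+Y. indicator (mat_ball n p X1 \<delta>') Y \<partial>haar n p)"
      by (simp add: sets_haar[OF pn])
    also have "\<dots> \<le> (\<integral>\<^sup>+Y. indicator (mat_ball n p X0 \<delta>) (matmul n n p Q Y) \<partial>haar n p)"
      using sub by (intro nn_integral_mono) (auto simp: indicator_def)
    also have "\<dots> = (\<integral>\<^sup>+Y. indicator (mat_ball n p X0 \<delta>) Y \<partial>haar n p)"
      by (rule is_haar_invariant[OF H Q]) measurable
    also have "\<dots> = 0" using 0 by (simp add: sets_haar[OF pn])
    finally show ?thesis by (simp add: null_sets_def sets_haar[OF pn])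
  qed
  define I where "I = {..<n} \<times> {..<p}"
  \<comment> \<open>Points of one cell differ by at most the mesh, so half of
    \<open>\<delta>'\<close> gives the strict bound required by \<open>mat_ball\<close>.\<close>
  define g where "g = cell I (\<lambda>a X :: mat. X a) (\<delta>' / 2)"
  have cnt: "countable (g ` stiefel n p)"
  proof (rule countable_subset)
    show "g ` stiefel n p \<subseteq> PiE I (\<lambda>_. UNIV)" by (auto simp: g_def cell_def PiE_def)
    show "countable (PiE I (\<lambda>_. UNIV :: int set))" unfolding I_def by (rule countable_PiE) auto
  qed
  have "(\<Union>z\<in>g ` stiefel n p. mat_ball n p (inv_into (stiefel n p) g z) \<delta>') \<in> null_sets (haar n p)"
    by (intro null_sets_UN' cnt null inv_into_into)
  moreover have "stiefel n p \<subseteq> (\<Union>z\<in>g ` stiefel n p. mat_ball n p (inv_into (stiefel n p) g z) \<delta>')"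
  proof
    fix X assume X: "X \<in> stiefel n p"
    define Y where "Y = inv_into (stiefel n p) g (g X)"
    have gY: "g Y = g X" unfolding Y_def by (rule f_inv_into_f[OF imageI[OF X]])
    have "\<bar>X (i,j) - Y (i,j)\<bar> < \<delta>'" if ij: "i < n" "j < p" for i j
      using cell_close[OF gY[unfolded g_def], of "(i,j)"] ij d' by (simp add: I_def abs_minus_commute)
    then have "X \<in> mat_ball n p Y \<delta>'" using X by (simp add: mat_ball_def)
    then show "X \<in> (\<Union>z\<in>g ` stiefel n p. mat_ball n p (inv_into (stiefel n p) g z) \<delta>')"
      using X unfolding Y_def by blast
  qed
  ultimately have "stiefel n p \<in> null_sets (haar n p)"
    using null_sets_subset stiefel_sets sets_haar[OF pn] by metis
  then show False using H by (simp add: is_haar_def null_sets_def)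
qed

section \<open>Exponent and normalising constant of the component density\<close>

text \<open>The entries of M D V^T; their inner product with X is the exponent of the
  density.\<close>

definition coef :: "nat \<Rightarrow> comp_param \<Rightarrow> nat \<Rightarrow> nat \<Rightarrow> real" where
  "coef p th i j = (case th of (M, d, V) \<Rightarrow> \<Sum>k<p. M (i,k) * d k * V (j,k))"

lemma fML_eq:
  "fML n p th X = exp (\<Sum>i<n. \<Sum>j<p. coef p th i j * X (i,j)) / hyp0F1 n p (fst (snd th))"
proof -
  obtain M d V where th: "th = (M,d,V)" by (cases th)
  have "(\<Sum>i<n. \<Sum>j<p. coef p th i j * X (i,j)) = (\<Sum>i<n. \<Sum>j<p. \<Sum>k<p. V (j,k) * d k * (M (i,k) * X (i,j)))"
    by (simp add: th coef_def sum_distrib_left sum_distrib_right mult_ac)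
  also have "\<dots> = (\<Sum>j<p. \<Sum>i<n. \<Sum>k<p. V (j,k) * d k * (M (i,k) * X (i,j)))" by (rule sum.swap)
  also have "\<dots> = (\<Sum>j<p. \<Sum>k<p. \<Sum>i<n. V (j,k) * d k * (M (i,k) * X (i,j)))"
    by (rule sum.cong[OF refl], rule sum.swap)
  also have "\<dots> = (\<Sum>j<p. \<Sum>k<p. V (j,k) * d k * (\<Sum>i<n. M (i,k) * X (i,j)))"
    by (simp add: sum_distrib_left)
  finally show ?thesis by (simp add: fML_def th)
qed

lemma exp_lin_measurable:
  "(\<lambda>X. exp (\<Sum>i<n. \<Sum>j<p. F i j * X (i,j)) :: real) \<in> borel_measurable (matspace n p)"
  by (intro measurable_compose[OF _ borel_measurable_exp]
    borel_measurable_sum borel_measurable_times borel_measurable_const mat_component) auto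

lemma exp_diag_measurable:
  "p \<le> n \<Longrightarrow> (\<lambda>X. exp (\<Sum>j<p. d j * X (j,j)) :: real) \<in> borel_measurable (matspace n p)"
  by (intro measurable_compose[OF _ borel_measurable_exp]
    borel_measurable_sum borel_measurable_times borel_measurable_const mat_component) auto

lemma fML_measurable: "fML n p th \<in> borel_measurable (matspace n p)"
proof -
  have "fML n p th = (\<lambda>X. exp (\<Sum>i<n. \<Sum>j<p. coef p th i j * X (i,j)) / hyp0F1 n p (fst (snd th)))"
    by (simp add: fun_eq_iff fML_eq)
  then show ?thesis using exp_lin_measurable[where F="coef p th"] by simp
qed

lemma stiefel_linear_bound:
  assumes X: "X \<in> stiefel n p" and F: "\<And>i j. i < n \<Longrightarrow> j < p \<Longrightarrow> \<bar>F i j\<bar> \<le> b i j"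
  shows "\<bar>\<Sum>i<n. \<Sum>j<p. F i j * X (i,j)\<bar> \<le> (\<Sum>i<n. \<Sum>j<p. b i j)"
proof -
  have "\<bar>\<Sum>i<n. \<Sum>j<p. F i j * X (i,j)\<bar> \<le> (\<Sum>i<n. \<Sum>j<p. \<bar>F i j * X (i,j)\<bar>)"
    by (rule order_trans[OF sum_abs]) (intro sum_mono sum_abs)
  also have "\<dots> \<le> (\<Sum>i<n. \<Sum>j<p. b i j)"
  proof (intro sum_mono)
    fix i j assume "i \<in> {..<n}" "j \<in> {..<p}"
    then have "\<bar>F i j\<bar> * \<bar>X (i,j)\<bar> \<le> b i j * 1"
      using F[of i j] stiefel_entry_le[OF X, of i j] by (intro mult_mono) auto
    then show "\<bar>F i j * X (i,j)\<bar> \<le> b i j" by (simp add: abs_mult)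
  qed
  finally show ?thesis .
qed

lemma stiefel_diag_bound:
  assumes X: "X \<in> stiefel n p" and pn: "p \<le> n"
  shows "\<bar>\<Sum>j<p. d j * X (j,j)\<bar> \<le> (\<Sum>j<p. \<bar>d j\<bar>)"
proof (rule order_trans[OF sum_abs], intro sum_mono)
  fix j assume "j \<in> {..<p}"
  then have "\<bar>d j\<bar> * \<bar>X (j,j)\<bar> \<le> \<bar>d j\<bar> * 1"
    using stiefel_entry_le[OF X, of j j] pn by (intro mult_mono) auto
  then show "\<bar>d j * X (j,j)\<bar> \<le> \<bar>d j\<bar>" by (simp add: abs_mult)
qed

lemma exp_diag_integrable: "p \<le> n \<Longrightarrow> integrable (haar n p) (\<lambda>X. exp (\<Sum>j<p. d j * X (j,j)))"
  by (rule haar_integrable_bounded[where B="exp (\<Sum>j<p. \<bar>d j\<bar>)"])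
     (use stiefel_diag_bound[of _ n p d] exp_diag_measurable[OF _, of p n d] in \<open>auto simp: abs_le_iff\<close>)

text \<open>The logarithm of the constant is 1-Lipschitz for the l1 norm, because the diagonal
  entries of a frame are at most 1 in absolute value.\<close>

lemma hyp0F1_lipschitz:
  assumes pn: "p \<le> n"
  shows "hyp0F1 n p d \<le> exp (\<Sum>j<p. \<bar>d j - d' j\<bar>) * hyp0F1 n p d'"
proof -
  have "hyp0F1 n p d \<le> (\<integral>X. exp (\<Sum>j<p. \<bar>d j - d' j\<bar>) * exp (\<Sum>j<p. d' j * X (j,j)) \<partial>haar n p)"
    unfolding hyp0F1_def
  proof (rule integral_mono_AE)
    show "AE X in haar n p. exp (\<Sum>j<p. d j * X (j,j)) \<le> exp (\<Sum>j<p. \<bar>d j - d' j\<bar>) * exp (\<Sum>j<p. d' j * X (j,j))"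
      using AE_haar_stiefel[OF pn]
    proof eventually_elim
      case (elim X)
      then have "(\<Sum>j<p. d j * X (j,j)) - (\<Sum>j<p. d' j * X (j,j)) \<le> (\<Sum>j<p. \<bar>d j - d' j\<bar>)"
        using stiefel_diag_bound[OF elim pn, of "\<lambda>j. d j - d' j"] by (simp add: left_diff_distrib sum_subtractf)
      then show ?case by (simp flip: exp_add)
    qed
  qed (use exp_diag_integrable[OF pn] in auto)
  then show ?thesis by (simp add: hyp0F1_def)
qed

text \<open>Compared with d = 0, where the value is the total mass 1 of Haar measure.\<close>

lemma hyp0F1_pos:
  assumes pn: "p \<le> n"
  shows "hyp0F1 n p d > 0"
proof -
  interpret prob_space "haar n p" by (rule prob_space_haar[OF pn])
  have "hyp0F1 n p (\<lambda>_. 0) = 1" by (simp add: hyp0F1_def prob_space)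
  then have "1 \<le> exp (\<Sum>j<p. \<bar>0 - d j\<bar>) * hyp0F1 n p d"
    using hyp0F1_lipschitz[OF pn, of "\<lambda>_. 0" d] by simp
  then have "0 < exp (\<Sum>j<p. \<bar>0 - d j\<bar>) * hyp0F1 n p d" by linarith
  then show ?thesis by (simp add: zero_less_mult_iff not_less)
qed

lemma fML_pos: "p \<le> n \<Longrightarrow> fML n p th X > 0"
  by (simp add: fML_eq hyp0F1_pos)

lemma fML_integrable:
  assumes pn: "p \<le> n" shows "integrable (haar n p) (fML n p th)"
proof -
  have "fML n p th = (\<lambda>X. exp (\<Sum>i<n. \<Sum>j<p. coef p th i j * X (i,j)) / hyp0F1 n p (fst (snd th)))"
    by (simp add: fun_eq_iff fML_eq)
  moreover have "integrable (haar n p) (\<lambda>X. exp (\<Sum>i<n. \<Sum>j<p. coef p th i j * X (i,j)))"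
    by (rule haar_integrable_bounded[OF pn exp_lin_measurable, where B="exp (\<Sum>i<n. \<Sum>j<p. \<bar>coef p th i j\<bar>)"])
      (use stiefel_linear_bound[of _ n p "coef p th" "\<lambda>i j. \<bar>coef p th i j\<bar>"] in \<open>auto simp: abs_le_iff\<close>)
  ultimately show ?thesis by simp
qed

text \<open>If M consists of the first columns of Q, the exponent is the sum of d_k times the
  diagonal entries of Q^T X V. Left and right invariance reduce its exponential integral to the
  definition of \<open>hyp0F1\<close>.\<close>

lemma fML_integral:
  assumes pn: "p \<le> n" and M: "M \<in> stiefel n p" and V: "V \<in> stiefel p p"
  shows "(\<integral>X. fML n p (M,d,V) X \<partial>haar n p) = 1"
proof -
  obtain Q where Q: "Q \<in> stiefel n n" "M = cols n p Q" using stiefel_completion[OF M pn] by auto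
  have [simp]: "transp n Q \<in> space (matspace n n)" "V \<in> space (matspace p p)"
    using stiefel_ext[OF transp_stiefel[OF Q(1)]] stiefel_ext[OF V] by (simp_all add: space_matspace)
  let ?g = "\<lambda>X. ennreal (exp (\<Sum>j<p. d j * X (j,j)))"
  let ?T = "\<lambda>X. matmul n p p (matmul n n p (transp n Q) X) V"
  have g[measurable]: "?g \<in> borel_measurable (matspace n p)" using exp_diag_measurable[OF pn] by measurable
  have T: "(\<Sum>k<p. d k * ?T X (k,k)) = (\<Sum>i<n. \<Sum>j<p. coef p (M,d,V) i j * X (i,j))" for X
  proof -
    have "(\<Sum>k<p. d k * ?T X (k,k)) = (\<Sum>k<p. \<Sum>j<p. \<Sum>i<n. M (i,k) * d k * V (j,k) * X (i,j))"
      using pn by (intro sum.cong refl)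
        (simp add: matmul_apply transp_apply Q(2) cols_apply sum_distrib_left sum_distrib_right mult_ac)
    also have "\<dots> = (\<Sum>j<p. \<Sum>k<p. \<Sum>i<n. M (i,k) * d k * V (j,k) * X (i,j))" by (rule sum.swap)
    also have "\<dots> = (\<Sum>j<p. \<Sum>i<n. \<Sum>k<p. M (i,k) * d k * V (j,k) * X (i,j))"
      by (rule sum.cong[OF refl], rule sum.swap)
    also have "\<dots> = (\<Sum>i<n. \<Sum>j<p. \<Sum>k<p. M (i,k) * d k * V (j,k) * X (i,j))" by (rule sum.swap)
    finally show ?thesis by (simp add: coef_def sum_distrib_right)
  qed
  have nn: "0 \<le> (\<integral>X. fML n p (M,d,V) X \<partial>haar n p)"
    by (intro Bochner_Integration.integral_nonneg less_imp_le fML_pos pn)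
  have "ennreal (hyp0F1 n p d) = (\<integral>\<^sup>+X. ?g X \<partial>haar n p)"
    unfolding hyp0F1_def by (rule nn_integral_eq_integral[symmetric, OF exp_diag_integrable[OF pn]]) simp
  also have "\<dots> = (\<integral>\<^sup>+X. ?g (matmul n p p X V) \<partial>haar n p)"
    by (rule haar_right_invariant[OF pn V g, symmetric])
  also have "\<dots> = (\<integral>\<^sup>+X. ?g (?T X) \<partial>haar n p)"
    by (rule is_haar_invariant[OF is_haar_haar[OF pn] transp_stiefel[OF Q(1)], symmetric])
      (rule measurable_compose[OF _ g], measurable)
  also have "\<dots> = (\<integral>\<^sup>+X. ennreal (hyp0F1 n p d * fML n p (M,d,V) X) \<partial>haar n p)"
    using hyp0F1_pos[OF pn, of d] by (simp add: T fML_eq)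
  also have "\<dots> = ennreal (\<integral>X. hyp0F1 n p d * fML n p (M,d,V) X \<partial>haar n p)"
    using fML_pos[OF pn] hyp0F1_pos[OF pn]
    by (intro nn_integral_eq_integral) (auto intro!: mult_nonneg_nonneg less_imp_le fML_integrable[OF pn])
  finally have "hyp0F1 n p d = hyp0F1 n p d * (\<integral>X. fML n p (M,d,V) X \<partial>haar n p)"
    using nn hyp0F1_pos[OF pn, of d] by (subst (asm) ennreal_inj) auto
  then show ?thesis using hyp0F1_pos[OF pn, of d] by simp
qed

text \<open>Closeness in exactly the coordinates that determine the density: M and V are compared
  only through M D V^T, and d only through the normalising constant.\<close>

definition comp_close :: "nat \<Rightarrow> nat \<Rightarrow> real \<Rightarrow> comp_param \<Rightarrow> comp_param \<Rightarrow> bool" where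
  "comp_close n p \<eta> th th' \<longleftrightarrow> (\<forall>i<n. \<forall>j<p. \<bar>coef p th i j - coef p th' i j\<bar> \<le> \<eta>) \<and>
     (\<forall>j<p. \<bar>fst (snd th) j - fst (snd th') j\<bar> \<le> \<eta>)"

text \<open>The n p entries of M D V^T shift the exponent by at most n p \<eta>; the p entries of d
  change the normalising constant by a factor at most exp (p \<eta>).\<close>

lemma fML_le:
  assumes pn: "p \<le> n" and X: "X \<in> stiefel n p" and cl: "comp_close n p \<eta> th th'"
  shows "fML n p th X \<le> exp (real (n * p + p) * \<eta>) * fML n p th' X"
proof -
  have F: "\<bar>coef p th i j - coef p th' i j\<bar> \<le> \<eta>" if "i < n" "j < p" for i j
    using cl that by (simp add: comp_close_def)
  have d: "\<bar>fst (snd th) j - fst (snd th') j\<bar> \<le> \<eta>" if "j < p" for j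
    using cl that by (simp add: comp_close_def)
  let ?A = "\<lambda>th. (\<Sum>i<n. \<Sum>j<p. coef p th i j * X (i,j))"
  have "?A th - ?A th' \<le> (\<Sum>i<n. \<Sum>j<p. \<eta>)"
    using stiefel_linear_bound[OF X, of "\<lambda>i j. coef p th i j - coef p th' i j", OF F]
    by (simp add: left_diff_distrib sum_subtractf)
  then have 1: "exp (?A th) \<le> exp (real (n * p) * \<eta>) * exp (?A th')" by (simp flip: exp_add)
  have "hyp0F1 n p (fst (snd th')) \<le> exp (\<Sum>j<p. \<bar>fst (snd th') j - fst (snd th) j\<bar>) * hyp0F1 n p (fst (snd th))"
    by (rule hyp0F1_lipschitz[OF pn])
  also have "\<dots> \<le> exp (\<Sum>j<p. \<eta>) * hyp0F1 n p (fst (snd th))"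
    using d hyp0F1_pos[OF pn]
    by (intro mult_right_mono exp_le_cancel_iff[THEN iffD2] sum_mono) (auto simp: less_imp_le abs_minus_commute)
  finally have 2: "hyp0F1 n p (fst (snd th')) \<le> exp (real p * \<eta>) * hyp0F1 n p (fst (snd th))" by simp
  have "exp (?A th) * hyp0F1 n p (fst (snd th')) \<le>
    (exp (real (n * p) * \<eta>) * exp (?A th')) * (exp (real p * \<eta>) * hyp0F1 n p (fst (snd th)))"
    using 1 2 hyp0F1_pos[OF pn] by (intro mult_mono) (auto simp: less_imp_le)
  also have "\<dots> = exp (real (n * p + p) * \<eta>) * exp (?A th') * hyp0F1 n p (fst (snd th))"
    by (simp add: ring_distribs exp_add)
  finally show ?thesis
    using hyp0F1_pos[OF pn, of "fst (snd th)"] hyp0F1_pos[OF pn, of "fst (snd th')"]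
    by (simp add: fML_eq field_simps)
qed

section \<open>Mixtures, envelopes and Hellinger affinity\<close>

lemma fmix_eq: "fmix n p C t X = (\<Sum>c<C. snd t c * fML n p (fst t c) X)"
  by (simp add: fmix_def case_prod_beta)

lemma Xi_compE:
  assumes "t \<in> Xi n p C" "c < C"
  obtains M d V where "fst t c = (M,d,V)" "M \<in> stiefel_pos n p" "d \<in> Sp p" "V \<in> stiefel p p"
proof -
  have "fst t c \<in> stiefel_pos n p \<times> Sp p \<times> stiefel p p"
    using PiE_mem[of "fst t" "{..<C}" "\<lambda>c. stiefel_pos n p \<times> Sp p \<times> stiefel p p" c] assms(2)
      assms(1)[unfolded Xi_def Theta_def mem_Times_iff] by simp
  then show ?thesis
    by (cases "fst t c") (rule that, auto)
qed

lemma Xi_weights: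
  assumes "t \<in> Xi n p C"
  shows "c < C \<Longrightarrow> 0 < snd t c" "c < C \<Longrightarrow> snd t c < 1" "(\<Sum>c<C. snd t c) = 1" "0 < C"
  using assms by (auto simp: Xi_def pi_simplex_def intro!: Nat.gr0I)

lemma fML_integral_Xi:
  assumes "p \<le> n" "t \<in> Xi n p C" "c < C"
  shows "(\<integral>X. fML n p (fst t c) X \<partial>haar n p) = 1"
  using assms by (auto elim!: Xi_compE simp: stiefel_pos_def fML_integral)

lemma fmix_measurable: "fmix n p C t \<in> borel_measurable (matspace n p)"
  unfolding fmix_eq[abs_def] using fML_measurable by measurable

definition mix_envelope :: "nat \<Rightarrow> nat \<Rightarrow> nat \<Rightarrow> real \<Rightarrow> param \<Rightarrow> mat \<Rightarrow> real" where
  "mix_envelope n p C \<eta> t X =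
    exp (real (n * p + p) * \<eta>) * (\<Sum>c<C. (snd t c + \<eta>) * fML n p (fst t c) X)"

lemma mix_envelope_measurable: "mix_envelope n p C \<eta> t \<in> borel_measurable (matspace n p)"
  unfolding mix_envelope_def[abs_def] using fML_measurable by measurable

text \<open>Weights are left out because the two comparisons treat them differently: additively in
  the upper envelope, multiplicatively in the lower bound near the truth.\<close>

definition param_close :: "nat \<Rightarrow> nat \<Rightarrow> nat \<Rightarrow> real \<Rightarrow> param \<Rightarrow> param \<Rightarrow> bool" where
  "param_close n p C \<eta> t t' \<longleftrightarrow> (\<forall>c<C. comp_close n p \<eta> (fst t c) (fst t' c))"

context
  fixes n p C :: nat
  assumes pn: "p \<le> n"
begin

lemma fmix_pos: "t \<in> Xi n p C \<Longrightarrow> 0 < fmix n p C t X"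
  unfolding fmix_eq using Xi_weights[of t n p C] fML_pos[OF pn] by (intro sum_pos) auto

lemma fmix_integrable: "integrable (haar n p) (fmix n p C t)"
  unfolding fmix_eq[abs_def] by (intro Bochner_Integration.integrable_sum integrable_mult_right fML_integrable[OF pn])

lemma fmix_integral: "t \<in> Xi n p C \<Longrightarrow> (\<integral>X. fmix n p C t X \<partial>haar n p) = 1"
  unfolding fmix_eq
  by (subst Bochner_Integration.integral_sum)
    (auto simp: fML_integrable[OF pn] fML_integral_Xi[OF pn] Xi_weights(3))

lemma mix_envelope_integrable: "integrable (haar n p) (mix_envelope n p C \<eta> t)"
  unfolding mix_envelope_def[abs_def]
  by (intro Bochner_Integration.integrable_sum integrable_mult_right fML_integrable[OF pn])

lemma mix_envelope_integral:
  "t \<in> Xi n p C \<Longrightarrow> (\<integral>X. mix_envelope n p C \<eta> t X \<partial>haar n p) = exp (real (n * p + p) * \<eta>) * (1 + real C * \<eta>)"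
  unfolding mix_envelope_def
  by (simp add: fML_integrable[OF pn] fML_integral_Xi[OF pn] Xi_weights(3) sum.distrib Bochner_Integration.integral_sum)

lemma fmix_le_envelope:
  assumes cl: "param_close n p C \<eta> t' t" and w: "\<And>c. c < C \<Longrightarrow> \<bar>snd t' c - snd t c\<bar> \<le> \<eta>"
    and t': "t' \<in> Xi n p C" and X: "X \<in> stiefel n p"
  shows "fmix n p C t' X \<le> mix_envelope n p C \<eta> t X"
proof -
  have "fmix n p C t' X \<le> (\<Sum>c<C. (snd t c + \<eta>) * (exp (real (n * p + p) * \<eta>) * fML n p (fst t c) X))"
    unfolding fmix_eq
  proof (intro sum_mono mult_mono)
    fix c assume c: "c \<in> {..<C}"
    show "snd t' c \<le> snd t c + \<eta>" using w[of c] c by auto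
    then show "0 \<le> snd t c + \<eta>" using Xi_weights(1)[OF t', of c] c by auto
    show "fML n p (fst t' c) X \<le> exp (real (n * p + p) * \<eta>) * fML n p (fst t c) X"
      using cl c by (intro fML_le[OF pn X]) (auto simp: param_close_def)
  qed (simp add: fML_pos[OF pn] less_imp_le)
  then show ?thesis by (simp add: mix_envelope_def sum_distrib_left mult_ac)
qed

lemma fmix_le_envelope_self:
  assumes "t \<in> Xi n p C" "0 \<le> \<eta>" "X \<in> stiefel n p"
  shows "fmix n p C t X \<le> mix_envelope n p C \<eta> t X"
  using assms by (intro fmix_le_envelope) (auto simp: param_close_def comp_close_def)

text \<open>The weights cost a further factor exp \<eta>, hence the + 1 in the exponent.\<close>

lemma fmix_le_fmix:
  assumes cl: "param_close n p C \<eta> t0 t" and w: "\<And>c. c < C \<Longrightarrow> snd t0 c \<le> exp \<eta> * snd t c"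
    and t: "t \<in> Xi n p C" and X: "X \<in> stiefel n p"
  shows "fmix n p C t0 X \<le> exp (real (n * p + p + 1) * \<eta>) * fmix n p C t X"
proof -
  have "fmix n p C t0 X \<le> (\<Sum>c<C. (exp \<eta> * snd t c) * (exp (real (n * p + p) * \<eta>) * fML n p (fst t c) X))"
    unfolding fmix_eq
  proof (intro sum_mono mult_mono)
    fix c assume c: "c \<in> {..<C}"
    show "snd t0 c \<le> exp \<eta> * snd t c" using w[of c] c by auto
    show "0 \<le> exp \<eta> * snd t c" using Xi_weights(1)[OF t, of c] c by auto
    show "fML n p (fst t0 c) X \<le> exp (real (n * p + p) * \<eta>) * fML n p (fst t c) X"
      using cl c by (intro fML_le[OF pn X]) (auto simp: param_close_def)
  qed (simp add: fML_pos[OF pn] less_imp_le)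
  also have "\<dots> = (exp \<eta> * exp (real (n * p + p) * \<eta>)) * fmix n p C t X"
    by (simp add: fmix_eq sum_distrib_left mult_ac)
  also have "exp \<eta> * exp (real (n * p + p) * \<eta>) = exp (real (n * p + p + 1) * \<eta>)"
    by (simp add: ring_distribs flip: exp_add)
  finally show ?thesis .
qed

end

section \<open>Cauchy-Schwarz and Hellinger affinity\<close>

lemma sqrt_mult_integrable:
  fixes f g :: "'a \<Rightarrow> real"
  assumes f: "integrable M f" and g: "integrable M g" and nn: "AE x in M. 0 \<le> f x \<and> 0 \<le> g x"
  shows "integrable M (\<lambda>x. sqrt (f x * g x))"
proof (rule Bochner_Integration.integrable_bound[of M "\<lambda>x. f x + g x"])
  show "AE x in M. norm (sqrt (f x * g x)) \<le> norm (f x + g x)"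
    using nn
  proof eventually_elim
    case (elim x)
    then have "0 \<le> sqrt (f x * g x)" "sqrt (f x * g x) \<le> (f x + g x) / 2"
      using arith_geo_mean_sqrt[of "f x" "g x"] by auto
    then show ?case using elim by simp
  qed
qed (use f g in auto)

text \<open>Cauchy-Schwarz for a function f of integral 1, by the pointwise bound sqrt (f g) \<le>
  (s f + g / s) / 2; the scale s = sqrt of the integral of g balances the two terms.\<close>

lemma integral_sqrt_mult_le:
  fixes f g :: "'a \<Rightarrow> real"
  assumes f: "integrable M f" and g: "integrable M g" and nn: "AE x in M. 0 \<le> f x \<and> 0 \<le> g x"
    and f1: "(\<integral>x. f x \<partial>M) = 1" and g0: "(\<integral>x. g x \<partial>M) > 0"
  shows "(\<integral>x. sqrt (f x * g x) \<partial>M) \<le> sqrt (\<integral>x. g x \<partial>M)"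
proof -
  define s where "s = sqrt (\<integral>x. g x \<partial>M)"
  have s: "s > 0" "(\<integral>x. g x \<partial>M) = s * s" using g0 by (auto simp: s_def)
  have "(\<integral>x. sqrt (f x * g x) \<partial>M) \<le> (\<integral>x. (s * f x + g x / s) / 2 \<partial>M)"
  proof (rule integral_mono_AE[OF sqrt_mult_integrable[OF f g nn]])
    show "AE x in M. sqrt (f x * g x) \<le> (s * f x + g x / s) / 2"
      using nn
    proof eventually_elim
      case (elim x)
      then show ?case using arith_geo_mean_sqrt[of "s * f x" "g x / s"] s by simp
    qed
  qed (use f g in auto)
  also have "\<dots> = s" using f g s by (simp add: f1)
  finally show ?thesis by (simp add: s_def)
qed

context
  fixes n p C :: nat
  assumes pn: "p \<le> n"
begin

text \<open>Expanding the square, the squared Hellinger distance of two densities is 2 minus twice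
  their affinity.\<close>

lemma fmix_affinity:
  assumes t0: "t0 \<in> Xi n p C" and t: "t \<in> Xi n p C" and e: "\<epsilon> \<le> hell n p C t0 t" "0 \<le> \<epsilon>"
  shows "(\<integral>X. sqrt (fmix n p C t0 X * fmix n p C t X) \<partial>haar n p) \<le> 1 - \<epsilon>\<^sup>2 / 2"
proof -
  let ?f = "fmix n p C t0" and ?g = "fmix n p C t"
  have nn: "0 \<le> ?f X" "0 \<le> ?g X" for X
    using fmix_pos[OF pn t0] fmix_pos[OF pn t] by (simp_all add: less_imp_le)
  have i: "integrable (haar n p) (\<lambda>X. sqrt (?f X * ?g X))"
    using nn by (intro sqrt_mult_integrable fmix_integrable[OF pn]) auto
  have "\<epsilon>\<^sup>2 \<le> (hell n p C t0 t)\<^sup>2" using e by (intro power_mono)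
  also have "\<dots> = (\<integral>X. (sqrt (?f X) - sqrt (?g X))\<^sup>2 \<partial>haar n p)"
    unfolding hell_def by (intro real_sqrt_pow2 Bochner_Integration.integral_nonneg) simp
  also have "\<dots> = (\<integral>X. ?f X + ?g X - 2 * sqrt (?f X * ?g X) \<partial>haar n p)"
    using nn by (intro Bochner_Integration.integral_cong) (auto simp: power2_diff real_sqrt_mult)
  also have "\<dots> = 2 - 2 * (\<integral>X. sqrt (?f X * ?g X) \<partial>haar n p)"
    using i by (simp add: fmix_integrable[OF pn] fmix_integral[OF pn t0] fmix_integral[OF pn t])
  finally show ?thesis by simp
qed

text \<open>With g the mixture at t and u its envelope, sqrt u \<le> sqrt g + sqrt (u - g). The
  first term gives the affinity; by Cauchy-Schwarz the second costs the root of the excess mass of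
  u.\<close>

lemma envelope_affinity:
  assumes t0: "t0 \<in> Xi n p C" and t: "t \<in> Xi n p C" and e: "\<epsilon> \<le> hell n p C t0 t" "0 \<le> \<epsilon>" and \<eta>: "0 < \<eta>"
  shows "integrable (haar n p) (\<lambda>X. sqrt (fmix n p C t0 X * mix_envelope n p C \<eta> t X))" (is ?I)
    "(\<integral>X. sqrt (fmix n p C t0 X * mix_envelope n p C \<eta> t X) \<partial>haar n p)
      \<le> 1 - \<epsilon>\<^sup>2 / 2 + sqrt (exp (real (n * p + p) * \<eta>) * (1 + real C * \<eta>) - 1)" (is ?L)
proof -
  let ?f = "fmix n p C t0" and ?g = "fmix n p C t" and ?u = "mix_envelope n p C \<eta> t"
  have nn: "0 \<le> ?f X" "0 \<le> ?g X" for X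
    using fmix_pos[OF pn t0] fmix_pos[OF pn t] by (simp_all add: less_imp_le)
  have gu: "AE X in haar n p. ?g X \<le> ?u X"
    using AE_haar_stiefel[OF pn] by eventually_elim (use fmix_le_envelope_self[OF pn t] \<eta> in auto)
  have ig: "(\<integral>X. ?u X - ?g X \<partial>haar n p) = exp (real (n * p + p) * \<eta>) * (1 + real C * \<eta>) - 1"
    by (simp add: mix_envelope_integrable[OF pn] fmix_integrable[OF pn] mix_envelope_integral[OF pn t] fmix_integral[OF pn t])
  \<comment> \<open>Strictness comes from C > 0; the exponential factor equals 1 when p = 0.\<close>
  have "1 * 1 < exp (real (n * p + p) * \<eta>) * (1 + real C * \<eta>)"
    using \<eta> Xi_weights(4)[OF t] by (intro mult_le_less_imp_less) auto
  then have pos: "(\<integral>X. ?u X - ?g X \<partial>haar n p) > 0" using ig by simp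
  have i1: "integrable (haar n p) (\<lambda>X. sqrt (?f X * ?g X))"
    using nn by (intro sqrt_mult_integrable fmix_integrable[OF pn]) auto
  have gu': "AE X in haar n p. 0 \<le> ?f X \<and> 0 \<le> ?u X - ?g X"
    using gu by eventually_elim (simp add: nn)
  have "AE X in haar n p. 0 \<le> ?f X \<and> 0 \<le> ?u X"
    using gu by eventually_elim (use nn order_trans in blast)
  then show I: ?I
    by (intro sqrt_mult_integrable fmix_integrable[OF pn] mix_envelope_integrable[OF pn])
  have i2: "integrable (haar n p) (\<lambda>X. ?u X - ?g X)"
    by (intro Bochner_Integration.integrable_diff fmix_integrable[OF pn] mix_envelope_integrable[OF pn])
  note i3 = sqrt_mult_integrable[OF fmix_integrable[OF pn] i2 gu']
  have "(\<integral>X. sqrt (?f X * ?u X) \<partial>haar n p) \<le> (\<integral>X. sqrt (?f X * ?g X) + sqrt (?f X * (?u X - ?g X)) \<partial>haar n p)"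
  proof (rule integral_mono_AE[OF I])
    show "AE X in haar n p. sqrt (?f X * ?u X) \<le> sqrt (?f X * ?g X) + sqrt (?f X * (?u X - ?g X))"
      using gu
    proof eventually_elim
      case (elim X)
      have "sqrt (?g X + (?u X - ?g X)) \<le> sqrt (?g X) + sqrt (?u X - ?g X)"
        using nn elim by (intro sqrt_add_le_add_sqrt) auto
      then have "sqrt (?f X) * sqrt (?u X) \<le> sqrt (?f X) * (sqrt (?g X) + sqrt (?u X - ?g X))"
        using nn by (intro mult_left_mono) auto
      then show ?case by (simp only: real_sqrt_mult ring_distribs(1))
    qed
  qed (use i1 i3 in auto)
  also have "\<dots> = (\<integral>X. sqrt (?f X * ?g X) \<partial>haar n p) + (\<integral>X. sqrt (?f X * (?u X - ?g X)) \<partial>haar n p)"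
    by (rule Bochner_Integration.integral_add[OF i1 i3])
  also have "\<dots> \<le> (1 - \<epsilon>\<^sup>2 / 2) + sqrt (\<integral>X. ?u X - ?g X \<partial>haar n p)"
    by (intro add_mono fmix_affinity[OF t0 t e] integral_sqrt_mult_le[OF fmix_integrable[OF pn] i2 gu' fmix_integral[OF pn t0] pos])
  finally show ?L by (simp only: ig)
qed

lemma prob_space_sample_dist:
  assumes t0: "t0 \<in> Xi n p C"
  shows "prob_space (sample_dist n p C t0)"
proof (rule prob_spaceI)
  have "fmix n p C t0 \<in> borel_measurable (haar n p)" by (simp add: measurable_haar[OF pn] fmix_measurable)
  then have "emeasure (sample_dist n p C t0) (space (sample_dist n p C t0)) = (\<integral>\<^sup>+X. ennreal (fmix n p C t0 X) \<partial>haar n p)"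
    unfolding sample_dist_def by (subst emeasure_density) (auto intro!: nn_integral_cong)
  also have "\<dots> = ennreal (\<integral>X. fmix n p C t0 X \<partial>haar n p)"
    by (intro nn_integral_eq_integral fmix_integrable[OF pn]) (simp add: fmix_pos[OF pn t0] less_imp_le)
  finally show "emeasure (sample_dist n p C t0) (space (sample_dist n p C t0)) = 1"
    by (simp add: fmix_integral[OF pn t0])
qed

lemma AE_sample_dist_stiefel: "AE X in sample_dist n p C t0. X \<in> stiefel n p"
proof -
  have "fmix n p C t0 \<in> borel_measurable (haar n p)" by (simp add: measurable_haar[OF pn] fmix_measurable)
  then show ?thesis unfolding sample_dist_def using AE_haar_stiefel[OF pn]
    by (subst AE_density) (auto elim: eventually_mono)
qed

text \<open>The density f0 of an observation cancels half of the denominator: the mean of sqrt (u /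
  f0) is the integral of sqrt (f0 u).\<close>

lemma nn_integral_sample_sqrt_ratio:
  assumes t0: "t0 \<in> Xi n p C" and t: "t \<in> Xi n p C" and e: "\<epsilon> \<le> hell n p C t0 t" "0 \<le> \<epsilon>" and \<eta>: "0 < \<eta>"
  shows "(\<integral>\<^sup>+X. ennreal (sqrt (mix_envelope n p C \<eta> t X / fmix n p C t0 X)) \<partial>sample_dist n p C t0)
    \<le> ennreal (1 - \<epsilon>\<^sup>2 / 2 + sqrt (exp (real (n * p + p) * \<eta>) * (1 + real C * \<eta>) - 1))"
proof -
  let ?f = "fmix n p C t0" and ?u = "mix_envelope n p C \<eta> t"
  have [measurable]: "?f \<in> borel_measurable (haar n p)" "?u \<in> borel_measurable (haar n p)"
    by (simp_all add: measurable_haar[OF pn] fmix_measurable mix_envelope_measurable)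
  have f: "0 < ?f X" for X by (rule fmix_pos[OF pn t0])
  have u: "0 \<le> ?u X" for X
    unfolding mix_envelope_def using Xi_weights(1)[OF t] fML_pos[OF pn] \<eta>
    by (intro mult_nonneg_nonneg sum_nonneg add_nonneg_nonneg) (auto simp: less_imp_le)
  have eq: "?f X * sqrt (?u X / ?f X) = sqrt (?f X * ?u X)" for X
  proof -
    have "sqrt (?f X) * sqrt (?f X) = ?f X" using f[of X] by simp
    then show ?thesis using f[of X] by (simp add: real_sqrt_divide real_sqrt_mult field_simps)
  qed
  have "(\<integral>\<^sup>+X. ennreal (sqrt (?u X / ?f X)) \<partial>sample_dist n p C t0)
    = (\<integral>\<^sup>+X. ennreal (?f X) * ennreal (sqrt (?u X / ?f X)) \<partial>haar n p)"
    unfolding sample_dist_def by (rule nn_integral_density) measurable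
  also have "\<dots> = (\<integral>\<^sup>+X. ennreal (sqrt (?f X * ?u X)) \<partial>haar n p)"
    using f by (intro nn_integral_cong) (simp add: ennreal_mult'[symmetric] eq less_imp_le)
  also have "\<dots> = ennreal (\<integral>X. sqrt (?f X * ?u X) \<partial>haar n p)"
    using f u by (intro nn_integral_eq_integral envelope_affinity[OF t0 t e \<eta>]) (simp add: less_imp_le)
  also have "\<dots> \<le> ennreal (1 - \<epsilon>\<^sup>2 / 2 + sqrt (exp (real (n * p + p) * \<eta>) * (1 + real C * \<eta>) - 1))"
    by (intro ennreal_leI envelope_affinity[OF t0 t e \<eta>])
  finally show ?thesis .
qed

end

section \<open>Priors of the component parameters\<close>

lemma emeasure_density_pos:
  assumes f: "f \<in> borel_measurable M" and B: "B \<in> sets M" "emeasure M B > 0" and p: "\<And>x. x \<in> B \<Longrightarrow> 0 < f x"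
  shows "emeasure (density M f) B > 0"
proof (rule ccontr)
  assume "\<not> ?thesis"
  then have "B \<in> null_sets (density M f)" using B by (simp add: null_sets_def)
  then have "AE x in M. x \<in> B \<longrightarrow> f x = 0" using f by (simp add: null_sets_density_iff)
  then have "AE x in M. x \<notin> B" by eventually_elim (use p in force)
  then have "emeasure M B = 0" using AE_iff_null_sets[OF B(1)] by auto
  then show False using B by simp
qed

lemma sets_normdens[simp, measurable_cong]: "sets (normdens \<mu> A g) = sets \<mu>"
  by (simp add: normdens_def)

text \<open>This needs no integrability: a non-integrable g has integral 0 by convention, and
  division by it makes the density 0.\<close>

lemma normdens_mass_le:
  assumes A: "A \<in> sets \<mu>" and g: "g \<in> borel_measurable \<mu>" and nn: "\<And>x. 0 \<le> g x"
  shows "emeasure (normdens \<mu> A g) (space (normdens \<mu> A g)) \<le> 1"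
proof -
  define Z where "Z = (\<integral>y. indicator A y * g y \<partial>\<mu>)"
  have m: "(\<lambda>x. ennreal (indicator A x * g x / Z)) \<in> borel_measurable \<mu>" using A g by measurable
  have Z0: "0 \<le> Z" unfolding Z_def using nn by (intro Bochner_Integration.integral_nonneg) simp
  have "emeasure (normdens \<mu> A g) (space \<mu>) = (\<integral>\<^sup>+x. ennreal (indicator A x * g x / Z) \<partial>\<mu>)"
    unfolding normdens_def Z_def[symmetric] using m by (subst emeasure_density) (auto intro!: nn_integral_cong)
  also have "\<dots> \<le> 1"
  proof (cases "integrable \<mu> (\<lambda>y. indicator A y * g y)")
    case True
    then have "(\<integral>\<^sup>+x. ennreal (indicator A x * g x / Z) \<partial>\<mu>) = ennreal (\<integral>x. indicator A x * g x / Z \<partial>\<mu>)"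
      using nn Z0 by (intro nn_integral_eq_integral) auto
    also have "(\<integral>x. indicator A x * g x / Z \<partial>\<mu>) = Z / Z" by (simp add: Z_def)
    also have "ennreal (Z / Z) \<le> 1" by (cases "Z = 0") auto
    finally show ?thesis .
  next
    case False
    then have "Z = 0" unfolding Z_def by (rule not_integrable_integral_eq)
    then show ?thesis by simp
  qed
  finally show ?thesis by (simp add: normdens_def)
qed

lemma normdens_normalizer_pos:
  fixes g :: "'a \<Rightarrow> real"
  assumes A: "A \<in> sets \<mu>" and g: "g \<in> borel_measurable \<mu>" and nn: "\<And>x. 0 < g x"
    and i: "integrable \<mu> (\<lambda>y. indicator A y * g y)" and B: "B \<in> sets \<mu>" "B \<subseteq> A" "emeasure \<mu> B > 0"
  shows "(\<integral>y. indicator A y * g y \<partial>\<mu>) > 0"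
proof (rule ccontr)
  have nn': "0 \<le> indicator A y * g y" for y using nn[of y] by (intro mult_nonneg_nonneg) (auto simp: less_imp_le)
  assume "\<not> ?thesis"
  moreover have "0 \<le> (\<integral>y. indicator A y * g y \<partial>\<mu>)" by (rule Bochner_Integration.integral_nonneg[OF nn'])
  ultimately have "(\<integral>y. indicator A y * g y \<partial>\<mu>) = 0" by simp
  then have "AE y in \<mu>. indicator A y * g y = 0"
    using i nn' by (subst (asm) integral_nonneg_eq_0_iff_AE) auto
  then have "AE y in \<mu>. y \<notin> B"
    by eventually_elim (use nn B in \<open>auto simp: indicator_def less_le split: if_splits\<close>)
  then have "emeasure \<mu> B = 0" using AE_iff_null_sets[OF B(1)] by auto
  then show False using B by simp
qed

lemma normdens_pos:
  assumes A: "A \<in> sets \<mu>" and g: "g \<in> borel_measurable \<mu>" and nn: "\<And>x. 0 < g x"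
    and i: "integrable \<mu> (\<lambda>y. indicator A y * g y)" and B: "B \<in> sets \<mu>" "B \<subseteq> A" "emeasure \<mu> B > 0"
  shows "emeasure (normdens \<mu> A g) B > 0"
  unfolding normdens_def using A g
  by (intro emeasure_density_pos B) (use normdens_normalizer_pos[OF assms] nn B in auto)

lemma finite_measure_normdens:
  assumes "A \<in> sets \<mu>" "g \<in> borel_measurable \<mu>" "\<And>x. 0 \<le> g x"
  shows "finite_measure (normdens \<mu> A g)"
  using normdens_mass_le[OF assms] by (intro finite_measureI) (auto simp: top_unique)

lemma stiefel_pos_sets: "p \<le> n \<Longrightarrow> stiefel_pos n p \<in> sets (matspace n p)"
proof -
  assume pn: "p \<le> n"
  have "stiefel_pos n p = stiefel n p \<inter> {X \<in> space (matspace n p). \<forall>j\<in>{..<p}. 0 < X (0,j)}"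
    using stiefel_ext by (auto simp: stiefel_pos_def space_matspace)
  also have "\<dots> \<in> sets (matspace n p)" using pn
    by (intro sets.Int stiefel_sets sets.sets_Collect_finite_All borel_measurable_less mat_component borel_measurable_const) auto
  finally show ?thesis .
qed

text \<open>Shared by the priors of M and V, with \<open>A\<close> the frames of positive first row
  or all orthogonal matrices. The exponential of a linear form is bounded on the manifold, hence
  integrable.\<close>

lemma haar_normdens:
  fixes G :: mat
  assumes pn: "p \<le> n" and A: "A \<in> sets (matspace n p)" "A \<subseteq> stiefel n p"
  defines "g \<equiv> \<lambda>M::mat. exp (\<Sum>i<n. \<Sum>j<p. G (i,j) * M (i,j))"
  shows "finite_measure (normdens (haar n p) A g)"
    and "emeasure (normdens (haar n p) A g) (space (normdens (haar n p) A g)) \<le> 1"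
    and "X0 \<in> stiefel n p \<Longrightarrow> 0 < \<delta> \<Longrightarrow> mat_ball n p X0 \<delta> \<subseteq> A \<Longrightarrow> emeasure (normdens (haar n p) A g) (mat_ball n p X0 \<delta>) > 0"
proof -
  have g: "g \<in> borel_measurable (haar n p)" unfolding g_def
    using exp_lin_measurable[where F="\<lambda>i j. G (i,j)"] by (simp add: measurable_haar[OF pn])
  have A': "A \<in> sets (haar n p)" using A by (simp add: sets_haar[OF pn])
  show "finite_measure (normdens (haar n p) A g)" by (intro finite_measure_normdens A' g) (simp add: g_def)
  show "emeasure (normdens (haar n p) A g) (space (normdens (haar n p) A g)) \<le> 1"
    by (intro normdens_mass_le A' g) (simp add: g_def)
  assume "X0 \<in> stiefel n p" "0 < \<delta>" "mat_ball n p X0 \<delta> \<subseteq> A"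
  then show "emeasure (normdens (haar n p) A g) (mat_ball n p X0 \<delta>) > 0"
  proof (intro normdens_pos A' g haar_ball_pos[OF pn])
    show "integrable (haar n p) (\<lambda>y. indicat_real A y * g y)"
    proof (rule haar_integrable_bounded[OF pn])
      show "(\<lambda>y. indicat_real A y * g y) \<in> borel_measurable (matspace n p)"
        using g A by (simp add: measurable_haar[OF pn])
      fix X assume X: "X \<in> stiefel n p"
      show "\<bar>indicat_real A X * g X\<bar> \<le> exp (\<Sum>i<n. \<Sum>j<p. \<bar>G (i,j)\<bar>)"
        using stiefel_linear_bound[OF X, of "\<lambda>i j. G (i,j)" "\<lambda>i j. \<bar>G (i,j)\<bar>"]
        by (auto simp: g_def indicator_def abs_le_iff)
    qed
  qed (auto simp: g_def sets_haar[OF pn])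
qed

section \<open>The prior of d: growth of the normalising constant and exponential moment\<close>

lemma space_vecspace: "space (vecspace m) = extensional {..<m}"
  by (simp add: vecspace_def space_PiM PiE_def)

lemma vec_component: "i < m \<Longrightarrow> (\<lambda>x. x i) \<in> borel_measurable (vecspace m)"
  unfolding vecspace_def using measurable_component_singleton[of i "{..<m}" "\<lambda>_. lborel :: real measure"] by simp

lemma Sp_sets: "Sp p \<in> sets (vecspace p)"
proof -
  have "Sp p = {d \<in> space (vecspace p). (\<forall>j\<in>{..<p}. 0 < d j) \<and> (\<forall>j\<in>{..<p - 1}. d (Suc j) < d j)}"
    by (auto simp: Sp_def space_vecspace PiE_def)
  also have "\<dots> \<in> sets (vecspace p)"
    by (intro sets.sets_Collect_conj sets.sets_Collect_finite_All borel_measurable_less vec_component borel_measurable_const) auto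
  finally show ?thesis .
qed

lemma hyp0F1_measurable:
  assumes pn: "p \<le> n" shows "hyp0F1 n p \<in> borel_measurable (vecspace p)"
proof -
  interpret prob_space "haar n p" by (rule prob_space_haar[OF pn])
  have "(\<lambda>w. \<Sum>j<p. fst w j * snd w (j,j)) \<in> borel_measurable (vecspace p \<Otimes>\<^sub>M haar n p)"
  proof (intro borel_measurable_sum borel_measurable_times)
    fix j assume "j \<in> {..<p}"
    then show "(\<lambda>w. fst w j) \<in> borel_measurable (vecspace p \<Otimes>\<^sub>M haar n p)"
      "(\<lambda>w. snd w (j,j)) \<in> borel_measurable (vecspace p \<Otimes>\<^sub>M haar n p)"
      using pn by (auto intro!: measurable_compose[OF measurable_fst] measurable_compose[OF measurable_snd] vec_component
          simp: measurable_haar mat_component)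
  qed
  then have "(\<lambda>(d,X). exp (\<Sum>j<p. d j * X (j,j))) \<in> borel_measurable (vecspace p \<Otimes>\<^sub>M haar n p)"
    by (simp add: case_prod_beta)
  then show ?thesis unfolding hyp0F1_def[abs_def] by (rule borel_measurable_lebesgue_integral)
qed

text \<open>On a ball of radius \<kappa> around the frame of the first unit vectors all X_jj exceed
  1 - \<kappa>, and m is the Haar mass of that ball. Thus the constant grows almost like the
  exponential of the sum of the d_j.\<close>

lemma hyp0F1_ge:
  assumes pn: "p \<le> n" and k: "0 < \<kappa>"
  obtains m where "m > 0" "\<And>d. (\<And>j. j < p \<Longrightarrow> 0 \<le> d j) \<Longrightarrow> m * exp (\<Sum>j<p. (1 - \<kappa>) * d j) \<le> hyp0F1 n p d"
proof -
  interpret prob_space "haar n p" by (rule prob_space_haar[OF pn])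
  define E :: mat where "E = restrict (\<lambda>(i,j). if i = j then 1 else 0) ({..<n} \<times> {..<p})"
  have E: "E \<in> stiefel n p"
  proof (rule stiefelI)
    fix j k assume jk: "j < p" "k < p"
    have "(\<Sum>i<n. E (i,j) * E (i,k)) = (\<Sum>i<n. if i = j then (if j = k then 1 else 0) else 0)"
      using jk by (intro sum.cong) (auto simp: E_def)
    then show "(\<Sum>i<n. E (i,j) * E (i,k)) = (if j = k then 1 else 0)" using jk pn by simp
  qed (simp add: E_def)
  let ?B = "mat_ball n p E \<kappa>"
  define m where "m = measure (haar n p) ?B"
  have m: "m > 0" using haar_ball_pos[OF pn E k] by (simp add: m_def emeasure_eq_measure)
  have B: "?B \<in> sets (haar n p)" by (simp add: sets_haar[OF pn])
  have "m * exp (\<Sum>j<p. (1 - \<kappa>) * d j) \<le> hyp0F1 n p d" if d: "\<And>j. j < p \<Longrightarrow> 0 \<le> d j" for d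
  proof -
    have "m * exp (\<Sum>j<p. (1 - \<kappa>) * d j) = (\<integral>X. indicator ?B X * exp (\<Sum>j<p. (1 - \<kappa>) * d j) \<partial>haar n p)"
      using B by (simp add: m_def)
    also have "\<dots> \<le> (\<integral>X. exp (\<Sum>j<p. d j * X (j,j)) \<partial>haar n p)"
    proof (rule integral_mono)
      fix X
      show "indicator ?B X * exp (\<Sum>j<p. (1 - \<kappa>) * d j) \<le> exp (\<Sum>j<p. d j * X (j,j))"
      proof (cases "X \<in> ?B")
        case True
        have "(1 - \<kappa>) * d j \<le> d j * X (j,j)" if j: "j < p" for j
        proof -
          have "\<bar>X (j,j) - E (j,j)\<bar> < \<kappa>" using True j pn by (simp add: mat_ball_def)
          then have "1 - \<kappa> \<le> X (j,j)" using j pn by (simp add: E_def)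
          from mult_right_mono[OF this d[OF j]] show ?thesis by (simp add: mult.commute)
        qed
        then have "(\<Sum>j<p. (1 - \<kappa>) * d j) \<le> (\<Sum>j<p. d j * X (j,j))" by (intro sum_mono) auto
        then show ?thesis using True by simp
      qed simp
    qed (use B exp_diag_integrable[OF pn] in \<open>auto simp: integrable_indicator_iff emeasure_eq_measure\<close>)
    finally show ?thesis by (simp add: hyp0F1_def)
  qed
  with m show ?thesis by (rule that)
qed

text \<open>A product of m one-dimensional integrals, each dominated by a multiple of the
  exponential density.\<close>

lemma nn_integral_exp_orthant:
  assumes a: "a > 0"
  shows "(\<integral>\<^sup>+d. ennreal (indicator {d. \<forall>j<m. 0 < d j} d * exp (- a * (\<Sum>j<m. d j))) \<partial>vecspace m) < \<infinity>"
proof -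
  interpret product_sigma_finite "\<lambda>_. lborel :: real measure" by standard
  have one: "(\<integral>\<^sup>+x. ennreal (indicator {0<..} x * exp (- a * x)) \<partial>lborel) < \<infinity>"
  proof -
    interpret E: prob_space "density lborel (exponential_density a)" by (rule prob_space_exponential_density[OF a])
    have "(\<integral>\<^sup>+x. ennreal (indicator {0<..} x * exp (- a * x)) \<partial>lborel)
      \<le> (\<integral>\<^sup>+x. ennreal (1 / a) * ennreal (exponential_density a x) \<partial>lborel)"
    proof (rule nn_integral_mono)
      fix x :: real
      have "indicator {0<..} x * exp (- a * x) \<le> 1 / a * exponential_density a x"
        using a by (simp add: exponential_density_def indicator_def mult.commute)
      then show "ennreal (indicator {0<..} x * exp (- a * x)) \<le> ennreal (1 / a) * ennreal (exponential_density a x)"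
        using a by (simp add: ennreal_mult'[symmetric] ennreal_leI)
    qed
    also have "\<dots> = ennreal (1 / a) * (\<integral>\<^sup>+x. ennreal (exponential_density a x) \<partial>lborel)"
      by (rule nn_integral_cmult) measurable
    also have "(\<integral>\<^sup>+x. ennreal (exponential_density a x) \<partial>lborel) = 1"
      using E.emeasure_space_1 by (subst (asm) emeasure_density) auto
    finally show ?thesis by (simp add: order_le_less_trans)
  qed
  have "(\<integral>\<^sup>+d. ennreal (indicator {d. \<forall>j<m. 0 < d j} d * exp (- a * (\<Sum>j<m. d j))) \<partial>vecspace m)
    = (\<integral>\<^sup>+d. (\<Prod>j<m. ennreal (indicator {0<..} (d j) * exp (- a * d j))) \<partial>PiM {..<m} (\<lambda>_. lborel))"
    unfolding vecspace_def
  proof (rule nn_integral_cong)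
    fix d :: "nat \<Rightarrow> real"
    have "indicator {d. \<forall>j<m. 0 < d j} d * exp (- a * (\<Sum>j<m. d j)) = (\<Prod>j<m. indicator {0<..} (d j) * exp (- a * d j))"
      by (auto simp: indicator_def sum_distrib_left exp_sum sum_negf[symmetric] intro!: prod_zero[symmetric])
    then show "ennreal (indicator {d. \<forall>j<m. 0 < d j} d * exp (- a * (\<Sum>j<m. d j)))
      = (\<Prod>j<m. ennreal (indicator {0<..} (d j) * exp (- a * d j)))"
      by (simp add: prod_ennreal)
  qed
  also have "\<dots> = (\<Prod>j<m. \<integral>\<^sup>+x. ennreal (indicator {0<..} x * exp (- a * x)) \<partial>lborel)"
    by (rule product_nn_integral_prod) (simp, measurable)
  also have "\<dots> < \<infinity>" using one by (simp add: less_top[symmetric] power_eq_top_ennreal)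
  finally show ?thesis .
qed


lemma prior_d_facts:
  fixes \<nu> :: real and \<eta> :: vec
  assumes pn: "p \<le> n"
  shows finite_measure_prior_d: "finite_measure (prior_d n p \<nu> \<eta>)"
    and prior_d_exp_moment: "\<nu> > 0 \<Longrightarrow> (\<And>j. j < p \<Longrightarrow> \<eta> j < 1) \<Longrightarrow>
      \<exists>a>0. (\<integral>\<^sup>+d. ennreal (exp (a * (\<Sum>j<p. \<bar>d j\<bar>))) \<partial>prior_d n p \<nu> \<eta>) < \<infinity>"
    and prior_d_pos: "\<nu> > 0 \<Longrightarrow> (\<And>j. j < p \<Longrightarrow> \<eta> j < 1) \<Longrightarrow> B \<in> sets (vecspace p) \<Longrightarrow> B \<subseteq> Sp p \<Longrightarrow>
      emeasure (vecspace p) B > 0 \<Longrightarrow> emeasure (prior_d n p \<nu> \<eta>) B > 0"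
proof -
  define g where "g d = exp (\<nu> * (\<Sum>j<p. \<eta> j * d j)) / hyp0F1 n p d powr \<nu>" for d
  have g: "g \<in> borel_measurable (vecspace p)" unfolding g_def
    by (intro borel_measurable_divide powr_real_measurable hyp0F1_measurable[OF pn] borel_measurable_const
        measurable_compose[OF _ borel_measurable_exp] borel_measurable_times borel_measurable_sum vec_component) auto
  have gpos: "g d > 0" for d using hyp0F1_pos[OF pn, of d] by (simp add: g_def)
  have prior: "prior_d n p \<nu> \<eta> = normdens (vecspace p) (Sp p) g" by (simp add: prior_d_def g_def[abs_def])
  show "finite_measure (prior_d n p \<nu> \<eta>)"
    unfolding prior by (intro finite_measure_normdens Sp_sets g less_imp_le gpos)
  assume nu: "\<nu> > 0" and eta: "\<And>j. j < p \<Longrightarrow> \<eta> j < 1"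
  \<comment> \<open>The inserted 0 keeps the maximum defined for p = 0 and does not spoil b <
    1.\<close>
  define b where "b = Max (insert 0 (\<eta> ` {..<p}))"
  have b: "b < 1" "\<And>j. j < p \<Longrightarrow> \<eta> j \<le> b" unfolding b_def using eta by (subst Max_less_iff) auto
  \<comment> \<open>Half of the gap 1 - b pays for the loss in \<open>hyp0F1_ge\<close>. The other
    half leaves a decay rate \<nu> \<kappa> = 2 a, of which a is given to the exponential
    weight.\<close>
  define \<kappa> where "\<kappa> = (1 - b) / 2"
  have k: "\<kappa> > 0" using b by (simp add: \<kappa>_def)
  define a where "a = \<nu> * \<kappa> / 2"
  have a: "a > 0" using nu k by (simp add: a_def)
  obtain m where m: "m > 0" "\<And>d. (\<And>j. j < p \<Longrightarrow> 0 \<le> d j) \<Longrightarrow> m * exp (\<Sum>j<p. (1 - \<kappa>) * d j) \<le> hyp0F1 n p d"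
    using hyp0F1_ge[OF pn k] by blast
  define Orth where "Orth = {d :: vec. \<forall>j<p. 0 < d j}"
  let ?w = "\<lambda>d. exp (a * (\<Sum>j<p. \<bar>d j\<bar>))" and ?h = "\<lambda>d. indicator (Sp p) d * g d"
  have gle: "?h d * ?w d \<le> m powr - \<nu> * (indicator Orth d * exp (- a * (\<Sum>j<p. d j)))" for d
  proof (cases "d \<in> Sp p")
    case True
    then have d: "0 < d j" if "j < p" for j using that by (auto simp: Sp_def)
    let ?S = "\<Sum>j<p. d j"
    have "(m * exp ((1 - \<kappa>) * ?S)) powr \<nu> \<le> hyp0F1 n p d powr \<nu>"
      using m(2)[of d] d m(1) nu by (intro powr_mono2) (auto simp: less_imp_le sum_distrib_left)
    then have "m powr \<nu> * exp (\<nu> * ((1 - \<kappa>) * ?S)) \<le> hyp0F1 n p d powr \<nu>"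
      using m(1) by (simp add: powr_mult powr_def[of "exp _"] )
    then have "g d \<le> exp (\<nu> * (\<Sum>j<p. \<eta> j * d j)) / (m powr \<nu> * exp (\<nu> * ((1 - \<kappa>) * ?S)))"
      unfolding g_def using m(1) hyp0F1_pos[OF pn, of d] by (intro divide_left_mono mult_pos_pos) auto
    also have "\<dots> = m powr - \<nu> * exp (\<nu> * (\<Sum>j<p. \<eta> j * d j) - \<nu> * ((1 - \<kappa>) * ?S))"
      by (simp only: exp_diff powr_minus_divide times_divide_times_eq mult_1)
    also have "\<dots> \<le> m powr - \<nu> * exp (- 2 * a * ?S)"
    proof -
      have "(\<Sum>j<p. \<eta> j * d j) \<le> b * ?S"
        unfolding sum_distrib_left using b d by (intro sum_mono mult_right_mono) (auto simp: less_imp_le)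
      then have "\<nu> * (\<Sum>j<p. \<eta> j * d j) \<le> \<nu> * (b * ?S)" using nu by simp
      moreover have "\<nu> * (b * ?S) - \<nu> * ((1 - \<kappa>) * ?S) = - 2 * a * ?S"
        by (simp add: a_def \<kappa>_def field_simps)
      ultimately have "\<nu> * (\<Sum>j<p. \<eta> j * d j) - \<nu> * ((1 - \<kappa>) * ?S) \<le> - 2 * a * ?S" by linarith
      then show ?thesis by (intro mult_left_mono) auto
    qed
    finally have "g d * exp (a * ?S) \<le> m powr - \<nu> * exp (- 2 * a * ?S) * exp (a * ?S)"
      by (intro mult_right_mono) auto
    also have "\<dots> = m powr - \<nu> * exp (- a * ?S)"
      by (simp add: mult.assoc flip: exp_add)
    finally have "g d * exp (a * ?S) \<le> m powr - \<nu> * exp (- a * ?S)" .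
    moreover have "(\<Sum>j<p. \<bar>d j\<bar>) = ?S" using d by (intro sum.cong) (auto simp: less_imp_le)
    ultimately show ?thesis using True d by (simp add: Orth_def)
  qed simp
  have fin: "(\<integral>\<^sup>+d. ennreal (?h d * ?w d) \<partial>vecspace p) < \<infinity>"
  proof -
    have Om: "(\<lambda>d. indicat_real Orth d * exp (- a * (\<Sum>j<p. d j))) \<in> borel_measurable (vecspace p)"
    proof -
      have "Orth \<inter> space (vecspace p) = {d \<in> space (vecspace p). \<forall>j\<in>{..<p}. 0 < d j}" by (auto simp: Orth_def)
      also have "\<dots> \<in> sets (vecspace p)"
        by (intro sets.sets_Collect_finite_All borel_measurable_less vec_component borel_measurable_const) auto
      finally have "indicat_real Orth \<in> borel_measurable (vecspace p)" by (simp add: borel_measurable_indicator_iff)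
      then show ?thesis
        by (intro borel_measurable_times measurable_compose[OF _ borel_measurable_exp] borel_measurable_sum vec_component borel_measurable_const) auto
    qed
    have "(\<integral>\<^sup>+d. ennreal (?h d * ?w d) \<partial>vecspace p)
      \<le> (\<integral>\<^sup>+d. ennreal (m powr - \<nu>) * ennreal (indicator Orth d * exp (- a * (\<Sum>j<p. d j))) \<partial>vecspace p)"
      using gle by (intro nn_integral_mono) (simp add: ennreal_mult'[symmetric] ennreal_leI)
    also have "\<dots> = ennreal (m powr - \<nu>) * (\<integral>\<^sup>+d. ennreal (indicator Orth d * exp (- a * (\<Sum>j<p. d j))) \<partial>vecspace p)"
      by (rule nn_integral_cmult[OF measurable_compose[OF Om measurable_ennreal]])
    also have "\<dots> < \<infinity>"
      using nn_integral_exp_orthant[OF a, of p] by (simp add: Orth_def ennreal_mult_less_top)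
    finally show ?thesis .
  qed
  have int: "integrable (vecspace p) (\<lambda>d. ?h d)"
  proof (rule integrableI_bounded)
    show "(\<lambda>d. ?h d) \<in> borel_measurable (vecspace p)" using g Sp_sets by measurable
    \<comment> \<open>The weight is at least 1, so finiteness of the moment includes integrability
      of the unnormalised density.\<close>
    have "?h d \<le> ?h d * ?w d" for d
    proof -
      have "1 \<le> ?w d" using a by (simp add: sum_nonneg)
      then show ?thesis using mult_left_mono[of 1 "?w d" "?h d"] gpos[of d] by (simp add: less_imp_le)
    qed
    then have "(\<integral>\<^sup>+d. ennreal (norm (?h d)) \<partial>vecspace p)
      \<le> (\<integral>\<^sup>+d. ennreal (?h d * ?w d) \<partial>vecspace p)"
      using gpos by (intro nn_integral_mono ennreal_leI) (simp add: abs_mult less_imp_le)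
    then show "(\<integral>\<^sup>+d. ennreal (norm (?h d)) \<partial>vecspace p) < \<infinity>" using fin by (rule order_le_less_trans)
  qed
  show "\<exists>a>0. (\<integral>\<^sup>+d. ennreal (exp (a * (\<Sum>j<p. \<bar>d j\<bar>))) \<partial>prior_d n p \<nu> \<eta>) < \<infinity>"
  proof (intro exI[of _ a] conjI a)
    define Z where "Z = (\<integral>y. indicator (Sp p) y * g y \<partial>vecspace p)"
    have Z0: "0 \<le> Z" unfolding Z_def using gpos by (intro Bochner_Integration.integral_nonneg) (simp add: less_imp_le)
    have em: "(\<lambda>d. ?w d) \<in> borel_measurable (vecspace p)"
      by (intro measurable_compose[OF _ borel_measurable_exp] borel_measurable_times borel_measurable_sum
          borel_measurable_abs vec_component borel_measurable_const) auto
    have "(\<integral>\<^sup>+d. ennreal (?w d) \<partial>prior_d n p \<nu> \<eta>)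
      = (\<integral>\<^sup>+d. ennreal (?h d / Z) * ennreal (?w d) \<partial>vecspace p)"
      unfolding prior normdens_def Z_def[symmetric] by (intro nn_integral_density measurable_compose[OF _ measurable_ennreal] em borel_measurable_divide
          borel_measurable_times borel_measurable_indicator Sp_sets g borel_measurable_const)
    also have "\<dots> = (\<integral>\<^sup>+d. ennreal (1 / Z) * ennreal (?h d * ?w d) \<partial>vecspace p)"
      using Z0 gpos by (intro nn_integral_cong) (simp add: ennreal_mult'[symmetric] less_imp_le)
    also have "\<dots> = ennreal (1 / Z) * (\<integral>\<^sup>+d. ennreal (?h d * ?w d) \<partial>vecspace p)"
      by (intro nn_integral_cmult measurable_compose[OF _ measurable_ennreal] em
          borel_measurable_times borel_measurable_indicator Sp_sets g)
    also have "\<dots> < \<infinity>" using fin by (simp add: ennreal_mult_less_top)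
    finally show "(\<integral>\<^sup>+d. ennreal (?w d) \<partial>prior_d n p \<nu> \<eta>) < \<infinity>" .
  qed
  assume B: "B \<in> sets (vecspace p)" "B \<subseteq> Sp p" "emeasure (vecspace p) B > 0"
  then show "emeasure (prior_d n p \<nu> \<eta>) B > 0"
    unfolding prior by (intro normdens_pos Sp_sets g gpos int)
qed

text \<open>The finitely many strict inequalities defining \<open>Sp\<close> hold with slack at
  least 2 r. Moving every entry by less than r changes a difference of two entries by less than 2
  r.\<close>

lemma Sp_contains_box:
  assumes d: "d \<in> Sp p"
  obtains r where "r > 0" "\<And>r'. r' \<le> r \<Longrightarrow> vec_box p d r' \<subseteq> Sp p"
proof -
  let ?R = "insert 1 (d ` {..<p} \<union> (\<lambda>j. d j - d (Suc j)) ` {j. Suc j < p})"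
  have fin: "finite ?R" by (simp add: finite_subset[of "{j. Suc j < p}" "{..<p}"] subset_eq)
  have pos: "\<forall>r\<in>?R. r > 0" using d by (auto simp: Sp_def)
  define r where "r = Min ?R / 2"
  have r: "r > 0" using fin pos by (simp add: r_def Min_gr_iff del: Min_insert)
  have le: "2 * r \<le> s" if "s \<in> ?R" for s using Min_le[OF fin that] by (simp add: r_def del: Min_insert)
  have "vec_box p d r' \<subseteq> Sp p" if r': "r' \<le> r" for r'
  proof
    fix y assume y: "y \<in> vec_box p d r'"
    have yd: "\<bar>y j - d j\<bar> < r" if "j < p" for j using vec_boxD[OF y that] r' by simp
    have "0 < y j" if j: "j < p" for j
    proof -
      have "2 * r \<le> d j" using j by (intro le) auto
      then show ?thesis using yd[OF j] r by linarith
    qed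
    moreover have "y (Suc j) < y j" if j: "Suc j < p" for j
    proof -
      have "2 * r \<le> d j - d (Suc j)" using j by (intro le) auto
      then show ?thesis using yd[OF j] yd[of j] j by linarith
    qed
    ultimately show "y \<in> Sp p" using y by (auto simp: Sp_def vec_box_def PiE_def)
  qed
  with r show ?thesis by (rule that)
qed

section \<open>The Dirichlet distribution\<close>

text \<open>The substitution y = s x. The differential and the two powers contribute the exponents
  1, a - 1 and e - 1 of s.\<close>

lemma nn_integral_beta_scaled:
  fixes a e s :: real
  assumes a: "a > 0" and e: "e > 0" and s: "s > 0"
  shows "(\<integral>\<^sup>+y. ennreal (indicator {0<..<s} y * (y powr (a - 1) * (s - y) powr (e - 1))) \<partial>lborel)
    = ennreal (Beta a e * s powr (a + e - 1))"
proof -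
  let ?f = "\<lambda>y. ennreal (indicator {0<..<s} y * (y powr (a - 1) * (s - y) powr (e - 1)))"
  let ?b = "\<lambda>x. x powr (a - 1) * (1 - x) powr (e - 1) :: real"
  have fm: "?f \<in> borel_measurable borel" by measurable
  have "(?b has_integral Beta a e) {0<..<1}"
    using has_integral_Beta_real[OF a e] by (simp add: has_integral_Icc_iff_Ioo)
  then have B: "(\<integral>\<^sup>+x. ennreal (indicator {0<..<1} x * ?b x) \<partial>lborel) = ennreal (Beta a e)"
    by (intro nn_integral_has_integral_lebesgue) auto
  have "(\<integral>\<^sup>+y. ?f y \<partial>lborel) = ennreal \<bar>s\<bar> * (\<integral>\<^sup>+x. ?f (0 + s * x) \<partial>lborel)"
    using s by (intro nn_integral_real_affine[OF fm]) simp
  also have "(\<integral>\<^sup>+x. ?f (0 + s * x) \<partial>lborel) = (\<integral>\<^sup>+x. ennreal (s powr (a + e - 2)) * ennreal (indicator {0<..<1} x * ?b x) \<partial>lborel)"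
  proof (rule nn_integral_cong)
    fix x :: real
    have "indicator {0<..<s} (s * x) * ((s * x) powr (a - 1) * (s - s * x) powr (e - 1))
      = s powr (a + e - 2) * (indicator {0<..<1} x * ?b x)"
    proof (cases "0 < x \<and> x < 1")
      case True
      have "s - s * x = s * (1 - x)" by (simp add: algebra_simps)
      moreover have "s powr (a + e - 2) = s powr (a - 1) * s powr (e - 1)"
        by (simp flip: powr_add)
      ultimately show ?thesis using True s by (simp add: powr_mult)
    next
      case False
      then have "s * x \<notin> {0<..<s}" "x \<notin> {0<..<1}" using s by (auto simp: zero_less_mult_iff)
      then show ?thesis by simp
    qed
    then show "?f (0 + s * x) = ennreal (s powr (a + e - 2)) * ennreal (indicator {0<..<1} x * ?b x)"
      by (simp add: ennreal_mult')
  qed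
  also have "\<dots> = ennreal (s powr (a + e - 2)) * ennreal (Beta a e)"
    by (subst nn_integral_cmult) (measurable, simp add: B)
  also have "ennreal \<bar>s\<bar> * (ennreal (s powr (a + e - 2)) * ennreal (Beta a e)) = ennreal (s * s powr (a + e - 2)) * ennreal (Beta a e)"
    using s by (simp add: ennreal_mult' mult.assoc)
  also have "s * s powr (a + e - 2) = s powr (a + e - 1)"
    using s powr_add[of s 1 "a + e - 2"] by (simp add: algebra_simps)
  also have "ennreal (s powr (a + e - 1)) * ennreal (Beta a e) = ennreal (Beta a e * s powr (a + e - 1))"
    by (simp add: ennreal_mult'' mult.commute)
  finally show ?thesis .
qed

text \<open>The unnormalised Dirichlet density in all coordinates but the last, whose exponent is b
  - 1, on a simplex of size s. The size is free because fixing one coordinate y leaves the kernel of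
  size s - y.\<close>

definition dir_kernel :: "nat \<Rightarrow> (nat \<Rightarrow> real) \<Rightarrow> real \<Rightarrow> real \<Rightarrow> vec \<Rightarrow> real" where
  "dir_kernel m a b s x = indicator {x. (\<forall>c<m. 0 < x c) \<and> (\<Sum>c<m. x c) < s} x *
     ((\<Prod>c<m. x c powr (a c - 1)) * (s - (\<Sum>c<m. x c)) powr (b - 1))"

lemma simplex_sets: "{x \<in> space (vecspace m). (\<forall>c<m. 0 < x c) \<and> (\<Sum>c<m. x c) < s} \<in> sets (vecspace m)"
proof -
  have "{x \<in> space (vecspace m). (\<forall>c<m. 0 < x c) \<and> (\<Sum>c<m. x c) < s}
    = {x \<in> space (vecspace m). (\<forall>c\<in>{..<m}. 0 < x c) \<and> (\<Sum>c<m. x c) < s}" by auto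
  also have "\<dots> \<in> sets (vecspace m)"
    by (intro sets.sets_Collect_conj sets.sets_Collect_finite_All borel_measurable_less vec_component
        borel_measurable_const borel_measurable_sum) auto
  finally show ?thesis .
qed

lemma simplex_indicator: "(\<lambda>x. indicat_real {x. (\<forall>c<m. 0 < x c) \<and> (\<Sum>c<m. x c) < s} x) \<in> borel_measurable (vecspace m)"
proof -
  have "{x. (\<forall>c<m. 0 < x c) \<and> (\<Sum>c<m. x c) < s} \<inter> space (vecspace m)
    = {x \<in> space (vecspace m). (\<forall>c<m. 0 < x c) \<and> (\<Sum>c<m. x c) < s}" by auto
  also have "\<dots> \<in> sets (vecspace m)" by (rule simplex_sets)
  finally show ?thesis by (rule borel_measurable_indicator_iff[THEN iffD2])
qed

lemma dir_kernel_measurable: "dir_kernel m a b s \<in> borel_measurable (vecspace m)"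
  unfolding dir_kernel_def
  by (intro borel_measurable_times simplex_indicator borel_measurable_prod powr_real_measurable
      borel_measurable_diff borel_measurable_sum vec_component borel_measurable_const) auto

lemma dir_kernel_nonneg: "0 \<le> dir_kernel m a b s x"
  by (auto simp: dir_kernel_def indicator_def intro!: mult_nonneg_nonneg prod_nonneg)

lemma dir_kernel_Suc:
  "dir_kernel (Suc m) a b s (x(m := y)) = indicator {0<..<s} y * y powr (a m - 1) * dir_kernel m a b (s - y) x"
proof -
  have S: "(\<Sum>c<Suc m. (x(m := y)) c) = (\<Sum>c<m. x c) + y"
    unfolding sum.lessThan_Suc by (intro arg_cong2[where f="(+)"] sum.cong) auto
  have P: "(\<Prod>c<Suc m. (x(m := y)) c powr (a c - 1)) = (\<Prod>c<m. x c powr (a c - 1)) * y powr (a m - 1)"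
    unfolding prod.lessThan_Suc by (intro arg_cong2[where f="(*)"] prod.cong) auto
  have I: "(\<forall>c<Suc m. 0 < (x(m := y)) c) \<longleftrightarrow> (\<forall>c<m. 0 < x c) \<and> 0 < y" by (auto simp: less_Suc_eq)
  show ?thesis
  proof (cases "(\<forall>c<m. 0 < x c) \<and> 0 < y \<and> (\<Sum>c<m. x c) + y < s")
    case True
    then have "0 \<le> (\<Sum>c<m. x c)" by (intro sum_nonneg) (auto simp: less_imp_le)
    then have "y < s" using True by linarith
    have "(\<Sum>c<m. x c) < s - y" using True by linarith
    have "s - ((\<Sum>c<m. x c) + y) = s - y - (\<Sum>c<m. x c)" by simp
    then show ?thesis using True \<open>y < s\<close> \<open>(\<Sum>c<m. x c) < s - y\<close>
      unfolding dir_kernel_def S P by (simp add: I S mult_ac diff_diff_eq add.commute del: fun_upd_apply sum.lessThan_Suc)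
  next
    case False
    then show ?thesis unfolding dir_kernel_def S P
      by (auto simp: indicator_def I S simp del: fun_upd_apply sum.lessThan_Suc)
  qed
qed

text \<open>The induction hypothesis, at size s - y, turns the integral over the removed coordinate
  into a scaled Beta integral. The exact power of s is tracked to make this possible, and K collects
  the Beta factors.\<close>

lemma nn_integral_dir_kernel_finite:
  assumes b: "b > 0" and a: "\<And>c. c < m \<Longrightarrow> a c > 0"
  shows "\<exists>K\<ge>0. \<forall>s>0. (\<integral>\<^sup>+x. ennreal (dir_kernel m a b s x) \<partial>vecspace m) = ennreal (K * s powr (b + (\<Sum>c<m. a c) - 1))"
  using a
proof (induction m)
  case 0
  interpret product_sigma_finite "\<lambda>_. lborel :: real measure" by standard
  show ?case by (intro exI[of _ 1]) (simp add: vecspace_def nn_integral_empty dir_kernel_def PiM_empty)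
next
  case (Suc m)
  interpret product_sigma_finite "\<lambda>_. lborel :: real measure" by standard
  from Suc obtain K where K: "K \<ge> 0" and IH: "\<And>s. s > 0 \<Longrightarrow>
    (\<integral>\<^sup>+x. ennreal (dir_kernel m a b s x) \<partial>vecspace m) = ennreal (K * s powr (b + (\<Sum>c<m. a c) - 1))" by auto
  let ?e = "b + (\<Sum>c<m. a c)"
  have e: "?e > 0" using b Suc.prems by (intro add_pos_nonneg sum_nonneg) (auto simp: less_imp_le)
  have am: "a m > 0" using Suc.prems by simp
  have "(\<integral>\<^sup>+x. ennreal (dir_kernel (Suc m) a b s x) \<partial>vecspace (Suc m)) = ennreal (K * Beta (a m) ?e * s powr (b + (\<Sum>c<Suc m. a c) - 1))"
    if s: "s > 0" for s
  proof -
    have "(\<integral>\<^sup>+x. ennreal (dir_kernel (Suc m) a b s x) \<partial>vecspace (Suc m))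
      = (\<integral>\<^sup>+y. (\<integral>\<^sup>+x. ennreal (dir_kernel (Suc m) a b s (x(m := y))) \<partial>vecspace m) \<partial>lborel)"
    proof -
      have "(\<lambda>x. ennreal (dir_kernel (Suc m) a b s x)) \<in> borel_measurable (PiM (insert m {..<m}) (\<lambda>_. lborel))"
        using dir_kernel_measurable[of "Suc m" a b s] by (simp add: vecspace_def lessThan_Suc)
      from product_nn_integral_insert_rev[OF _ _ this] show ?thesis
        by (simp add: vecspace_def lessThan_Suc)
    qed
    also have "\<dots> = (\<integral>\<^sup>+y. ennreal K * ennreal (indicator {0<..<s} y * (y powr (a m - 1) * (s - y) powr (?e - 1))) \<partial>lborel)"
    proof (rule nn_integral_cong)
      fix y :: real
      show "(\<integral>\<^sup>+x. ennreal (dir_kernel (Suc m) a b s (x(m := y))) \<partial>vecspace m)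
        = ennreal K * ennreal (indicator {0<..<s} y * (y powr (a m - 1) * (s - y) powr (?e - 1)))"
      proof (cases "y \<in> {0<..<s}")
        case True
        have "(\<integral>\<^sup>+x. ennreal (dir_kernel (Suc m) a b s (x(m := y))) \<partial>vecspace m)
          = (\<integral>\<^sup>+x. ennreal (y powr (a m - 1)) * ennreal (dir_kernel m a b (s - y) x) \<partial>vecspace m)"
          using True by (intro nn_integral_cong) (simp add: dir_kernel_Suc ennreal_mult' dir_kernel_nonneg)
        also have "\<dots> = ennreal (y powr (a m - 1)) * ennreal (K * (s - y) powr (?e - 1))"
          using True dir_kernel_measurable[of m a b "s - y"] by (subst nn_integral_cmult) (auto simp: IH)
        also have "\<dots> = ennreal K * ennreal (indicator {0<..<s} y * (y powr (a m - 1) * (s - y) powr (?e - 1)))"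
          using True K by (simp add: ennreal_mult'[symmetric] mult_ac)
        finally show ?thesis .
      qed (simp add: dir_kernel_Suc)
    qed
    also have "\<dots> = ennreal K * ennreal (Beta (a m) ?e * s powr (a m + ?e - 1))"
      by (subst nn_integral_cmult) (measurable, simp add: nn_integral_beta_scaled[OF am e s])
    also have "\<dots> = ennreal (K * Beta (a m) ?e * s powr (b + (\<Sum>c<Suc m. a c) - 1))"
      using K by (simp add: ennreal_mult'[symmetric] add_ac mult.assoc)
    finally show ?thesis .
  qed
  moreover have "Beta (a m) ?e \<ge> 0" using am e by (auto simp: Beta_def less_imp_le intro!: divide_nonneg_nonneg mult_nonneg_nonneg Gamma_real_nonneg)
  ultimately show ?case using K by (intro exI[of _ "K * Beta (a m) ?e"]) auto
qed

section \<open>Total mass and support of the Dirichlet law\<close>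

text \<open>The map bound by \<open>let\<close> inside \<open>dirichlet\<close>, named so that facts
  about it can be stated.\<close>

definition complete_last :: "nat \<Rightarrow> vec \<Rightarrow> vec" where
  "complete_last C x = restrict (\<lambda>c. if c < C - 1 then x c else 1 - (\<Sum>k<C - 1. x k)) {..<C}"

lemma complete_last_measurable: "complete_last C \<in> measurable (vecspace (C - 1)) (vecspace C)"
  unfolding complete_last_def vecspace_def[of C]
proof (rule measurable_restrict)
  fix c assume "c \<in> {..<C}"
  show "(\<lambda>x. if c < C - 1 then x c else 1 - (\<Sum>k<C - 1. x k)) \<in> measurable (vecspace (C - 1)) lborel"
    using vec_component[of c "C - 1"]
    by (cases "c < C - 1") (auto intro!: borel_measurable_diff borel_measurable_sum vec_component)
qed

lemma dirichlet_eq: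
  assumes C: "0 < C"
  shows "dirichlet C \<alpha> = distr (density (vecspace (C - 1)) (\<lambda>x. ennreal (Gamma (\<Sum>c<C. \<alpha> c) / (\<Prod>c<C. Gamma (\<alpha> c))
       * dir_kernel (C - 1) \<alpha> (\<alpha> (C - 1)) 1 x))) (vecspace C) (complete_last C)"
proof -
  obtain m where m: "C = Suc m" using C by (cases C) auto
  have "(\<Prod>c<C. complete_last C x c powr (\<alpha> c - 1)) = (\<Prod>c<m. x c powr (\<alpha> c - 1)) * (1 - (\<Sum>c<m. x c)) powr (\<alpha> m - 1)" for x
    by (simp add: m complete_last_def)
  then show ?thesis
    unfolding dirichlet_def Let_def complete_last_def[symmetric, abs_def] dir_kernel_def
    by (simp add: m mult_ac)
qed

lemma finite_measure_dirichlet: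
  assumes C: "0 < C" and al: "\<And>c. c < C \<Longrightarrow> 0 < \<alpha> c"
  shows "finite_measure (dirichlet C \<alpha>)"
proof -
  let ?G = "Gamma (\<Sum>c<C. \<alpha> c) / (\<Prod>c<C. Gamma (\<alpha> c))"
  let ?k = "dir_kernel (C - 1) \<alpha> (\<alpha> (C - 1)) 1"
  have m: "?k \<in> borel_measurable (vecspace (C - 1))" by (rule dir_kernel_measurable)
  have "emeasure (density (vecspace (C - 1)) (\<lambda>x. ennreal (?G * ?k x))) (space (vecspace (C - 1)))
    = (\<integral>\<^sup>+x. ennreal (?G * ?k x) \<partial>vecspace (C - 1))"
    using m by (subst emeasure_density) (auto intro!: nn_integral_cong)
  also have "\<dots> = (\<integral>\<^sup>+x. ennreal ?G * ennreal (?k x) \<partial>vecspace (C - 1))"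
    by (intro nn_integral_cong ennreal_mult'' dir_kernel_nonneg)
  also have "\<dots> = ennreal ?G * (\<integral>\<^sup>+x. ennreal (?k x) \<partial>vecspace (C - 1))"
    using m by (intro nn_integral_cmult) auto
  also have "\<dots> < \<infinity>"
    using nn_integral_dir_kernel_finite[of "\<alpha> (C - 1)" "C - 1" \<alpha>] al C by (auto simp: ennreal_mult_less_top)
  finally have "finite_measure (density (vecspace (C - 1)) (\<lambda>x. ennreal (?G * ?k x)))"
    by (intro finite_measureI) auto
  then show ?thesis unfolding dirichlet_eq[OF C]
    by (rule finite_measure.finite_measure_distr) (use complete_last_measurable[of C] in simp)
qed

definition weight_ball :: "nat \<Rightarrow> vec \<Rightarrow> real \<Rightarrow> vec set" where
  "weight_ball C q \<delta> = {r \<in> pi_simplex C. \<forall>c<C. \<bar>r c - q c\<bar> < \<delta>}"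

lemma pi_simplex_sets: "pi_simplex C \<in> sets (vecspace C)"
proof -
  have "pi_simplex C = {q \<in> space (vecspace C). (\<forall>c\<in>{..<C}. 0 < q c) \<and> (\<forall>c\<in>{..<C}. q c < 1) \<and> (\<Sum>c<C. q c) = 1}"
    by (auto simp: pi_simplex_def space_vecspace PiE_def)
  also have "\<dots> \<in> sets (vecspace C)"
    by (intro sets.sets_Collect_conj sets.sets_Collect_finite_All borel_measurable_less borel_measurable_eq
        borel_measurable_sum vec_component borel_measurable_const) auto
  finally show ?thesis .
qed

lemma weight_ball_sets: "weight_ball C q \<delta> \<in> sets (vecspace C)"
proof -
  have "weight_ball C q \<delta> = pi_simplex C \<inter> {r \<in> space (vecspace C). \<forall>c\<in>{..<C}. \<bar>r c - q c\<bar> < \<delta>}"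
    by (auto simp: weight_ball_def pi_simplex_def space_vecspace PiE_def)
  also have "\<dots> \<in> sets (vecspace C)"
    by (intro sets.Int pi_simplex_sets sets.sets_Collect_finite_All borel_measurable_less borel_measurable_abs
        borel_measurable_diff vec_component borel_measurable_const) auto
  finally show ?thesis .
qed

text \<open>A small box around the first C - 1 weights has positive mass under the density, and
  completing its points by the last weight leads into the ball.\<close>

lemma dirichlet_ball_pos:
  assumes q: "q \<in> pi_simplex C" and al: "\<And>c. c < C \<Longrightarrow> 0 < \<alpha> c" and d: "0 < \<delta>"
  shows "emeasure (dirichlet C \<alpha>) (weight_ball C q \<delta>) > 0"
proof -
  have q': "\<And>c. c < C \<Longrightarrow> 0 < q c" "\<And>c. c < C \<Longrightarrow> q c < 1" "(\<Sum>c<C. q c) = 1" using q by (auto simp: pi_simplex_def)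
  have "C \<noteq> 0"
  proof
    assume "C = 0" then show False using q'(3) by simp
  qed
  \<comment> \<open>Weights lie strictly below 1 and sum to 1, so there are at least two of
    them.\<close>
  moreover have "C \<noteq> 1"
  proof
    assume "C = 1" then show False using q'(2)[of 0] q'(3) by simp
  qed
  ultimately obtain m where m: "C = Suc m" "0 < m" by (cases C) auto
  \<comment> \<open>Bounded by all weights of q, so that weights stay positive under changes smaller
    than \<open>\<delta>'\<close>.\<close>
  define \<delta>' where "\<delta>' = Min (insert \<delta> (q ` {..<C}))"
  have d': "0 < \<delta>'" "\<delta>' \<le> \<delta>" "\<And>c. c < C \<Longrightarrow> \<delta>' \<le> q c"
    unfolding \<delta>'_def using d q' by (subst Min_gr_iff, auto)
  \<comment> \<open>The error of the last weight is the sum of m = C - 1 errors below r, hence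
    smaller than \<open>\<delta>'\<close>.\<close>
  define r where "r = \<delta>' / real C"
  have r: "0 < r" using d' m by (simp add: r_def)
  have mr: "real m * r < \<delta>'" using d' m by (simp add: r_def field_simps)
  have r': "r < \<delta>'" using d' m by (simp add: r_def field_simps)
  define B where "B = vec_box m q r"
  have B: "B \<in> sets (vecspace m)" "emeasure (vecspace m) B > 0"
    using vec_box_sets vec_box_pos[OF r] by (simp_all add: B_def)
  have qm: "q m = 1 - (\<Sum>c<m. q c)" using q'(3) by (simp add: m)
  have box: "complete_last C x \<in> weight_ball C q \<delta>" "dir_kernel m \<alpha> (\<alpha> m) 1 x > 0" if x: "x \<in> B" for x
  proof -
    have xd: "\<bar>x c - q c\<bar> < r" if "c < m" for c using x that by (auto simp: B_def dest: vec_boxD)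
    define s where "s = (\<Sum>c<m. x c)"
    have "\<bar>s - (\<Sum>c<m. q c)\<bar> \<le> (\<Sum>c<m. \<bar>x c - q c\<bar>)"
      unfolding s_def sum_subtractf[symmetric] by (rule sum_abs)
    also have "\<dots> \<le> (\<Sum>c<m. r)" using xd by (intro sum_mono) (auto simp: less_imp_le)
    also have "\<dots> < \<delta>'" using mr by simp
    finally have s: "\<bar>s - (\<Sum>c<m. q c)\<bar> < \<delta>'" .
    have xc: "x c > 0" if "c < m" for c using xd[OF that] d'(3)[of c] r' that m by auto
    have s1: "s < 1" using s d'(3)[of m] qm m by auto
    show "dir_kernel m \<alpha> (\<alpha> m) 1 x > 0"
    proof -
      have "0 < x c powr (\<alpha> c - 1)" if "c < m" for c using xc[OF that] by simp
      then have "0 < (\<Prod>c<m. x c powr (\<alpha> c - 1))" by (intro prod_pos) auto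
      then show ?thesis using xc s1 by (simp add: dir_kernel_def s_def[symmetric])
    qed
    let ?y = "complete_last C x"
    have y: "?y c = x c" if "c < m" for c using that by (simp add: complete_last_def m)
    have ym: "?y m = 1 - s" by (simp add: complete_last_def m s_def)
    have ypos: "0 < ?y c" if "c < C" for c
      using that xc s1 y ym m by (cases "c < m") (auto simp: less_Suc_eq)
    have ysum: "(\<Sum>c<C. ?y c) = 1" using y ym by (simp add: m s_def)
    have ylt: "?y c < 1" if c: "c < C" for c
    proof -
      \<comment> \<open>A second index: its positive weight keeps the weight at c below 1.\<close>
      define k where "k = (if c = 0 then 1 else 0 :: nat)"
      have k: "k < C" "k \<noteq> c" using m by (auto simp: k_def)
      have "?y c + ?y k = (\<Sum>c\<in>{c,k}. ?y c)" using k by simp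
      also have "\<dots> \<le> (\<Sum>c<C. ?y c)" using k c ypos by (intro sum_mono2) (auto simp: less_imp_le)
      finally show ?thesis using ysum ypos[OF k(1)] by simp
    qed
    have yd: "\<bar>?y c - q c\<bar> < \<delta>" if "c < C" for c
    proof (cases "c < m")
      case True
      then show ?thesis using xd[OF True] r' d'(2) y by auto
    next
      case False
      then have "c = m" using that m by simp
      then show ?thesis using s d'(2) by (simp add: ym qm)
    qed
    have "?y \<in> extensional {..<C}" by (simp add: complete_last_def)
    then show "?y \<in> weight_ball C q \<delta>"
      using ypos ylt ysum yd by (auto simp: weight_ball_def pi_simplex_def PiE_def)
  qed
  let ?D = "density (vecspace m) (\<lambda>x. ennreal (Gamma (\<Sum>c<C. \<alpha> c) / (\<Prod>c<C. Gamma (\<alpha> c)) * dir_kernel m \<alpha> (\<alpha> m) 1 x))"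
  have cm: "complete_last C \<in> measurable ?D (vecspace C)" using complete_last_measurable[of C] by (simp add: m)
  have Gp: "Gamma (\<Sum>c<C. \<alpha> c) / (\<Prod>c<C. Gamma (\<alpha> c)) > 0"
    using al m by (intro divide_pos_pos prod_pos Gamma_real_pos sum_pos) auto
  have "0 < emeasure ?D B"
  proof (rule emeasure_density_pos[OF _ B])
    show "0 < ennreal (Gamma (\<Sum>c<C. \<alpha> c) / (\<Prod>c<C. Gamma (\<alpha> c)) * dir_kernel m \<alpha> (\<alpha> m) 1 x)" if "x \<in> B" for x
      using Gp box(2)[OF that] mult_pos_pos by (simp only: ennreal_less_zero_iff)
  qed (use dir_kernel_measurable in measurable)
  also have "emeasure ?D B \<le> emeasure ?D (complete_last C -` weight_ball C q \<delta> \<inter> space ?D)"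
    using box(1) sets.sets_into_space[OF B(1)] measurable_sets[OF cm weight_ball_sets]
    by (intro emeasure_mono) auto
  also have "\<dots> = emeasure (dirichlet C \<alpha>) (weight_ball C q \<delta>)"
    using m emeasure_distr[OF cm weight_ball_sets, of q \<delta>] dirichlet_eq[of C \<alpha>] by simp
  finally show ?thesis .
qed

section \<open>Summability over cells\<close>

text \<open>In the enumeration \<open>int_decode\<close> the k-th integer has absolute value at
  least k/2 - 1, which gives a geometric series of ratio exp (- b/2).\<close>

lemma nn_integral_int_exp_finite:
  fixes b :: real
  assumes b: "b > 0"
  shows "(\<integral>\<^sup>+z. ennreal (exp (- b * (\<bar>real_of_int z\<bar> - 1))) \<partial>count_space UNIV) < \<infinity>"
proof -
  let ?f = "\<lambda>z::int. exp (- b * (\<bar>real_of_int z\<bar> - 1))"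
  have le: "?f (int_decode k) \<le> exp (2 * b) * exp (- b / 2) ^ k" for k
  proof -
    have "real k / 2 - 1 \<le> \<bar>real_of_int (int_decode k)\<bar>"
      by (cases "even k") (auto simp: int_decode_def sum_decode_def elim!: evenE oddE)
    then have "b * (real k / 2 - 1) \<le> b * \<bar>real_of_int (int_decode k)\<bar>" using b by simp
    then have "- b * (\<bar>real_of_int (int_decode k)\<bar> - 1) \<le> 2 * b + real k * (- b / 2)" by (simp add: algebra_simps)
    then show ?thesis by (simp only: exp_of_nat_mult[symmetric] exp_add[symmetric] exp_le_cancel_iff)
  qed
  have "summable (\<lambda>k. exp (2 * b) * exp (- b / 2) ^ k)"
    using b by (intro summable_mult summable_geometric) simp
  then have "(\<Sum>k. ennreal (exp (2 * b) * exp (- b / 2) ^ k)) \<noteq> top"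
    by (intro ennreal_suminf_neq_top) auto
  then have fin: "(\<Sum>k. ennreal (exp (2 * b) * exp (- b / 2) ^ k)) < \<infinity>" by (simp only: less_top infinity_ennreal_def)
  have "(\<integral>\<^sup>+z. ennreal (?f z) \<partial>count_space UNIV) = (\<Sum>k. ennreal (?f (int_decode k)))"
    using nn_integral_bij_count_space[OF bij_int_decode, of "\<lambda>z. ennreal (?f z)"] by (simp add: nn_integral_count_space_nat)
  also have "\<dots> \<le> (\<Sum>k. ennreal (exp (2 * b) * exp (- b / 2) ^ k))"
    by (intro suminf_le ennreal_leI le) auto
  finally show ?thesis using fin by (rule order_le_less_trans)
qed

lemma cell_sets:
  fixes \<Phi> :: "'i \<Rightarrow> 'a \<Rightarrow> real"
  assumes I: "finite I" and A: "A \<in> sets M" and m: "\<And>i. i \<in> I \<Longrightarrow> \<Phi> i \<in> borel_measurable M"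
    and z: "z \<in> PiE I (\<lambda>_. UNIV)"
  shows "{x \<in> A. cell I \<Phi> \<delta> x = z} \<in> sets M"
proof -
  have "{x \<in> A. cell I \<Phi> \<delta> x = z} = A \<inter> {x \<in> space M. \<forall>i\<in>I. \<lfloor>\<Phi> i x / \<delta>\<rfloor> = z i}"
    using sets.sets_into_space[OF A] z by (auto simp: cell_def fun_eq_iff PiE_def extensional_def)
  also have "\<dots> \<in> sets M"
  proof (intro sets.Int A sets.sets_Collect_finite_All I)
    fix i assume "i \<in> I"
    note [measurable] = m[OF this]
    show "{x \<in> space M. \<lfloor>\<Phi> i x / \<delta>\<rfloor> = z i} \<in> sets M" by measurable
  qed
  finally show ?thesis .
qed

text \<open>Markov's inequality on each cell: there the weight is at least a product of exponentials
  in the indices z i, so the measure decays exponentially in z. Square roots halve the rate, and the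
  sum over z factorises over the coordinates.\<close>

lemma sum_sqrt_cell_measure_finite:
  fixes \<Phi> :: "'i \<Rightarrow> 'a \<Rightarrow> real"
  assumes fin: "finite_measure M" and I: "finite I" and A: "A \<in> sets M"
    and m: "\<And>i. i \<in> I \<Longrightarrow> \<Phi> i \<in> borel_measurable M" and a: "a > 0" and d: "\<delta> > 0"
    and mom: "(\<integral>\<^sup>+x. indicator A x * ennreal (exp (a * (\<Sum>i\<in>I. \<bar>\<Phi> i x\<bar>))) \<partial>M) < \<infinity>"
  shows "(\<integral>\<^sup>+z. ennreal (sqrt (measure M {x \<in> A. cell I \<Phi> \<delta> x = z})) \<partial>count_space (PiE I (\<lambda>_. UNIV))) < \<infinity>"
proof -
  interpret finite_measure M by fact
  let ?Z = "PiE I (\<lambda>_. UNIV :: int set)"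
  obtain E where E: "E \<ge> 0" "(\<integral>\<^sup>+x. indicator A x * ennreal (exp (a * (\<Sum>i\<in>I. \<bar>\<Phi> i x\<bar>))) \<partial>M) = ennreal E"
    using mom by (cases "\<integral>\<^sup>+x. indicator A x * ennreal (exp (a * (\<Sum>i\<in>I. \<bar>\<Phi> i x\<bar>))) \<partial>M") auto
  \<comment> \<open>Half the rate a \<delta> survives the square root.\<close>
  define b where "b = a * \<delta> / 2"
  have b: "b > 0" using a d by (simp add: b_def)
  let ?h = "\<lambda>z::int. exp (- b * (\<bar>real_of_int z\<bar> - 1))"
  have le: "sqrt (measure M {x \<in> A. cell I \<Phi> \<delta> x = z}) \<le> sqrt E * (\<Prod>i\<in>I. ?h (z i))" if z: "z \<in> ?Z" for z
  proof -
    let ?B = "{x \<in> A. cell I \<Phi> \<delta> x = z}"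
    have B: "?B \<in> sets M" by (rule cell_sets[OF I A m z])
    let ?w = "\<Prod>i\<in>I. exp (2 * b * (\<bar>real_of_int (z i)\<bar> - 1))"
    have "emeasure M ?B * ennreal ?w = (\<integral>\<^sup>+x. indicator ?B x * ennreal ?w \<partial>M)"
      using B by (simp add: nn_integral_multc)
    also have "\<dots> \<le> (\<integral>\<^sup>+x. indicator A x * ennreal (exp (a * (\<Sum>i\<in>I. \<bar>\<Phi> i x\<bar>))) \<partial>M)"
    proof (rule nn_integral_mono)
      fix x
      show "indicator ?B x * ennreal ?w \<le> indicator A x * ennreal (exp (a * (\<Sum>i\<in>I. \<bar>\<Phi> i x\<bar>)))"
      proof (cases "x \<in> ?B")
        case True
        have "2 * b * (\<bar>real_of_int (z i)\<bar> - 1) \<le> a * \<bar>\<Phi> i x\<bar>" if i: "i \<in> I" for i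
        proof -
          have "z i = \<lfloor>\<Phi> i x / \<delta>\<rfloor>" using True i by (auto simp: cell_def)
          \<comment> \<open>For negative values the floor can exceed the absolute value by up to 1;
            this is the origin of the - 1 in the exponents.\<close>
          then have "\<bar>real_of_int (z i)\<bar> - 1 \<le> \<bar>\<Phi> i x / \<delta>\<bar>" by linarith
          then have "\<delta> * (\<bar>real_of_int (z i)\<bar> - 1) \<le> \<bar>\<Phi> i x\<bar>" using d by (simp add: field_simps)
          then have "a * (\<delta> * (\<bar>real_of_int (z i)\<bar> - 1)) \<le> a * \<bar>\<Phi> i x\<bar>" using a by simp
          then show ?thesis by (simp add: b_def mult.assoc)
        qed
        then have "(\<Sum>i\<in>I. 2 * b * (\<bar>real_of_int (z i)\<bar> - 1)) \<le> a * (\<Sum>i\<in>I. \<bar>\<Phi> i x\<bar>)"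
          unfolding sum_distrib_left by (intro sum_mono)
        then have "?w \<le> exp (a * (\<Sum>i\<in>I. \<bar>\<Phi> i x\<bar>))" using I by (simp flip: exp_sum)
        then show ?thesis using True by (simp add: ennreal_leI)
      qed simp
    qed
    finally have "ennreal (measure M ?B * ?w) \<le> ennreal E"
      by (simp add: E(2) emeasure_eq_measure ennreal_mult' prod_nonneg)
    then have "measure M ?B * ?w \<le> E" using E(1) by simp
    moreover have w: "?w > 0" by (intro prod_pos) simp
    ultimately have "measure M ?B \<le> E / ?w" by (simp add: field_simps)
    also have "\<dots> = E * (\<Prod>i\<in>I. ?h (z i))\<^sup>2"
    proof -
      have "1 / ?w = (\<Prod>i\<in>I. (?h (z i))\<^sup>2)"
      proof -
        have "(exp (- b * t))\<^sup>2 = 1 / exp (2 * b * t)" for t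
        proof -
          have "(exp (- b * t))\<^sup>2 = exp (- (2 * b * t))" by (simp flip: exp_double)
          then show ?thesis by (simp add: exp_minus inverse_eq_divide)
        qed
        then show ?thesis by (simp add: prod_dividef)
      qed
      then have "E * (1 / ?w) = E * (\<Prod>i\<in>I. ?h (z i))\<^sup>2" by (simp only: prod_power_distrib)
      then show ?thesis by (simp only: times_divide_eq_right mult_1_right)
    qed
    finally have "sqrt (measure M ?B) \<le> sqrt (E * (\<Prod>i\<in>I. ?h (z i))\<^sup>2)" by simp
    also have "\<dots> = sqrt E * (\<Prod>i\<in>I. ?h (z i))" by (simp add: real_sqrt_mult prod_nonneg)
    finally show ?thesis .
  qed
  interpret product_sigma_finite "\<lambda>_::'i. count_space (UNIV :: int set)"
    by (rule product_sigma_finite.intro) (rule sigma_finite_measure_count_space_countable, simp)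
  have "(\<integral>\<^sup>+z. ennreal (sqrt (measure M {x \<in> A. cell I \<Phi> \<delta> x = z})) \<partial>count_space ?Z)
    \<le> (\<integral>\<^sup>+z. ennreal (sqrt E) * (\<Prod>i\<in>I. ennreal (?h (z i))) \<partial>count_space ?Z)"
  proof (rule nn_integral_mono)
    fix z :: "'i \<Rightarrow> int" assume "z \<in> space (count_space ?Z)"
    then have "ennreal (sqrt (measure M {x \<in> A. cell I \<Phi> \<delta> x = z})) \<le> ennreal (sqrt E * (\<Prod>i\<in>I. ?h (z i)))"
      by (intro ennreal_leI le) simp
    also have "\<dots> = ennreal (sqrt E) * (\<Prod>i\<in>I. ennreal (?h (z i)))"
      using E(1) by (simp add: ennreal_mult' prod_ennreal)
    finally show "ennreal (sqrt (measure M {x \<in> A. cell I \<Phi> \<delta> x = z})) \<le> ennreal (sqrt E) * (\<Prod>i\<in>I. ennreal (?h (z i)))" .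
  qed
  also have "\<dots> = ennreal (sqrt E) * (\<integral>\<^sup>+z. (\<Prod>i\<in>I. ennreal (?h (z i))) \<partial>count_space ?Z)"
    by (rule nn_integral_cmult) simp
  also have "(\<integral>\<^sup>+z. (\<Prod>i\<in>I. ennreal (?h (z i))) \<partial>count_space ?Z) = (\<integral>\<^sup>+z. (\<Prod>i\<in>I. ennreal (?h (z i))) \<partial>PiM I (\<lambda>_. count_space UNIV))"
    using I by (subst count_space_PiM_finite) auto
  also have "\<dots> = (\<Prod>i\<in>I. \<integral>\<^sup>+z. ennreal (?h z) \<partial>count_space UNIV)"
    by (rule product_nn_integral_prod[OF I]) simp
  also have "ennreal (sqrt E) * \<dots> < \<infinity>"
    using nn_integral_int_exp_finite[OF b]
    by (auto simp: ennreal_mult_eq_top_iff power_eq_top_ennreal less_top[symmetric])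
  finally show ?thesis .
qed

text \<open>Each term is at most the whole sum. This lets a sum of cell integrals be controlled
  through the sum of their square roots, whose expectation is accessible.\<close>

lemma nn_integral_count_space_square_le:
  "(\<integral>\<^sup>+z. f z * f z \<partial>count_space Z) \<le> (\<integral>\<^sup>+z. f z \<partial>count_space Z) * (\<integral>\<^sup>+z. f z \<partial>count_space Z)"
proof -
  have "(\<integral>\<^sup>+z. f z * f z \<partial>count_space Z) \<le> (\<integral>\<^sup>+z. f z * (\<integral>\<^sup>+z. f z \<partial>count_space Z) \<partial>count_space Z)"
    by (intro nn_integral_mono mult_left_mono nn_integral_ge_point) auto
  also have "\<dots> = (\<integral>\<^sup>+z. f z \<partial>count_space Z) * (\<integral>\<^sup>+z. f z \<partial>count_space Z)"
    by (rule nn_integral_multc) simp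
  finally show ?thesis .
qed

text \<open>The integrand depends on the first N coordinates only, so the infinite product is
  replaced by its finite marginal.\<close>

lemma nn_integral_PiM_prod_iid:
  assumes D: "prob_space D" and g[measurable]: "g \<in> borel_measurable D"
  shows "(\<integral>\<^sup>+xs. (\<Prod>i<N. g (xs i)) \<partial>PiM (UNIV :: nat set) (\<lambda>_. D)) = (\<integral>\<^sup>+x. g x \<partial>D) ^ N"
proof -
  interpret D: prob_space D by fact
  interpret product_prob_space "\<lambda>_::nat. D" UNIV by standard
  have "(\<integral>\<^sup>+xs. (\<Prod>i<N. g (xs i)) \<partial>PiM (UNIV :: nat set) (\<lambda>_. D))
    = (\<integral>\<^sup>+xs. (\<Prod>i<N. g (restrict xs {..<N} i)) \<partial>PiM (UNIV :: nat set) (\<lambda>_. D))"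
    by (intro nn_integral_cong prod.cong) auto
  also have "\<dots> = (\<integral>\<^sup>+xs. (\<Prod>i<N. g (xs i)) \<partial>distr (PiM UNIV (\<lambda>_. D)) (PiM {..<N} (\<lambda>_. D)) (\<lambda>xs. restrict xs {..<N}))"
    by (rule nn_integral_distr[symmetric]) (rule measurable_restrict_subset, simp, measurable)
  also have "\<dots> = (\<integral>\<^sup>+xs. (\<Prod>i<N. g (xs i)) \<partial>PiM {..<N} (\<lambda>_. D))"
    by (subst distr_PiM_restrict_finite) auto
  also have "\<dots> = (\<Prod>i<N. \<integral>\<^sup>+x. g x \<partial>D)"
    by (rule product_nn_integral_prod) auto
  finally show ?thesis by simp
qed

section \<open>The prior of one component\<close>

text \<open>Carries the sigma-algebra of every component prior, so that measurability is proved
  once, independently of the hyperparameters.\<close>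

definition comp_space :: "nat \<Rightarrow> nat \<Rightarrow> comp_param measure" where
  "comp_space n p = matspace n p \<Otimes>\<^sub>M (vecspace p \<Otimes>\<^sub>M matspace p p)"

definition param_space :: "nat \<Rightarrow> nat \<Rightarrow> nat \<Rightarrow> param measure" where
  "param_space n p C = PiM {..<C} (\<lambda>_. comp_space n p) \<Otimes>\<^sub>M vecspace C"

definition comp_prior :: "nat \<Rightarrow> nat \<Rightarrow> mat \<Rightarrow> mat \<Rightarrow> real \<Rightarrow> vec \<Rightarrow> comp_param measure" where
  "comp_prior n p G H \<nu> \<eta> = prior_M n p G \<Otimes>\<^sub>M (prior_d n p \<nu> \<eta> \<Otimes>\<^sub>M prior_V p H)"

lemma prior_eq: "prior n p C G H nu eta alpha =
    PiM {..<C} (\<lambda>c. comp_prior n p (G c) (H c) (nu c) (eta c)) \<Otimes>\<^sub>M dirichlet C alpha"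
  by (simp add: prior_def comp_prior_def)

lemma sets_dirichlet: "sets (dirichlet C \<alpha>) = sets (vecspace C)"
  by (simp add: dirichlet_def Let_def)

context
  fixes n p :: nat
  assumes pn: "p \<le> n"
begin

lemma sets_comp_prior: "sets (comp_prior n p G H \<nu> \<eta>) = sets (comp_space n p)"
  unfolding comp_prior_def comp_space_def prior_M_def prior_d_def prior_V_def
  by (intro sets_pair_measure_cong) (simp_all add: sets_haar[OF pn] sets_haar)

lemma sets_prior: "sets (prior n p C G H nu eta alpha) = sets (param_space n p C)"
  unfolding prior_eq param_space_def
  by (intro sets_pair_measure_cong sets_PiM_cong sets_comp_prior sets_dirichlet refl)

lemma finite_measure_prior_M: "finite_measure (prior_M n p G)"
  unfolding prior_M_def by (rule haar_normdens[OF pn stiefel_pos_sets[OF pn]]) (auto simp: stiefel_pos_def)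

lemma finite_measure_prior_V: "finite_measure (prior_V p H)"
  unfolding prior_V_def by (rule haar_normdens[OF order_refl stiefel_sets order_refl])

lemma finite_measure_comp_prior: "finite_measure (comp_prior n p G H \<nu> \<eta>)"
  unfolding comp_prior_def
  by (intro finite_measure_pair_measure finite_measure_prior_M finite_measure_prior_V finite_measure_prior_d[OF pn])

lemma comp_measurable:
  shows "i < n \<Longrightarrow> j < p \<Longrightarrow> (\<lambda>th. fst th (i,j)) \<in> borel_measurable (comp_space n p)"
    and "j < p \<Longrightarrow> (\<lambda>th. fst (snd th) j) \<in> borel_measurable (comp_space n p)"
    and "i < p \<Longrightarrow> j < p \<Longrightarrow> (\<lambda>th. snd (snd th) (i,j)) \<in> borel_measurable (comp_space n p)"
  unfolding comp_space_def
  by (auto intro!: measurable_compose[OF measurable_fst] measurable_compose[OF measurable_snd] mat_component vec_component)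

lemma coef_measurable: "i < n \<Longrightarrow> j < p \<Longrightarrow> (\<lambda>th. coef p th i j) \<in> borel_measurable (comp_space n p)"
  unfolding coef_def case_prod_beta
  by (intro borel_measurable_sum borel_measurable_times comp_measurable) auto

lemma abs_d_sum_measurable: "(\<lambda>d. exp (a * (\<Sum>j<p. \<bar>d j\<bar>)) :: real) \<in> borel_measurable (vecspace p)"
  by (intro measurable_compose[OF _ borel_measurable_exp] borel_measurable_times borel_measurable_sum
      borel_measurable_abs vec_component borel_measurable_const) auto

text \<open>The integrand depends on d alone; the factors for M and V contribute their finite total
  masses.\<close>

lemma comp_prior_exp_moment:
  assumes nu: "\<nu> > 0" and eta: "\<And>j. j < p \<Longrightarrow> \<eta> j < 1"
  shows "\<exists>a>0. (\<integral>\<^sup>+th. ennreal (exp (a * (\<Sum>j<p. \<bar>fst (snd th) j\<bar>))) \<partial>comp_prior n p G H \<nu> \<eta>) < \<infinity>"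
proof -
  obtain a where a: "a > 0" and fin: "(\<integral>\<^sup>+d. ennreal (exp (a * (\<Sum>j<p. \<bar>d j\<bar>))) \<partial>prior_d n p \<nu> \<eta>) < \<infinity>"
    using prior_d_exp_moment[OF pn nu, of \<eta>] eta by blast
  interpret V: finite_measure "prior_V p H" by (rule finite_measure_prior_V)
  interpret D: finite_measure "prior_d n p \<nu> \<eta>" by (rule finite_measure_prior_d[OF pn])
  interpret M: finite_measure "prior_M n p G" by (rule finite_measure_prior_M)
  interpret DV: finite_measure "prior_d n p \<nu> \<eta> \<Otimes>\<^sub>M prior_V p H"
    by (intro finite_measure_pair_measure V.finite_measure_axioms D.finite_measure_axioms)
  let ?g = "\<lambda>d. ennreal (exp (a * (\<Sum>j<p. \<bar>d j\<bar>)))"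
  have g: "?g \<in> borel_measurable (prior_d n p \<nu> \<eta>)"
    using abs_d_sum_measurable[of a] by (simp add: prior_d_def cong: measurable_cong_sets)
  have gs: "(\<lambda>w. ?g (fst w)) \<in> borel_measurable (prior_d n p \<nu> \<eta> \<Otimes>\<^sub>M prior_V p H)"
    by (rule measurable_compose[OF measurable_fst g])
  have "(\<integral>\<^sup>+th. ?g (fst (snd th)) \<partial>comp_prior n p G H \<nu> \<eta>)
    = (\<integral>\<^sup>+M. (\<integral>\<^sup>+w. ?g (fst w) \<partial>(prior_d n p \<nu> \<eta> \<Otimes>\<^sub>M prior_V p H)) \<partial>prior_M n p G)"
    unfolding comp_prior_def using measurable_compose[OF measurable_snd gs]
    by (subst DV.nn_integral_fst[symmetric]) simp_all
  also have "\<dots> = (\<integral>\<^sup>+w. ?g (fst w) \<partial>(prior_d n p \<nu> \<eta> \<Otimes>\<^sub>M prior_V p H)) * emeasure (prior_M n p G) (space (prior_M n p G))"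
    by simp
  also have "(\<integral>\<^sup>+w. ?g (fst w) \<partial>(prior_d n p \<nu> \<eta> \<Otimes>\<^sub>M prior_V p H)) = (\<integral>\<^sup>+d. (\<integral>\<^sup>+V. ?g d \<partial>prior_V p H) \<partial>prior_d n p \<nu> \<eta>)"
    using gs by (subst V.nn_integral_fst[symmetric]) simp_all
  also have "\<dots> = (\<integral>\<^sup>+d. ?g d \<partial>prior_d n p \<nu> \<eta>) * emeasure (prior_V p H) (space (prior_V p H))"
    using g by (simp add: nn_integral_multc)
  also have "\<dots> * emeasure (prior_M n p G) (space (prior_M n p G)) < \<infinity>"
    using fin by (auto simp: ennreal_mult_eq_top_iff less_top[symmetric])
  finally show ?thesis using a by blast
qed

text \<open>A product of balls in M, d and V has positive mass by independence; it remains to bound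
  the change of M D V^T on it.\<close>

lemma comp_nbhd_pos:
  assumes th0: "th0 \<in> stiefel_pos n p \<times> Sp p \<times> stiefel p p" and e: "\<epsilon> > 0"
    and nu: "\<nu> > 0" and eta: "\<And>j. j < p \<Longrightarrow> \<eta> j < 1"
  shows "\<exists>B\<in>sets (comp_space n p). B \<subseteq> stiefel_pos n p \<times> Sp p \<times> stiefel p p \<and>
    emeasure (comp_prior n p G H \<nu> \<eta>) B > 0 \<and>
    (\<forall>th\<in>B. comp_close n p \<epsilon> th0 th)"
proof -
  obtain M0 d0 V0 where th: "th0 = (M0,d0,V0)" by (cases th0)
  have M0: "M0 \<in> stiefel n p" "\<And>j. j < p \<Longrightarrow> 0 < M0 (0,j)" and d0: "d0 \<in> Sp p" and V0: "V0 \<in> stiefel p p"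
    using th0 by (auto simp: th stiefel_pos_def)
  obtain r where r: "r > 0" "\<And>r'. r' \<le> r \<Longrightarrow> vec_box p d0 r' \<subseteq> Sp p" using Sp_contains_box[OF d0] by blast
  \<comment> \<open>The change of M_ik d_k V_jk is at most \<delta> (2 |d0_k| + 2), by the splitting
    below; the + 1 gives K > 0 for p = 0.\<close>
  define K where "K = (\<Sum>k<p. 2 * \<bar>d0 k\<bar> + 2) + 1"
  have K: "K > 0" unfolding K_def by (intro add_nonneg_pos sum_nonneg) auto
  \<comment> \<open>1 gives |d_k| \<le> |d0_k| + 1, r keeps d in \<open>Sp\<close>, \<epsilon>
    bounds the change of d, \<epsilon> / K that of M D V^T, and the entries of the first row of
    \<open>M0\<close> keep that row positive.\<close>
  define \<delta> where "\<delta> = Min (insert 1 (insert r (insert \<epsilon> (insert (\<epsilon> / K) ((\<lambda>j. M0 (0,j)) ` {..<p})))))"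
  have \<delta>: "\<delta> > 0" unfolding \<delta>_def using r e K M0 by (subst Min_gr_iff) auto
  have \<delta>le: "\<delta> \<le> 1" "\<delta> \<le> r" "\<delta> \<le> \<epsilon>" "\<delta> \<le> \<epsilon> / K" "\<And>j. j < p \<Longrightarrow> \<delta> \<le> M0 (0,j)"
    unfolding \<delta>_def by (auto intro!: Min_le simp del: Min_insert)
  define B where "B = mat_ball n p M0 \<delta> \<times> (vec_box p d0 \<delta> \<times> mat_ball p p V0 \<delta>)"
  have BM: "mat_ball n p M0 \<delta> \<subseteq> stiefel_pos n p"
  proof
    fix M assume M: "M \<in> mat_ball n p M0 \<delta>"
    have "0 < M (0,j)" if j: "j < p" for j
    proof -
      have "\<bar>M (0,j) - M0 (0,j)\<bar> < \<delta>" using M j pn by (simp add: mat_ball_def)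
      then show ?thesis using \<delta>le(5)[OF j] by linarith
    qed
    then show "M \<in> stiefel_pos n p" using M by (simp add: mat_ball_def stiefel_pos_def)
  qed
  have Bd: "vec_box p d0 \<delta> \<subseteq> Sp p" using r \<delta>le by blast
  have BV: "mat_ball p p V0 \<delta> \<subseteq> stiefel p p" by (auto simp: mat_ball_def)
  have "B \<in> sets (comp_space n p)"
    unfolding B_def comp_space_def by (intro pair_measureI mat_ball_sets vec_box_sets)
  moreover have "B \<subseteq> stiefel_pos n p \<times> Sp p \<times> stiefel p p" using BM Bd BV unfolding B_def by blast
  moreover have "emeasure (comp_prior n p G H \<nu> \<eta>) B > 0"
  proof -
    interpret V: finite_measure "prior_V p H" by (rule finite_measure_prior_V)
    interpret D: finite_measure "prior_d n p \<nu> \<eta>" by (rule finite_measure_prior_d[OF pn])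
    interpret DV: finite_measure "prior_d n p \<nu> \<eta> \<Otimes>\<^sub>M prior_V p H"
      by (intro finite_measure_pair_measure V.finite_measure_axioms D.finite_measure_axioms)
    have s: "mat_ball n p M0 \<delta> \<in> sets (prior_M n p G)" "vec_box p d0 \<delta> \<in> sets (prior_d n p \<nu> \<eta>)" "mat_ball p p V0 \<delta> \<in> sets (prior_V p H)"
      by (simp_all add: prior_M_def prior_d_def prior_V_def sets_haar[OF pn] sets_haar vec_box_sets mat_ball_sets)
    have "emeasure (comp_prior n p G H \<nu> \<eta>) B
      = emeasure (prior_M n p G) (mat_ball n p M0 \<delta>) * (emeasure (prior_d n p \<nu> \<eta>) (vec_box p d0 \<delta>) * emeasure (prior_V p H) (mat_ball p p V0 \<delta>))"
      unfolding comp_prior_def B_def using s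
      by (simp add: DV.emeasure_pair_measure_Times V.emeasure_pair_measure_Times)
    moreover have "emeasure (prior_M n p G) (mat_ball n p M0 \<delta>) > 0"
      unfolding prior_M_def
      by (rule haar_normdens(3)[OF pn stiefel_pos_sets[OF pn] _ M0(1) \<delta> BM]) (auto simp: stiefel_pos_def)
    moreover have "emeasure (prior_V p H) (mat_ball p p V0 \<delta>) > 0"
      unfolding prior_V_def by (rule haar_normdens(3)[OF order_refl stiefel_sets order_refl V0 \<delta> BV])
    moreover have "emeasure (prior_d n p \<nu> \<eta>) (vec_box p d0 \<delta>) > 0"
      by (rule prior_d_pos[OF pn nu eta vec_box_sets Bd vec_box_pos[OF \<delta>]])
    ultimately show ?thesis by (simp add: ennreal_zero_less_mult_iff)
  qed
  moreover have "\<bar>coef p th0 i j - coef p th i j\<bar> \<le> \<epsilon>" if "th \<in> B" and ij: "i < n" "j < p" for th i j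
  proof -
    obtain M d V where t: "th = (M,d,V)" by (cases th)
    have MdV: "M \<in> mat_ball n p M0 \<delta>" "d \<in> vec_box p d0 \<delta>" "V \<in> mat_ball p p V0 \<delta>" using that by (auto simp: t B_def)
    have k: "\<bar>M0 (i,k) * d0 k * V0 (j,k) - M (i,k) * d k * V (j,k)\<bar> \<le> \<delta> * (2 * \<bar>d0 k\<bar> + 2)" if k: "k < p" for k
    proof -
      have m: "\<bar>M0 (i,k) - M (i,k)\<bar> \<le> \<delta>" "\<bar>V0 (j,k) - V (j,k)\<bar> \<le> \<delta>"
        using MdV ij k by (auto simp: mat_ball_def abs_minus_commute less_imp_le)
      have d: "\<bar>d0 k - d k\<bar> \<le> \<delta>" using vec_boxD[OF MdV(2) k] by (simp add: abs_minus_commute)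
      have b: "\<bar>M0 (i,k)\<bar> \<le> 1" "\<bar>V (j,k)\<bar> \<le> 1"
        using stiefel_entry_le[OF M0(1) ij(1) k] stiefel_entry_le[of V p p j k] MdV ij k by (auto simp: mat_ball_def)
      have dk: "\<bar>d k\<bar> \<le> \<bar>d0 k\<bar> + 1" using d \<delta>le(1) by linarith
      \<comment> \<open>One factor is changed at a time; entries of M0 and V are at most 1, which
        gives the three bounds |d0| + 1, 1 and |d0| times \<delta>.\<close>
      define x y w where "x = (M0 (i,k) - M (i,k)) * (d k * V (j,k))"
        and "y = M0 (i,k) * ((d0 k - d k) * V (j,k))" and "w = M0 (i,k) * (d0 k * (V0 (j,k) - V (j,k)))"
      have eq: "M0 (i,k) * d0 k * V0 (j,k) - M (i,k) * d k * V (j,k) = x + y + w"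
        by (simp add: x_def y_def w_def algebra_simps)
      have "\<bar>x\<bar> \<le> \<delta> * ((\<bar>d0 k\<bar> + 1) * 1)"
        unfolding x_def abs_mult using m d b dk \<delta> by (intro mult_mono) auto
      moreover have "\<bar>y\<bar> \<le> 1 * (\<delta> * 1)"
        unfolding y_def abs_mult using m d b dk \<delta> by (intro mult_mono) auto
      moreover have "\<bar>w\<bar> \<le> 1 * (\<bar>d0 k\<bar> * \<delta>)"
        unfolding w_def abs_mult using m d b dk \<delta> by (intro mult_mono) auto
      ultimately have "\<bar>x + y + w\<bar> \<le> \<delta> * ((\<bar>d0 k\<bar> + 1) * 1) + 1 * (\<delta> * 1) + 1 * (\<bar>d0 k\<bar> * \<delta>)"
        by linarith
      also have "\<dots> = \<delta> * (2 * \<bar>d0 k\<bar> + 2)" by (simp add: algebra_simps)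
      finally show ?thesis by (simp only: eq)
    qed
    have "\<bar>coef p th0 i j - coef p th i j\<bar> = \<bar>\<Sum>k<p. M0 (i,k) * d0 k * V0 (j,k) - M (i,k) * d k * V (j,k)\<bar>"
      by (simp add: th t coef_def sum_subtractf)
    also have "\<dots> \<le> (\<Sum>k<p. \<delta> * (2 * \<bar>d0 k\<bar> + 2))"
      by (rule order_trans[OF sum_abs]) (intro sum_mono k, simp)
    also have "\<dots> \<le> \<delta> * K" using \<delta> by (simp add: K_def sum_distrib_left[symmetric])
    also have "\<dots> \<le> \<epsilon>" using \<delta>le(4) K by (simp add: field_simps)
    finally show ?thesis .
  qed
  moreover have "\<bar>fst (snd th0) j - fst (snd th) j\<bar> \<le> \<epsilon>" if "th \<in> B" and j: "j < p" for th j
    using that vec_boxD[of "fst (snd th)" p d0 \<delta> j] \<delta>le(3) by (auto simp: th B_def abs_minus_commute)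
  ultimately show ?thesis unfolding comp_close_def by blast
qed

end

section \<open>The full prior\<close>

lemma ennreal_prod_pos:
  fixes f :: "'a \<Rightarrow> ennreal"
  shows "finite A \<Longrightarrow> (\<And>i. i \<in> A \<Longrightarrow> 0 < f i) \<Longrightarrow> 0 < (\<Prod>i\<in>A. f i)"
  by (induction A rule: finite_induct) (auto simp: ennreal_zero_less_mult_iff)

lemma Xi_sets:
  assumes pn: "p \<le> n" shows "Xi n p C \<in> sets (param_space n p C)"
  unfolding Xi_def Theta_def param_space_def
  by (intro pair_measureI sets_PiM_I_finite pi_simplex_sets)
    (auto simp: comp_space_def intro!: pair_measureI stiefel_pos_sets[OF pn] Sp_sets stiefel_sets)

definition d_total :: "nat \<Rightarrow> nat \<Rightarrow> param \<Rightarrow> real" where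
  "d_total p C t = (\<Sum>c<C. \<Sum>j<p. \<bar>fst (snd (fst t c)) j\<bar>)"

lemma param_measurable:
  assumes "c < C" and "f \<in> borel_measurable (comp_space n p)"
  shows "(\<lambda>t. f (fst t c)) \<in> borel_measurable (param_space n p C)"
  unfolding param_space_def
  using measurable_component_singleton[of c "{..<C}" "\<lambda>_. comp_space n p"] assms
  by (intro measurable_compose[OF measurable_fst] measurable_compose[OF _ assms(2)]) simp

section \<open>Grid coordinates of a parameter\<close>

text \<open>The p + 1 columns provide a slot for the weight even when p = 0; surplus slots hold 0 or
  repeat the weight.\<close>

definition coord_index :: "nat \<Rightarrow> nat \<Rightarrow> nat \<Rightarrow> (nat \<times> nat \<times> nat) set" where
  "coord_index n p C = {..<C} \<times> {..<n + 2} \<times> {..<Suc p}"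

text \<open>For every component the coordinates are the entries of \<open>M D V\<^sup>T\<close> (rows below \<open>n\<close>), the entries of
  \<open>d\<close> (row \<open>n\<close>) and the weight (row \<open>n + 1\<close>).\<close>
definition param_coord :: "nat \<Rightarrow> nat \<Rightarrow> nat \<times> nat \<times> nat \<Rightarrow> param \<Rightarrow> real" where
  "param_coord n p a t = (case a of (c,i,j) \<Rightarrow>
     if i < n then (if j < p then coef p (fst t c) i j else 0)
     else if i = n then (if j < p then fst (snd (fst t c)) j else 0) else snd t c)"

lemma param_coord_measurable:
  assumes pn: "p \<le> n" and a: "a \<in> coord_index n p C"
  shows "param_coord n p a \<in> borel_measurable (param_space n p C)"
proof -
  obtain c i j where a': "a = (c,i,j)" by (cases a)
  have c: "c < C" using a by (simp add: a' coord_index_def)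
  have w: "(\<lambda>t. snd t c) \<in> borel_measurable (param_space n p C)"
    unfolding param_space_def by (rule measurable_compose[OF measurable_snd vec_component[OF c]])
  show ?thesis
    using w param_measurable[OF c coef_measurable[OF pn]] param_measurable[OF c comp_measurable(2)[OF pn]]
    by (cases "i < n"; cases "i = n"; cases "j < p") (auto simp: param_coord_def[abs_def] a')
qed

text \<open>Provides both closeness hypotheses of \<open>fmix_le_envelope\<close> for two parameters
  in one cell.\<close>

lemma param_coord_close:
  assumes c: "cell (coord_index n p C) (param_coord n p) \<eta> t = cell (coord_index n p C) (param_coord n p) \<eta> t'" and e: "\<eta> > 0"
  shows "param_close n p C \<eta> t t'" "k < C \<Longrightarrow> \<bar>snd t k - snd t' k\<bar> \<le> \<eta>"
proof -
  note * = cell_close[OF c _ e]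
  show "param_close n p C \<eta> t t'" unfolding param_close_def comp_close_def
  proof (intro allI impI conjI)
    fix c i j assume "c < C" "i < n" "j < p"
    then show "\<bar>coef p (fst t c) i j - coef p (fst t' c) i j\<bar> \<le> \<eta>"
      using *[of "(c,i,j)"] by (simp add: coord_index_def param_coord_def)
  next
    fix c j assume "c < C" "j < p"
    then show "\<bar>fst (snd (fst t c)) j - fst (snd (fst t' c)) j\<bar> \<le> \<eta>"
      using *[of "(c,n,j)"] by (simp add: coord_index_def param_coord_def)
  qed
  assume "k < C"
  then show "\<bar>snd t k - snd t' k\<bar> \<le> \<eta>"
    using *[of "(k,Suc n,0)"] by (simp add: coord_index_def param_coord_def)
qed

text \<open>On \<open>Xi\<close> only d is unbounded: the entries of M and V and the weights are at
  most 1. Hence an exponential moment of the total of d controls all coordinates.\<close>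

lemma param_coord_le:
  assumes t: "t \<in> Xi n p C" and a: "a \<in> coord_index n p C"
  shows "\<bar>param_coord n p a t\<bar> \<le> 1 + d_total p C t"
proof -
  obtain c i j where a': "a = (c,i,j)" by (cases a)
  have c: "c < C" using a by (simp add: a' coord_index_def)
  obtain M d V where th: "fst t c = (M,d,V)" "M \<in> stiefel_pos n p" "d \<in> Sp p" "V \<in> stiefel p p"
    using Xi_compE[OF t c] by blast
  have M: "M \<in> stiefel n p" using th(2) by (simp add: stiefel_pos_def)
  have "(\<Sum>k<p. \<bar>fst (snd (fst t c)) k\<bar>) \<le> d_total p C t"
    unfolding d_total_def using c by (intro member_le_sum[of c "{..<C}" "\<lambda>c. \<Sum>k<p. \<bar>fst (snd (fst t c)) k\<bar>"]) (auto intro: sum_nonneg)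
  then have S: "(\<Sum>k<p. \<bar>d k\<bar>) \<le> d_total p C t" by (simp add: th(1))
  have S0: "0 \<le> d_total p C t" by (simp add: d_total_def sum_nonneg)
  have 1: "\<bar>coef p (fst t c) i j\<bar> \<le> 1 + d_total p C t" if "i < n" "j < p"
  proof -
    have "\<bar>coef p (fst t c) i j\<bar> \<le> (\<Sum>k<p. \<bar>M (i,k) * d k * V (j,k)\<bar>)"
      by (simp add: coef_def th(1) sum_abs)
    also have "\<dots> \<le> (\<Sum>k<p. \<bar>d k\<bar>)"
    proof (rule sum_mono)
      fix k assume k: "k \<in> {..<p}"
      have "\<bar>M (i,k)\<bar> * \<bar>d k\<bar> * \<bar>V (j,k)\<bar> \<le> 1 * \<bar>d k\<bar> * 1"
        using stiefel_entry_le[OF M that(1)] stiefel_entry_le[OF th(4) that(2)] k by (intro mult_mono) auto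
      then show "\<bar>M (i,k) * d k * V (j,k)\<bar> \<le> \<bar>d k\<bar>" by (simp add: abs_mult)
    qed
    finally show ?thesis using S by simp
  qed
  have 2: "\<bar>fst (snd (fst t c)) j\<bar> \<le> 1 + d_total p C t" if "j < p"
  proof -
    have "\<bar>d j\<bar> \<le> (\<Sum>k<p. \<bar>d k\<bar>)" using that by (intro member_le_sum) auto
    then show ?thesis using S by (simp add: th(1))
  qed
  have 3: "\<bar>snd t c\<bar> \<le> 1 + d_total p C t" using Xi_weights(1,2)[OF t c] S0 by simp
  show ?thesis using 1 2 3 S0 by (simp add: param_coord_def a')
qed

section \<open>The full prior: exponential moment, total mass, neighbourhoods of the truth\<close>

context
  fixes n p C :: nat and G H :: "nat \<Rightarrow> mat" and nu alpha :: "nat \<Rightarrow> real" and eta :: "nat \<Rightarrow> vec"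
  assumes pn: "p \<le> n" and C0: "0 < C" and nu: "\<And>c. c < C \<Longrightarrow> 0 < nu c"
    and eta: "\<And>c j. c < C \<Longrightarrow> j < p \<Longrightarrow> eta c j < 1" and alpha: "\<And>c. c < C \<Longrightarrow> 0 < alpha c"
begin

abbreviation (input) cp where "cp \<equiv> \<lambda>c. comp_prior n p (G c) (H c) (nu c) (eta c)"
abbreviation (input) Pr where "Pr \<equiv> prior n p C G H nu eta alpha"

lemma product_sigma_finite_cp: "product_sigma_finite cp"
proof (rule product_sigma_finite.intro)
  fix c
  interpret finite_measure "cp c" by (rule finite_measure_comp_prior[OF pn])
  show "sigma_finite_measure (cp c)" ..
qed

lemma prior_exp_moment: "\<exists>a>0. (\<integral>\<^sup>+t. ennreal (exp (a * d_total p C t)) \<partial>Pr) < \<infinity>"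
proof -
  interpret PS: product_sigma_finite cp by (rule product_sigma_finite_cp)
  interpret D: finite_measure "dirichlet C alpha" by (rule finite_measure_dirichlet[OF C0 alpha])
  let ?g = "\<lambda>a th. ennreal (exp (a * (\<Sum>j<p. \<bar>fst (snd (th :: comp_param)) j\<bar>)))"
  have "\<forall>c\<in>{..<C}. \<exists>a>0. (\<integral>\<^sup>+th. ?g a th \<partial>cp c) < \<infinity>"
    using comp_prior_exp_moment[OF pn] nu eta by blast
  from bchoice[OF this] obtain A where A0: "\<forall>c\<in>{..<C}. A c > 0 \<and> (\<integral>\<^sup>+th. ?g (A c) th \<partial>cp c) < \<infinity>" ..
  have A: "A c > 0" "(\<integral>\<^sup>+th. ?g (A c) th \<partial>cp c) < \<infinity>" if "c < C" for c
    using bspec[OF A0, of c] that by simp_all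
  \<comment> \<open>A rate that is admissible for every component; the exponential then factorises
    over the components.\<close>
  define a where "a = Min (insert 1 (A ` {..<C}))"
  have a: "a > 0" "\<And>c. c < C \<Longrightarrow> a \<le> A c"
    unfolding a_def using A(1) by (subst Min_gr_iff) (auto intro!: Min_le simp del: Min_insert)
  have fin: "(\<integral>\<^sup>+th. ?g a th \<partial>cp c) < \<infinity>" if c: "c < C" for c
  proof -
    have "(\<integral>\<^sup>+th. ?g a th \<partial>cp c) \<le> (\<integral>\<^sup>+th. ?g (A c) th \<partial>cp c)"
      using a(2)[OF c] by (intro nn_integral_mono ennreal_leI exp_le_cancel_iff[THEN iffD2] mult_right_mono sum_nonneg) auto
    then show ?thesis using A(2)[OF c] by (rule order_le_less_trans)
  qed
  have gm: "?g a \<in> borel_measurable (comp_space n p)"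
    by (intro measurable_compose[OF _ measurable_ennreal] measurable_compose[OF _ borel_measurable_exp] borel_measurable_times
        borel_measurable_sum borel_measurable_abs comp_measurable(2)[OF pn] borel_measurable_const) auto
  have gm': "?g a \<in> borel_measurable (cp c)" for c
    using gm by (simp add: sets_comp_prior[OF pn] cong: measurable_cong_sets)
  have pm: "(\<lambda>th. \<Prod>c<C. ?g a (th c)) \<in> borel_measurable (PiM {..<C} cp)"
  proof (rule borel_measurable_prod_ennreal)
    fix c assume "c \<in> {..<C}"
    then show "(\<lambda>th. ?g a (th c)) \<in> borel_measurable (PiM {..<C} cp)"
      using measurable_component_singleton[of c "{..<C}" cp] by (intro measurable_compose[OF _ gm'])
  qed
  have "(\<integral>\<^sup>+t. ennreal (exp (a * d_total p C t)) \<partial>Pr) = (\<integral>\<^sup>+t. (\<Prod>c<C. ?g a (fst t c)) \<partial>Pr)"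
    by (simp add: d_total_def sum_distrib_left exp_sum prod_ennreal prod_nonneg)
  also have "\<dots> = (\<integral>\<^sup>+th. (\<integral>\<^sup>+q. (\<Prod>c<C. ?g a (th c)) \<partial>dirichlet C alpha) \<partial>PiM {..<C} cp)"
    unfolding prior_eq using measurable_compose[OF measurable_fst pm]
    by (subst D.nn_integral_fst[symmetric]) simp_all
  also have "\<dots> = (\<integral>\<^sup>+th. (\<Prod>c<C. ?g a (th c)) \<partial>PiM {..<C} cp) * emeasure (dirichlet C alpha) (space (dirichlet C alpha))"
    using nn_integral_multc[OF pm] by simp
  also have "(\<integral>\<^sup>+th. (\<Prod>c<C. ?g a (th c)) \<partial>PiM {..<C} cp) = (\<Prod>c<C. \<integral>\<^sup>+th. ?g a th \<partial>cp c)"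
    by (rule PS.product_nn_integral_prod) (simp, rule gm')
  also have "\<dots> * emeasure (dirichlet C alpha) (space (dirichlet C alpha)) < \<infinity>"
    using fin by (auto simp: ennreal_mult_eq_top_iff ennreal_prod_eq_top less_top[symmetric])
  finally show ?thesis using a(1) by blast
qed

lemma finite_measure_prior: "finite_measure Pr"
proof (rule finite_measureI)
  obtain a where a: "a > 0" "(\<integral>\<^sup>+t. ennreal (exp (a * d_total p C t)) \<partial>Pr) < \<infinity>" using prior_exp_moment by blast
  have "emeasure Pr (space Pr) = (\<integral>\<^sup>+t. ennreal 1 \<partial>Pr)" by simp
  also have "\<dots> \<le> (\<integral>\<^sup>+t. ennreal (exp (a * d_total p C t)) \<partial>Pr)"
    using a(1) by (intro nn_integral_mono ennreal_leI) (simp add: d_total_def sum_nonneg)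
  finally show "emeasure Pr (space Pr) \<noteq> \<infinity>" using a(2) by (simp add: top_unique less_top)
qed

lemma prior_nbhd_pos:
  assumes t0: "t0 \<in> Xi n p C" and e: "\<epsilon> > 0"
  shows "\<exists>B\<in>sets Pr. B \<subseteq> Xi n p C \<and> emeasure Pr B > 0 \<and>
    (\<forall>t\<in>B. param_close n p C \<epsilon> t0 t \<and> (\<forall>c<C. snd t0 c \<le> exp \<epsilon> * snd t c))"
proof -
  interpret PS: product_sigma_finite cp by (rule product_sigma_finite_cp)
  interpret D: finite_measure "dirichlet C alpha" by (rule finite_measure_dirichlet[OF C0 alpha])
  let ?T = "stiefel_pos n p \<times> Sp p \<times> stiefel p p"
  have th0: "fst t0 c \<in> ?T" if c: "c < C" for c using Xi_compE[OF t0 c] by (metis mem_Times_iff fst_conv snd_conv)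
  let ?good = "\<lambda>c B. B \<in> sets (comp_space n p) \<and> B \<subseteq> ?T \<and> emeasure (cp c) B > 0 \<and> (\<forall>th\<in>B. comp_close n p \<epsilon> (fst t0 c) th)"
  have "\<forall>c\<in>{..<C}. \<exists>B. ?good c B"
  proof
    fix c assume "c \<in> {..<C}"
    then have c: "c < C" by simp
    show "\<exists>B. ?good c B"
      using comp_nbhd_pos[OF pn th0[OF c] e nu[OF c], of "eta c" "G c" "H c"] eta[OF c] by blast
  qed
  from bchoice[OF this] obtain B where B0: "\<forall>c\<in>{..<C}. ?good c (B c)" ..
  have B: "B c \<in> sets (comp_space n p)" "B c \<subseteq> ?T" "emeasure (cp c) (B c) > 0" if "c < C" for c
    using bspec[OF B0, of c] that by simp_all
  have Bcl: "comp_close n p \<epsilon> (fst t0 c) th" if "c < C" "th \<in> B c" for c th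
    using bspec[OF B0, of c] that by simp
  have q: "snd t0 \<in> pi_simplex C" using t0 by (auto simp: Xi_def)
  \<comment> \<open>A change of a weight below (1 - exp (- \<epsilon>)) times its value keeps it
    above exp (- \<epsilon>) times that value: the additive ball yields the multiplicative
    bound.\<close>
  define \<delta> where "\<delta> = Min ((\<lambda>c. (1 - exp (- \<epsilon>)) * snd t0 c) ` {..<C})"
  have \<delta>: "\<delta> > 0" unfolding \<delta>_def using C0 e Xi_weights(1)[OF t0] by (subst Min_gr_iff) auto
  have \<delta>le: "\<delta> \<le> (1 - exp (- \<epsilon>)) * snd t0 c" if "c < C" for c
    unfolding \<delta>_def using that by (intro Min_le) auto
  define N where "N = PiE {..<C} B \<times> weight_ball C (snd t0) \<delta>"
  have s: "PiE {..<C} B \<in> sets (PiM {..<C} cp)" "weight_ball C (snd t0) \<delta> \<in> sets (dirichlet C alpha)"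
    using B(1) by (auto intro!: sets_PiM_I_finite simp: sets_comp_prior[OF pn] sets_dirichlet weight_ball_sets)
  have "N \<in> sets Pr" unfolding N_def prior_eq by (intro pair_measureI s)
  moreover have "N \<subseteq> Xi n p C"
    unfolding N_def Xi_def Theta_def using B(2) by (intro Sigma_mono PiE_mono) (auto simp: weight_ball_def)
  moreover have "emeasure Pr N > 0"
  proof -
    have "emeasure Pr N = emeasure (PiM {..<C} cp) (PiE {..<C} B) * emeasure (dirichlet C alpha) (weight_ball C (snd t0) \<delta>)"
      unfolding N_def prior_eq by (rule D.emeasure_pair_measure_Times[OF s])
    also have "emeasure (PiM {..<C} cp) (PiE {..<C} B) = (\<Prod>c<C. emeasure (cp c) (B c))"
      using B(1) by (intro PS.emeasure_PiM) (auto simp: sets_comp_prior[OF pn])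
    finally have "emeasure Pr N = (\<Prod>c<C. emeasure (cp c) (B c)) * emeasure (dirichlet C alpha) (weight_ball C (snd t0) \<delta>)" .
    moreover have "(\<Prod>c<C. emeasure (cp c) (B c)) > 0"
      using B(3) by (intro ennreal_prod_pos) auto
    moreover have "emeasure (dirichlet C alpha) (weight_ball C (snd t0) \<delta>) > 0"
      by (rule dirichlet_ball_pos[OF q alpha \<delta>])
    ultimately show ?thesis by (simp add: ennreal_zero_less_mult_iff)
  qed
  moreover have "param_close n p C \<epsilon> t0 t" if t: "t \<in> N" for t
  proof -
    have m: "fst t c \<in> B c" if "c < C" for c
      using t that PiE_mem[of "fst t" "{..<C}" B c] by (simp add: N_def mem_Times_iff)
    show ?thesis unfolding param_close_def using Bcl m by blast
  qed
  moreover have "snd t0 c \<le> exp \<epsilon> * snd t c" if t: "t \<in> N" and c: "c < C" for t c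
  proof -
    have "\<bar>snd t c - snd t0 c\<bar> < \<delta>" using t c by (simp add: N_def mem_Times_iff weight_ball_def)
    then have "snd t0 c - (1 - exp (- \<epsilon>)) * snd t0 c \<le> snd t c" using \<delta>le[OF c] by linarith
    then have "exp (- \<epsilon>) * snd t0 c \<le> snd t c" by (simp add: algebra_simps)
    then have "exp \<epsilon> * (exp (- \<epsilon>) * snd t0 c) \<le> exp \<epsilon> * snd t c" by simp
    then show ?thesis by (simp add: mult.assoc[symmetric] flip: exp_add)
  qed
  ultimately show ?thesis by blast
qed

end

section \<open>Posterior consistency\<close>

lemma nn_integral_count_space_measurable:
  assumes Z: "countable Z" and f: "\<And>z. z \<in> Z \<Longrightarrow> f z \<in> borel_measurable M"
  shows "(\<lambda>x. \<integral>\<^sup>+z. f z x \<partial>count_space Z) \<in> borel_measurable M"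
proof -
  interpret sigma_finite_measure "count_space Z" by (rule sigma_finite_measure_count_space_countable[OF Z])
  have "(\<lambda>w. f (fst w) (snd w)) \<in> borel_measurable (count_space Z \<Otimes>\<^sub>M M)"
    by (rule measurable_pair_measure_countable1[OF Z]) (simp add: f)
  from measurable_pair_swap[OF this] have "(\<lambda>(x,z). f z x) \<in> borel_measurable (M \<Otimes>\<^sub>M count_space Z)"
    by (simp add: case_prod_beta)
  then show ?thesis by (rule borel_measurable_nn_integral)
qed

text \<open>The expression is continuous and vanishes at \<eta> = 0. Applied with a = n p + p and b
  = C, it is the root of the excess mass of an envelope.\<close>

lemma small_radius_exists:
  fixes a b e :: real
  assumes "0 < e"
  obtains \<eta> where "0 < \<eta>" "sqrt (exp (a * \<eta>) * (1 + b * \<eta>) - 1) < e"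
proof -
  have "((\<lambda>\<eta>. sqrt (exp (a * \<eta>) * (1 + b * \<eta>) - 1)) \<longlongrightarrow> sqrt (exp (a * 0) * (1 + b * 0) - 1)) (at_right 0)"
    by (intro tendsto_intros)
  then have "eventually (\<lambda>\<eta>. sqrt (exp (a * \<eta>) * (1 + b * \<eta>) - 1) < e) (at_right 0)"
    using assms by (intro order_tendstoD(2)[of _ "sqrt (exp (a * 0) * (1 + b * 0) - 1)"]) auto
  moreover have "eventually (\<lambda>\<eta>::real. 0 < \<eta>) (at_right 0)" by (rule eventually_at_right_less)
  ultimately have "eventually (\<lambda>\<eta>. sqrt (exp (a * \<eta>) * (1 + b * \<eta>) - 1) < e \<and> 0 < \<eta>) (at_right 0)"
    by eventually_elim simp
  then show ?thesis using eventually_happens'[OF trivial_limit_at_right_real] that by blast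
qed

theorem theorem6:
  fixes n p C :: nat and G H :: "nat \<Rightarrow> mat" and nu alpha :: "nat \<Rightarrow> real"
    and eta :: "nat \<Rightarrow> vec" and t0 :: param and \<epsilon> :: real
  assumes "p \<le> n"
    and "t0 \<in> Xi n p C"
    and "\<forall>c<C. nu c > 0"
    and "\<forall>c<C. \<forall>j<p. eta c j < 1"
    and "\<forall>c<C. alpha c > 0"
    and "\<epsilon> > 0"
  shows "AE xs in PiM (UNIV :: nat set) (\<lambda>_. sample_dist n p C t0).
           (\<lambda>N. posterior n p C (prior n p C G H nu eta alpha) t0 xs N
                  (Xi n p C - {t \<in> Xi n p C. hell n p C t0 t < \<epsilon>})) \<longlonglongrightarrow> 0"
proof -
  note pn = assms(1) and t0 = assms(2)
  have C0: "0 < C" by (rule Xi_weights(4)[OF t0])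
  let ?Pr = "prior n p C G H nu eta alpha"
  let ?D = "sample_dist n p C t0"
  let ?P = "PiM (UNIV :: nat set) (\<lambda>_. ?D)"
  define W where "W = Xi n p C - {t \<in> Xi n p C. hell n p C t0 t < \<epsilon>}"
  interpret Pr: finite_measure ?Pr by (rule finite_measure_prior[OF pn C0]) (use assms in auto)
  have D: "prob_space ?D" by (rule prob_space_sample_dist[OF pn t0])

  define \<kappa> where "\<kappa> = real (n * p + p)"
  \<comment> \<open>The envelopes may use up half of the affinity gap \<epsilon>^2/2.\<close>
  obtain \<eta> where \<eta>: "0 < \<eta>" "sqrt (exp (\<kappa> * \<eta>) * (1 + real C * \<eta>) - 1) < \<epsilon>\<^sup>2 / 4"
    using small_radius_exists[of "\<epsilon>\<^sup>2 / 4" \<kappa> "real C"] assms(6) by auto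
  \<comment> \<open>The bound 1/2 keeps r positive for large \<epsilon>.\<close>
  define r where "r = max (1 / 2) (1 - \<epsilon>\<^sup>2 / 4)"
  have r: "0 < r" "r < 1" "1 - \<epsilon>\<^sup>2 / 2 + sqrt (exp (\<kappa> * \<eta>) * (1 + real C * \<eta>) - 1) \<le> r"
    using \<eta>(2) assms(6) by (auto simp: r_def)
  define s where "s = sqrt r"
  have s: "0 < s" "s < 1" "r = s * s" using r by (auto simp: s_def)

  define I where "I = coord_index n p C"
  define cl where "cl = cell I (param_coord n p) \<eta>"
  have I: "finite I" by (simp add: I_def coord_index_def)
  define m where "m z = measure ?Pr {t \<in> Xi n p C. cl t = z}" for z
  have Xi: "Xi n p C \<in> sets ?Pr" using Xi_sets[OF pn] by (simp add: sets_prior[OF pn])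
  have coord: "param_coord n p i \<in> borel_measurable ?Pr" if "i \<in> I" for i
    using param_coord_measurable[OF pn] that by (simp add: I_def sets_prior[OF pn] cong: measurable_cong_sets)
  have Kfin: "(\<integral>\<^sup>+z. ennreal (sqrt (m z)) \<partial>count_space (PiE I (\<lambda>_. UNIV))) < \<infinity>"
  proof -
    obtain a where a: "a > 0" "(\<integral>\<^sup>+t. ennreal (exp (a * d_total p C t)) \<partial>?Pr) < \<infinity>"
      using prior_exp_moment[where nu=nu and eta=eta and alpha=alpha and G=G and H=H, OF pn C0] assms by blast
    \<comment> \<open>The coordinates sum to at most \<open>card I\<close> times 1 +
      \<open>d_total\<close>, so the rate a is divided by a slightly larger number.\<close>
    define a' where "a' = a / (real (card I) + 1)"
    have a': "a' > 0" using a by (simp add: a'_def)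
    have le: "a' * (\<Sum>i\<in>I. \<bar>param_coord n p i t\<bar>) \<le> a + a * d_total p C t" if t: "t \<in> Xi n p C" for t
    proof -
      have d0: "0 \<le> d_total p C t" by (simp add: d_total_def sum_nonneg)
      have "(\<Sum>i\<in>I. \<bar>param_coord n p i t\<bar>) \<le> real (card I) * (1 + d_total p C t)"
        using param_coord_le[OF t] by (intro sum_bounded_above) (simp add: I_def)
      also have "\<dots> \<le> (real (card I) + 1) * (1 + d_total p C t)" using d0 by (intro mult_right_mono) auto
      finally have "a' * (\<Sum>i\<in>I. \<bar>param_coord n p i t\<bar>) \<le> a' * ((real (card I) + 1) * (1 + d_total p C t))"
        using a' by simp
      also have "\<dots> = a' * (real (card I) + 1) * (1 + d_total p C t)" by simp
      also have "a' * (real (card I) + 1) = a" by (simp add: a'_def)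
      finally show ?thesis by (simp add: algebra_simps)
    qed
    have dm: "(\<lambda>t. ennreal (exp (a * d_total p C t))) \<in> borel_measurable ?Pr"
    proof -
      have "d_total p C \<in> borel_measurable (param_space n p C)"
        unfolding d_total_def[abs_def]
        by (intro borel_measurable_sum borel_measurable_abs param_measurable comp_measurable(2)[OF pn]) auto
      then have [measurable]: "d_total p C \<in> borel_measurable ?Pr" by (simp add: sets_prior[OF pn] cong: measurable_cong_sets)
      show ?thesis by measurable
    qed
    have "(\<integral>\<^sup>+t. indicator (Xi n p C) t * ennreal (exp (a' * (\<Sum>i\<in>I. \<bar>param_coord n p i t\<bar>))) \<partial>?Pr)
      \<le> (\<integral>\<^sup>+t. ennreal (exp a) * ennreal (exp (a * d_total p C t)) \<partial>?Pr)"
    proof (rule nn_integral_mono)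
      fix t
      show "indicator (Xi n p C) t * ennreal (exp (a' * (\<Sum>i\<in>I. \<bar>param_coord n p i t\<bar>)))
        \<le> ennreal (exp a) * ennreal (exp (a * d_total p C t))"
      proof (cases "t \<in> Xi n p C")
        case True
        then show ?thesis using le[OF True] by (simp add: ennreal_mult'[symmetric] ennreal_leI flip: exp_add)
      qed simp
    qed
    also have "\<dots> = ennreal (exp a) * (\<integral>\<^sup>+t. ennreal (exp (a * d_total p C t)) \<partial>?Pr)"
      by (rule nn_integral_cmult[OF dm])
    also have "\<dots> < \<infinity>" using a(2) by (simp add: ennreal_mult_less_top)
    finally show ?thesis unfolding m_def cl_def
      by (intro sum_sqrt_cell_measure_finite[OF Pr.finite_measure_axioms I Xi coord a' \<eta>(1)])
  qed

  \<comment> \<open>Only cells that meet \<open>W\<close>: each has a representative at Hellinger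
    distance at least \<epsilon> from the truth.\<close>
  define Z where "Z = cl ` W"
  have ZI: "Z \<subseteq> PiE I (\<lambda>_. UNIV)" by (auto simp: Z_def cl_def cell_def)
  have Zc: "countable Z" by (rule countable_subset[OF ZI countable_PiE[OF I]]) simp
  define K where "K = (\<integral>\<^sup>+z. ennreal (sqrt (m z)) \<partial>count_space Z)"
  have K: "K < \<infinity>"
  proof -
    have "K = (\<integral>\<^sup>+z. ennreal (sqrt (m z)) * indicator Z z \<partial>count_space UNIV)"
      unfolding K_def by (rule nn_integral_count_space_indicator) simp
    also have "\<dots> \<le> (\<integral>\<^sup>+z. ennreal (sqrt (m z)) * indicator (PiE I (\<lambda>_. UNIV)) z \<partial>count_space UNIV)"
      using ZI by (intro nn_integral_mono mult_left_mono) (auto simp: indicator_def)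
    also have "\<dots> = (\<integral>\<^sup>+z. ennreal (sqrt (m z)) \<partial>count_space (PiE I (\<lambda>_. UNIV)))"
      by (rule nn_integral_count_space_indicator[symmetric]) simp
    finally show ?thesis using Kfin by (rule order_le_less_trans)
  qed
  define rep where "rep = inv_into W cl"
  have rep: "rep z \<in> W" "cl (rep z) = z" if "z \<in> Z" for z
    using that inv_into_into[of z cl W] f_inv_into_f[of z cl W] by (simp_all add: Z_def rep_def)
  have repXi: "rep z \<in> Xi n p C" "\<epsilon> \<le> hell n p C t0 (rep z)" if "z \<in> Z" for z
    using rep(1)[OF that] by (auto simp: W_def)
  define \<rho> where "\<rho> z X = mix_envelope n p C \<eta> (rep z) X / fmix n p C t0 X" for z X
  have f0: "0 < fmix n p C t0 X" for X by (rule fmix_pos[OF pn t0])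
  let ?R = "\<lambda>(N :: nat) z (xs :: nat \<Rightarrow> mat). ennreal (sqrt (m z)) * (\<Prod>i<N. ennreal (sqrt (\<rho> z (xs i))))"
  \<comment> \<open>Each term is the square root of a bound for the integral of the likelihood ratio
    over one cell; the square of \<open>Y N\<close> will dominate the numerator.\<close>
  define Y where "Y N xs = (\<integral>\<^sup>+z. ?R N z xs \<partial>count_space Z)" for N :: nat and xs :: "nat \<Rightarrow> mat"

  have \<rho>m: "(\<lambda>X. ennreal (sqrt (\<rho> z X))) \<in> borel_measurable ?D" for z
  proof -
    have [measurable]: "mix_envelope n p C \<eta> (rep z) \<in> borel_measurable ?D" "fmix n p C t0 \<in> borel_measurable ?D"
      using mix_envelope_measurable[of n p C \<eta> "rep z"] fmix_measurable[of n p C t0]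
      by (simp_all add: sample_dist_def measurable_haar[OF pn])
    show ?thesis unfolding \<rho>_def by measurable
  qed
  have \<rho>c: "(\<lambda>xs. ennreal (sqrt (\<rho> z (xs i)))) \<in> borel_measurable ?P" for z i
    using measurable_component_singleton[of i UNIV "\<lambda>_. ?D"] by (intro measurable_compose[OF _ \<rho>m]) simp
  have pm: "(\<lambda>xs. ?R N z xs) \<in> borel_measurable ?P" for z and N :: nat
    by (intro borel_measurable_times_ennreal borel_measurable_const borel_measurable_prod_ennreal \<rho>c)
  have Ym: "Y N \<in> borel_measurable ?P" for N
    unfolding Y_def[abs_def] by (intro nn_integral_count_space_measurable Zc pm)
  have EY: "(\<integral>\<^sup>+xs. Y N xs \<partial>?P) \<le> K * ennreal (r ^ N)" for N
  proof -
    have "(\<integral>\<^sup>+xs. Y N xs \<partial>?P) = (\<integral>\<^sup>+z. (\<integral>\<^sup>+xs. ?R N z xs \<partial>?P) \<partial>count_space Z)"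
      unfolding Y_def by (rule nn_integral_count_space_nn_integral[OF Zc pm])
    also have "\<dots> \<le> (\<integral>\<^sup>+z. ennreal (sqrt (m z)) * ennreal (r ^ N) \<partial>count_space Z)"
    proof (rule nn_integral_mono)
      fix z assume "z \<in> space (count_space Z)"
      then have z: "z \<in> Z" by simp
      have "(\<lambda>xs. \<Prod>i<N. ennreal (sqrt (\<rho> z (xs i)))) \<in> borel_measurable ?P"
        by (intro borel_measurable_prod_ennreal \<rho>c)
      then have "(\<integral>\<^sup>+xs. ?R N z xs \<partial>?P)
        = ennreal (sqrt (m z)) * (\<integral>\<^sup>+xs. (\<Prod>i<N. ennreal (sqrt (\<rho> z (xs i)))) \<partial>?P)"
        by (rule nn_integral_cmult)
      also have "(\<integral>\<^sup>+xs. (\<Prod>i<N. ennreal (sqrt (\<rho> z (xs i)))) \<partial>?P) = (\<integral>\<^sup>+X. ennreal (sqrt (\<rho> z X)) \<partial>?D) ^ N"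
        by (rule nn_integral_PiM_prod_iid[OF D \<rho>m])
      also have "(\<integral>\<^sup>+X. ennreal (sqrt (\<rho> z X)) \<partial>?D) \<le> ennreal r"
        using nn_integral_sample_sqrt_ratio[OF pn t0 repXi[OF z] less_imp_le[OF assms(6)] \<eta>(1)] r(3)
        unfolding \<rho>_def \<kappa>_def by (meson ennreal_leI order_trans)
      then have "(\<integral>\<^sup>+X. ennreal (sqrt (\<rho> z X)) \<partial>?D) ^ N \<le> ennreal (r ^ N)"
        using r(1) by (subst ennreal_power[symmetric]) (auto intro: power_mono)
      finally show "(\<integral>\<^sup>+xs. ?R N z xs \<partial>?P) \<le> ennreal (sqrt (m z)) * ennreal (r ^ N)"
        by (simp add: mult_left_mono)
    qed
    also have "\<dots> = K * ennreal (r ^ N)" unfolding K_def by (rule nn_integral_multc) simp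
    finally show ?thesis .
  qed

  \<comment> \<open>Since \<open>Y N\<close> has mean at most K r^N and r = s^2, the expectation of
    T is at most K times a geometric series in s. Where T is finite, \<open>Y N\<close> is at most
    s^N T for all N at once.\<close>
  define T where "T xs = (\<Sum>N. ennreal (1 / s ^ N) * Y N xs)" for xs
  have "AE xs in ?P. T xs \<noteq> \<infinity>"
  proof (rule nn_integral_PInf_AE)
    show "T \<in> borel_measurable ?P" unfolding T_def[abs_def] using Ym by measurable
    have "(\<integral>\<^sup>+xs. T xs \<partial>?P) = (\<Sum>N. \<integral>\<^sup>+xs. ennreal (1 / s ^ N) * Y N xs \<partial>?P)"
      unfolding T_def using Ym by (intro nn_integral_suminf) measurable
    also have "\<dots> \<le> (\<Sum>N. K * ennreal (s ^ N))"
    proof (rule suminf_le)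
      fix N
      have "(\<integral>\<^sup>+xs. ennreal (1 / s ^ N) * Y N xs \<partial>?P) = ennreal (1 / s ^ N) * (\<integral>\<^sup>+xs. Y N xs \<partial>?P)"
        by (rule nn_integral_cmult[OF Ym])
      also have "\<dots> \<le> ennreal (1 / s ^ N) * (K * ennreal (r ^ N))" by (intro mult_left_mono EY) simp
      also have "\<dots> = K * (ennreal (1 / s ^ N) * ennreal (r ^ N))"
        by (simp only: mult_ac)
      also have "ennreal (1 / s ^ N) * ennreal (r ^ N) = ennreal (1 / s ^ N * r ^ N)"
        using s(1) r(1) by (intro ennreal_mult[symmetric]) auto
      also have "1 / s ^ N * r ^ N = s ^ N" using s by (simp add: power_mult_distrib)
      finally show "(\<integral>\<^sup>+xs. ennreal (1 / s ^ N) * Y N xs \<partial>?P) \<le> K * ennreal (s ^ N)" .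
    qed auto
    also have "\<dots> = K * (\<Sum>N. ennreal (s ^ N))" by (rule ennreal_suminf_cmult)
    also have "\<dots> < \<infinity>"
    proof -
      have "summable (\<lambda>N. s ^ N)" using s by (intro summable_geometric) simp
      then have "(\<Sum>N. ennreal (s ^ N)) \<noteq> top" using s by (intro ennreal_suminf_neq_top) auto
      then show ?thesis using K by (simp add: ennreal_mult_less_top less_top)
    qed
    finally show "(\<integral>\<^sup>+xs. T xs \<partial>?P) \<noteq> \<infinity>" by simp
  qed
  \<comment> \<open>The comparisons of densities hold on the manifold only, so one null set is
    discarded for all observations together.\<close>
  moreover have "AE xs in ?P. \<forall>i. xs i \<in> stiefel n p"
    unfolding AE_all_countable by (intro allI AE_PiM_component D AE_sample_dist_stiefel[OF pn]) auto
  ultimately show ?thesis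
  proof eventually_elim
    case (elim xs)
    have st: "xs i \<in> stiefel n p" for i using elim(2) by simp
    let ?num = "\<lambda>N. \<integral>\<^sup>+t. indicator W t * ennreal (lik_ratio n p C t0 xs N t) \<partial>?Pr"
    let ?den = "\<lambda>N. \<integral>\<^sup>+t. indicator (Xi n p C) t * ennreal (lik_ratio n p C t0 xs N t) \<partial>?Pr"
    have YT: "Y N xs \<le> ennreal (s ^ N) * T xs" for N
    proof -
      have "ennreal (1 / s ^ N) * Y N xs \<le> T xs"
        unfolding T_def using sum_le_suminf[of "\<lambda>N. ennreal (1 / s ^ N) * Y N xs" "{N}"] by simp
      then have "ennreal (s ^ N) * (ennreal (1 / s ^ N) * Y N xs) \<le> ennreal (s ^ N) * T xs" by (rule mult_left_mono) simp
      moreover have "ennreal (s ^ N) * (ennreal (1 / s ^ N) * Y N xs) = Y N xs"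
        using s(1) by (simp add: mult.assoc[symmetric] flip: ennreal_mult')
      ultimately show ?thesis by simp
    qed
    have num: "?num N \<le> Y N xs * Y N xs" for N
    proof -
      let ?A = "\<lambda>z. {t \<in> Xi n p C. cl t = z}"
      let ?q = "\<lambda>z. ennreal (\<Prod>i<N. \<rho> z (xs i))"
      have A: "?A z \<in> sets ?Pr" if "z \<in> Z" for z
        unfolding cl_def using that ZI by (intro cell_sets[OF I Xi coord]) auto
      have \<rho>0: "0 \<le> \<rho> z X" if z: "z \<in> Z" and X: "X \<in> stiefel n p" for z X
      proof -
        have "0 < fmix n p C (rep z) X" by (rule fmix_pos[OF pn repXi(1)[OF z]])
        also have "\<dots> \<le> mix_envelope n p C \<eta> (rep z) X"
          using fmix_le_envelope_self[OF pn repXi(1)[OF z] _ X] \<eta>(1) by simp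
        finally show ?thesis using f0[of X] by (simp add: \<rho>_def)
      qed
      have "?num N \<le> (\<integral>\<^sup>+t. (\<integral>\<^sup>+z. indicator (?A z) t * ?q z \<partial>count_space Z) \<partial>?Pr)"
      proof (rule nn_integral_mono)
        fix t
        show "indicator W t * ennreal (lik_ratio n p C t0 xs N t) \<le> (\<integral>\<^sup>+z. indicator (?A z) t * ?q z \<partial>count_space Z)"
        proof (cases "t \<in> W")
          case True
          then have t: "t \<in> Xi n p C" and z: "cl t \<in> Z" by (auto simp: W_def Z_def)
          have cleq: "cell (coord_index n p C) (param_coord n p) \<eta> t = cell (coord_index n p C) (param_coord n p) \<eta> (rep (cl t))"
            using rep(2)[OF z] by (simp add: cl_def I_def)
          \<comment> \<open>Every factor is bounded by the envelope of the representative of the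
            cell of t.\<close>
          have "lik_ratio n p C t0 xs N t \<le> (\<Prod>i<N. \<rho> (cl t) (xs i))"
            unfolding lik_ratio_def \<rho>_def
          proof (intro prod_mono conjI divide_right_mono)
            fix i
            show "fmix n p C t (xs i) \<le> mix_envelope n p C \<eta> (rep (cl t)) (xs i)"
              using param_coord_close[OF cleq \<eta>(1)] by (intro fmix_le_envelope[OF pn _ _ t st]) auto
            show "0 \<le> fmix n p C t0 (xs i)" "0 \<le> fmix n p C t (xs i) / fmix n p C t0 (xs i)"
              using f0[of "xs i"] fmix_pos[OF pn t, of "xs i"] by auto
          qed
          then have "indicator W t * ennreal (lik_ratio n p C t0 xs N t) \<le> indicator (?A (cl t)) t * ?q (cl t)"
            using t True by (simp add: ennreal_leI)
          also have "\<dots> \<le> (\<integral>\<^sup>+z. indicator (?A z) t * ?q z \<partial>count_space Z)" by (rule nn_integral_ge_point[OF z])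
          finally show ?thesis .
        qed simp
      qed
      also have "\<dots> = (\<integral>\<^sup>+z. (\<integral>\<^sup>+t. indicator (?A z) t * ?q z \<partial>?Pr) \<partial>count_space Z)"
        using A by (intro nn_integral_count_space_nn_integral[OF Zc]) auto
      also have "\<dots> = (\<integral>\<^sup>+z. ?R N z xs
          * ?R N z xs \<partial>count_space Z)"
      proof (rule nn_integral_cong)
        fix z assume "z \<in> space (count_space Z)"
        then have z: "z \<in> Z" by simp
        have q: "?q z = ennreal (\<Prod>i<N. sqrt (\<rho> z (xs i))) * ennreal (\<Prod>i<N. sqrt (\<rho> z (xs i)))"
          using \<rho>0[OF z st] by (simp add: ennreal_mult'[symmetric] prod_nonneg flip: prod.distrib)
        have "(\<integral>\<^sup>+t. indicator (?A z) t * ?q z \<partial>?Pr) = ennreal (m z) * ?q z"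
          using A[OF z] by (simp add: nn_integral_multc Pr.emeasure_eq_measure m_def)
        also have "ennreal (m z) = ennreal (sqrt (m z)) * ennreal (sqrt (m z))"
          by (simp add: ennreal_mult'[symmetric] m_def)
        finally show "(\<integral>\<^sup>+t. indicator (?A z) t * ?q z \<partial>?Pr) = ?R N z xs
          * ?R N z xs"
          using \<rho>0[OF z st] unfolding q by (simp add: prod_ennreal mult_ac)
      qed
      also have "\<dots> \<le> Y N xs * Y N xs" unfolding Y_def by (rule nn_integral_count_space_square_le)
      finally show ?thesis .
    qed

    \<comment> \<open>Chosen so that the factor of \<open>fmix_le_fmix\<close> is exactly 1 / s for
      each observation.\<close>
    define \<beta> where "\<beta> = - ln s / real (n * p + p + 1)"
    have k: "0 < real (n * p + p + 1)" by (subst of_nat_0_less_iff) simp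
    have \<beta>: "\<beta> > 0" unfolding \<beta>_def using s(1,2) by (intro divide_pos_pos[OF _ k]) simp
    have "real (n * p + p + 1) * \<beta> = - ln s"
      unfolding \<beta>_def times_divide_eq_right by (rule nonzero_mult_div_cancel_left) (use k in linarith)
    then have e\<beta>: "exp (real (n * p + p + 1) * \<beta>) = 1 / s" using s(1) by (simp only: exp_minus exp_ln inverse_eq_divide)
    have "\<exists>B\<in>sets ?Pr. B \<subseteq> Xi n p C \<and> emeasure ?Pr B > 0 \<and>
      (\<forall>t\<in>B. param_close n p C \<beta> t0 t \<and> (\<forall>c<C. snd t0 c \<le> exp \<beta> * snd t c))"
      by (rule prior_nbhd_pos[OF pn C0 _ _ _ t0 \<beta>]) (use assms in auto)
    then obtain B where "B \<in> sets ?Pr" "B \<subseteq> Xi n p C \<and> emeasure ?Pr B > 0 \<and>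
      (\<forall>t\<in>B. param_close n p C \<beta> t0 t \<and> (\<forall>c<C. snd t0 c \<le> exp \<beta> * snd t c))" ..
    then have B: "B \<in> sets ?Pr" "B \<subseteq> Xi n p C" "emeasure ?Pr B > 0"
      "\<And>t. t \<in> B \<Longrightarrow> param_close n p C \<beta> t0 t" "\<And>t c. t \<in> B \<Longrightarrow> c < C \<Longrightarrow> snd t0 c \<le> exp \<beta> * snd t c"
      by simp_all
    define b where "b = measure ?Pr B"
    have b: "b > 0" "emeasure ?Pr B = ennreal b" using B(3) by (simp_all add: b_def Pr.emeasure_eq_measure)
    have den: "ennreal (s ^ N) * ennreal b \<le> ?den N" for N
    proof -
      have "ennreal (s ^ N) * ennreal b = (\<integral>\<^sup>+t. indicator B t * ennreal (s ^ N) \<partial>?Pr)"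
        using B(1) by (simp add: nn_integral_multc b(2) mult.commute)
      also have "\<dots> \<le> ?den N"
      proof (rule nn_integral_mono)
        fix t
        show "indicator B t * ennreal (s ^ N) \<le> indicator (Xi n p C) t * ennreal (lik_ratio n p C t0 xs N t)"
        proof (cases "t \<in> B")
          case True
          then have t: "t \<in> Xi n p C" using B(2) by blast
          have "(\<Prod>i<N. s) \<le> lik_ratio n p C t0 xs N t"
            unfolding lik_ratio_def
          proof (intro prod_mono conjI)
            fix i
            have "fmix n p C t0 (xs i) \<le> 1 / s * fmix n p C t (xs i)"
              using fmix_le_fmix[OF pn B(4)[OF True] B(5)[OF True] t st] unfolding e\<beta> by simp
            then show "s \<le> fmix n p C t (xs i) / fmix n p C t0 (xs i)"
              using s(1) f0[of "xs i"] by (simp add: field_simps)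
            show "0 \<le> s" using s by simp
          qed
          then show ?thesis using True t by (simp add: ennreal_leI)
        qed simp
      qed
      finally show ?thesis .
    qed
    obtain \<tau> where \<tau>: "0 \<le> \<tau>" "T xs = ennreal \<tau>" using elim(1) by (cases "T xs") auto
    \<comment> \<open>The numerator is at most s^(2 N) \<tau>^2 and the denominator at least s^N b,
      so one factor s^N remains.\<close>
    have le: "posterior n p C ?Pr t0 xs N W \<le> ennreal (s ^ N * (\<tau> * \<tau> / b))" for N
      unfolding posterior_def
    proof (rule divide_le_posI_ennreal)
      have sN: "0 < s ^ N" using s by simp
      then have "0 < ennreal (s ^ N) * ennreal b" using b by (simp add: ennreal_zero_less_mult_iff)
      then show "0 < ?den N" using den[of N] by order
      have "?num N \<le> (ennreal (s ^ N) * T xs) * (ennreal (s ^ N) * T xs)"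
        using num[of N] YT[of N] by (meson mult_mono order_trans zero_le)
      also have "\<dots> = ennreal (s ^ N) * ennreal b * ennreal (s ^ N * (\<tau> * \<tau> / b))"
        using sN b(1) \<tau> by (simp add: ennreal_mult'[symmetric] mult_ac)
      also have "\<dots> \<le> ?den N * ennreal (s ^ N * (\<tau> * \<tau> / b))" by (intro mult_right_mono den) simp
      finally show "?num N \<le> ?den N * ennreal (s ^ N * (\<tau> * \<tau> / b))" .
    qed
    have "(\<lambda>N. s ^ N * (\<tau> * \<tau> / b)) \<longlonglongrightarrow> 0 * (\<tau> * \<tau> / b)"
      using s by (intro tendsto_mult LIMSEQ_power_zero tendsto_const) simp
    then have lim: "(\<lambda>N. ennreal (s ^ N * (\<tau> * \<tau> / b))) \<longlonglongrightarrow> 0"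
      using tendsto_ennrealI by fastforce
    have "(\<lambda>N. posterior n p C ?Pr t0 xs N W) \<longlonglongrightarrow> 0"
      by (rule tendsto_sandwich[OF _ _ tendsto_const lim]) (simp, rule always_eventually, rule allI, rule le)
    then show ?case by (simp only: W_def)
  qed
qed

end
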